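(* Let $\mathcal T=(T,E)$ be an infinite $d$-regular tree with $d\ge3$ (each vertex has exactly $d$ neighbours), endowed with constant conductances $W$, with root $\phi$. Then for $W$ large enough, the distribution $\mathcal R_{ind}$ of the random environment of independent inverse Gaussian type representing $P^{VRJP(\phi)}$ is different from the distribution $\mathcal R_{st}$ of the standard representation of $P^{VRJP(\phi)}$ (both defined in the context).
   Context: Both $\mathcal R_{ind}$ and $\mathcal R_{st}$ are probability distributions on families $r=(r_{i,j})_{i\sim j}$ of nonnegative jump rates (one for each ordered pair of neighbours in $\mathcal T$). $P^{VRJP(\phi)}$ is the law of the time-changed Vertex Reinforced Jump Process on $\mathcal T$ started at $\phi$: the VRJP $(Y_s)$ jumps at time $s$ from $i=Y_s$ to a neighbour $j$ at rate $W_{i,j}L_j(s)$, $L_j(s)=1+\int_0^s\mathbf 1_{\{Y_u=j\}}du$, and $Z_t=Y_{D^{-1}(t)}$ with $D(s)=\sum_i(L_i(s)^2-1)$. Both environments are known to represent $P^{VRJP(\phi)}$ as a mixture of Markov jump processes. $\mathcal R_{ind}$: for $i\in T\setminus\{\phi\}$ let $\overleftarrow i$ be its parent and let $(A_i)_{i\in T\setminus\{\phi\}}$ be independent with $\mathbb P[A_i\in ds]=\mathbf 1_{s\ge0}\sqrt{\frac{W}{2\pi s^3}}e^{-W\frac{(s-1)^2}{2s}}ds$ (inverse Gaussian with parameter $(W,1)$). $\mathcal R_{ind}$ is the law of the rates $r_{\overleftarrow i,i}=\frac12WA_i$, $r_{i,\overleftarrow i}=\frac12W/A_i$. $\mathcal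 R_{st}$: let $W_{i,j}=W$ if $i\sim j$, $0$ otherwise, and for $\beta\in\mathbb R^T$ let $(H_\beta f)(i)=2\beta_if(i)-\sum_{j\sim i}W_{i,j}f(j)$. For finite $U$ and $\eta\in\mathbb R_+^U$, $\nu_U^{W_{U,U},\eta}$ is the probability measure on $\{\beta\in\mathbb R^U:H_\beta=2\beta-W_{U,U}>0\}$ (positive definite) with density $(2/\pi)^{|U|/2}e^{-\frac12(\langle\mathbf 1,H_\beta\mathbf 1\rangle+\langle\eta,H_\beta^{-1}\eta\rangle)+\langle\eta,\mathbf 1\rangle}(\det H_\beta)^{-1/2}$ with respect to $\prod_{i\in U}d\beta_i$; $\nu_T^W$ is the unique probability on $\{\beta\in\mathbb R^T:(H_\beta)_{U,U}>0\ \forall\text{ finite }U\}$ such that $\beta_U\sim\nu_U^{W_{U,U},\eta}$ with $\eta=W_{U,U^c}\mathbf 1_{U^c}$ for every finite $U\subset T$. Let $(V_n)$ be an increasing sequence of finite connected subsets exhausting $T$, $\hat G^{(n)}=((H_\beta)_{V_n,V_n})^{-1}$, and $\psi^{(n)}$ defined by $(H_\beta\psi^{(n)})_{V_n}=0$, $\psi^{(n)}=1$ off $V_n$. Under $\nu_T^W$, a.s. $\hat G^{(n)}(i,j)\to\hat G(i,j)<\infty$ and $\psi^{(n)}(i)\to\psi(i)$. Let $\gamma$ be independent of $\beta$ with density $\frac{\mathbf 1_{\{\gamma>0\}}}{\sqrt{\pi\gamma}}e^{-\gamma}$, and $G(i,j)=\hat G(i,j)+\frac1{2\gamma}\psi(i)\psi(j)$.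 $\mathcal R_{st}$ is the law of the rates $r_{i,j}=\frac12W_{i,j}\frac{G(\phi,j)}{G(\phi,i)}$. *)

theory Defs
  imports "HOL-Probability.Probability"
begin

section \<open>Trees\<close>

text \<open>A simple graph is given by its vertex set \<open>T\<close> and its set \<open>E\<close> of two-element edges; \<open>i\<close> and
  \<open>j\<close> are neighbours iff \<open>{i, j} \<in> E\<close>.\<close>

definition simple_graph :: "'v set \<Rightarrow> 'v set set \<Rightarrow> bool" where
  "simple_graph T E \<longleftrightarrow> (\<forall>e\<in>E. \<exists>i\<in>T. \<exists>j\<in>T. i \<noteq> j \<and> e = {i, j})"

definition nbrs :: "'v set set \<Rightarrow> 'v \<Rightarrow> 'v set" where
  "nbrs E i = {j. {i, j} \<in> E}"

definition darts :: "'v set set \<Rightarrow> ('v \<times> 'v) set" where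
  "darts E = {(i, j). {i, j} \<in> E}"

definition walk :: "'v set set \<Rightarrow> 'v list \<Rightarrow> bool" where
  "walk E xs \<longleftrightarrow> xs \<noteq> [] \<and> successively (\<lambda>i j. {i, j} \<in> E) xs"

definition connected_in :: "'v set set \<Rightarrow> 'v set \<Rightarrow> bool" where
  "connected_in E S \<longleftrightarrow>
     (\<forall>i\<in>S. \<forall>j\<in>S. \<exists>xs. walk E xs \<and> set xs \<subseteq> S \<and> hd xs = i \<and> last xs = j)"

definition cycle :: "'v set set \<Rightarrow> 'v list \<Rightarrow> bool" where
  "cycle E xs \<longleftrightarrow> 3 \<le> length xs \<and> distinct xs \<and> walk E xs \<and> {last xs, hd xs} \<in> E"

definition tree :: "'v set \<Rightarrow> 'v set set \<Rightarrow> bool" where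
  "tree T E \<longleftrightarrow> simple_graph T E \<and> T \<noteq> {} \<and> connected_in E T \<and> (\<nexists>xs. cycle E xs)"

definition regular :: "'v set \<Rightarrow> 'v set set \<Rightarrow> nat \<Rightarrow> bool" where
  "regular T E d \<longleftrightarrow> (\<forall>i\<in>T. finite (nbrs E i) \<and> card (nbrs E i) = d)"

text \<open>The parent of a vertex \<open>i\<close> other than the root is the vertex preceding \<open>i\<close> on the simple path
  from the root to \<open>i\<close>. At the root itself \<open>parent\<close> is unspecified.\<close>

definition parent :: "'v set set \<Rightarrow> 'v \<Rightarrow> 'v \<Rightarrow> 'v" where
  "parent E \<phi> i = (THE j. \<exists>xs. walk E (xs @ [j, i]) \<and> distinct (xs @ [j, i]) \<and> hd (xs @ [j, i]) = \<phi>)"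

definition exhaustion :: "'v set \<Rightarrow> 'v set set \<Rightarrow> (nat \<Rightarrow> 'v set) \<Rightarrow> bool" where
  "exhaustion T E V \<longleftrightarrow> incseq V \<and> (\<forall>n. finite (V n) \<and> connected_in E (V n)) \<and> (\<Union>n. V n) = T"

text \<open>The conductances \<open>W\<^bsub>i,j\<^esub>\<close> equal to the constant \<open>W\<close> on the edges.\<close>

definition cond :: "'v set set \<Rightarrow> real \<Rightarrow> 'v \<Rightarrow> 'v \<Rightarrow> real" where
  "cond E W i j = (if {i, j} \<in> E then W else 0)"


section \<open>The environment of independent inverse Gaussian variables\<close>

definition inv_gauss_density :: "real \<Rightarrow> real \<Rightarrow> real" where
  "inv_gauss_density W s =
     indicator {0..} s * sqrt (W / (2 * pi * s ^ 3)) * exp (- W * (s - 1)\<^sup>2 / (2 * s))"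

definition inv_gauss :: "real \<Rightarrow> real measure" where
  "inv_gauss W = density lborel (\<lambda>s. ennreal (inv_gauss_density W s))"

text \<open>Environments, here and below, are families of reals indexed by the ordered pairs of neighbours,
  with the product \<open>\<sigma>\<close>-algebra.\<close>

definition ind_rates :: "'v set set \<Rightarrow> 'v \<Rightarrow> real \<Rightarrow> ('v \<Rightarrow> real) \<Rightarrow> 'v \<times> 'v \<Rightarrow> real" where
  "ind_rates E \<phi> W A =
     (\<lambda>(i, j)\<in>darts E. if j \<noteq> \<phi> \<and> i = parent E \<phi> j then 1/2 * W * A j else 1/2 * W / A i)"

definition R_ind :: "'v set \<Rightarrow> 'v set set \<Rightarrow> 'v \<Rightarrow> real \<Rightarrow> ('v \<times> 'v \<Rightarrow> real) measure" where
  "R_ind T E \<phi> W =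
     distr (\<Pi>\<^sub>M i\<in>T - {\<phi>}. inv_gauss W) (\<Pi>\<^sub>M e\<in>darts E. borel) (ind_rates E \<phi> W)"


section \<open>Matrices indexed by finite sets\<close>

text \<open>A matrix indexed by \<open>U \<times> U\<close> is a function of two vertices of which only the values on
  \<open>U \<times> U\<close> matter. The determinant is the Leibniz formula, as in the library for finite index types;
  the inverse is extended by \<open>0\<close> outside \<open>U \<times> U\<close>.\<close>

definition det_on :: "'v set \<Rightarrow> ('v \<Rightarrow> 'v \<Rightarrow> real) \<Rightarrow> real" where
  "det_on U A = (\<Sum>p | p permutes U. of_int (sign p) * (\<Prod>i\<in>U. A i (p i)))"

definition inverse_on :: "'v set \<Rightarrow> ('v \<Rightarrow> 'v \<Rightarrow> real) \<Rightarrow> 'v \<Rightarrow> 'v \<Rightarrow> real" where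
  "inverse_on U A = (THE B.
     (\<forall>i j. i \<notin> U \<or> j \<notin> U \<longrightarrow> B i j = 0) \<and>
     (\<forall>i\<in>U. \<forall>j\<in>U. (\<Sum>k\<in>U. A i k * B k j) = (if i = j then 1 else 0)) \<and>
     (\<forall>i\<in>U. \<forall>j\<in>U. (\<Sum>k\<in>U. B i k * A k j) = (if i = j then 1 else 0)))"

definition form_on :: "'v set \<Rightarrow> ('v \<Rightarrow> 'v \<Rightarrow> real) \<Rightarrow> ('v \<Rightarrow> real) \<Rightarrow> real" where
  "form_on U A f = (\<Sum>i\<in>U. \<Sum>j\<in>U. f i * A i j * f j)"

text \<open>Used for symmetric matrices only.\<close>

definition pos_def_on :: "'v set \<Rightarrow> ('v \<Rightarrow> 'v \<Rightarrow> real) \<Rightarrow> bool" where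
  "pos_def_on U A \<longleftrightarrow> (\<forall>f. (\<exists>i\<in>U. f i \<noteq> 0) \<longrightarrow> 0 < form_on U A f)"


section \<open>The random potential\<close>

definition H_op :: "'v set set \<Rightarrow> real \<Rightarrow> ('v \<Rightarrow> real) \<Rightarrow> ('v \<Rightarrow> real) \<Rightarrow> 'v \<Rightarrow> real" where
  "H_op E W \<beta> f i = 2 * \<beta> i * f i - (\<Sum>j\<in>nbrs E i. cond E W i j * f j)"

definition H_mat :: "'v set set \<Rightarrow> real \<Rightarrow> ('v \<Rightarrow> real) \<Rightarrow> 'v \<Rightarrow> 'v \<Rightarrow> real" where
  "H_mat E W \<beta> i j = (if i = j then 2 * \<beta> i else 0) - cond E W i j"

definition nu_density ::
    "'v set set \<Rightarrow> real \<Rightarrow> 'v set \<Rightarrow> ('v \<Rightarrow> real) \<Rightarrow> ('v \<Rightarrow> real) \<Rightarrow> real" where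
  "nu_density E W U \<eta> \<beta> =
     (if pos_def_on U (H_mat E W \<beta>) then
        (2 / pi) powr (real (card U) / 2) *
        exp (- 1/2 * (form_on U (H_mat E W \<beta>) (\<lambda>_. 1) +
                      form_on U (inverse_on U (H_mat E W \<beta>)) \<eta>) + (\<Sum>i\<in>U. \<eta> i)) *
        det_on U (H_mat E W \<beta>) powr (- 1/2)
      else 0)"

definition nu_fin ::
    "'v set set \<Rightarrow> real \<Rightarrow> 'v set \<Rightarrow> ('v \<Rightarrow> real) \<Rightarrow> ('v \<Rightarrow> real) measure" where
  "nu_fin E W U \<eta> = density (\<Pi>\<^sub>M i\<in>U. lborel) (\<lambda>\<beta>. ennreal (nu_density E W U \<eta> \<beta>))"

text \<open>The vector \<open>W\<^bsub>U,U\<^sup>c\<^esub> 1\<close>; only neighbours contribute.\<close>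

definition boundary_weight :: "'v set set \<Rightarrow> real \<Rightarrow> 'v set \<Rightarrow> 'v \<Rightarrow> real" where
  "boundary_weight E W U i = (\<Sum>j\<in>nbrs E i - U. cond E W i j)"

definition pos_potentials :: "'v set \<Rightarrow> 'v set set \<Rightarrow> real \<Rightarrow> ('v \<Rightarrow> real) set" where
  "pos_potentials T E W =
     {\<beta> \<in> extensional T. \<forall>U. finite U \<and> U \<subseteq> T \<longrightarrow> pos_def_on U (H_mat E W \<beta>)}"

text \<open>The underlying space of \<open>nu T E W\<close> is \<open>pos_potentials T E W\<close> itself, so that the matrices
  \<open>H_mat E W \<beta>\<close> below are invertible for every \<open>\<beta>\<close> of the space.\<close>

definition nu :: "'v set \<Rightarrow> 'v set set \<Rightarrow> real \<Rightarrow> ('v \<Rightarrow> real) measure" where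
  "nu T E W = (THE N.
     prob_space N \<and>
     sets N = sets (restrict_space (\<Pi>\<^sub>M i\<in>T. borel) (pos_potentials T E W)) \<and>
     (\<forall>U. finite U \<and> U \<subseteq> T \<longrightarrow>
        distr N (\<Pi>\<^sub>M i\<in>U. lborel) (\<lambda>\<beta>. restrict \<beta> U) = nu_fin E W U (boundary_weight E W U)))"


section \<open>The standard environment\<close>

definition Ghat_n :: "'v set set \<Rightarrow> real \<Rightarrow> 'v set \<Rightarrow> ('v \<Rightarrow> real) \<Rightarrow> 'v \<Rightarrow> 'v \<Rightarrow> real" where
  "Ghat_n E W V \<beta> = inverse_on V (H_mat E W \<beta>)"

definition psi_n :: "'v set set \<Rightarrow> real \<Rightarrow> 'v set \<Rightarrow> ('v \<Rightarrow> real) \<Rightarrow> 'v \<Rightarrow> real" where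
  "psi_n E W V \<beta> = (THE f. (\<forall>i\<in>V. H_op E W \<beta> f i = 0) \<and> (\<forall>i. i \<notin> V \<longrightarrow> f i = 1))"

definition Ghat :: "'v set set \<Rightarrow> real \<Rightarrow> (nat \<Rightarrow> 'v set) \<Rightarrow> ('v \<Rightarrow> real) \<Rightarrow> 'v \<Rightarrow> 'v \<Rightarrow> real" where
  "Ghat E W V \<beta> i j = lim (\<lambda>n. Ghat_n E W (V n) \<beta> i j)"

definition psi :: "'v set set \<Rightarrow> real \<Rightarrow> (nat \<Rightarrow> 'v set) \<Rightarrow> ('v \<Rightarrow> real) \<Rightarrow> 'v \<Rightarrow> real" where
  "psi E W V \<beta> i = lim (\<lambda>n. psi_n E W (V n) \<beta> i)"

definition gamma_half :: "real measure" where
  "gamma_half = density lborel (\<lambda>x. ennreal (indicator {0<..} x / sqrt (pi * x) * exp (- x)))"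

definition Green ::
    "'v set set \<Rightarrow> real \<Rightarrow> (nat \<Rightarrow> 'v set) \<Rightarrow> ('v \<Rightarrow> real) \<Rightarrow> real \<Rightarrow> 'v \<Rightarrow> 'v \<Rightarrow> real" where
  "Green E W V \<beta> \<gamma> i j = Ghat E W V \<beta> i j + 1 / (2 * \<gamma>) * psi E W V \<beta> i * psi E W V \<beta> j"

definition st_rates ::
    "'v set set \<Rightarrow> 'v \<Rightarrow> real \<Rightarrow> (nat \<Rightarrow> 'v set) \<Rightarrow> ('v \<Rightarrow> real) \<times> real \<Rightarrow> 'v \<times> 'v \<Rightarrow> real" where
  "st_rates E \<phi> W V = (\<lambda>(\<beta>, \<gamma>). \<lambda>(i, j)\<in>darts E.
     1/2 * cond E W i j * (Green E W V \<beta> \<gamma> \<phi> j / Green E W V \<beta> \<gamma> \<phi> i))"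

definition R_st ::
    "'v set \<Rightarrow> 'v set set \<Rightarrow> 'v \<Rightarrow> real \<Rightarrow> (nat \<Rightarrow> 'v set) \<Rightarrow> ('v \<times> 'v \<Rightarrow> real) measure" where
  "R_st T E \<phi> W V =
     distr (nu T E W \<Otimes>\<^sub>M gamma_half) (\<Pi>\<^sub>M e\<in>darts E. borel) (st_rates E \<phi> W V)"

end

theory Submission
  imports Defs "HOL-Real_Asymp.Real_Asymp"
begin

text \<open>
  The two laws are told apart by the product \<open>F = (\<Prod>k<n. 2 / W * r (x\<^sub>k, x\<^sub>k\<^sub>+\<^sub>1))\<close> of
  the rates along a long simple path \<open>\<phi> = x\<^sub>0, \<dots>, x\<^sub>n\<close>.

  In the independent environment \<open>F\<close> is a product of \<open>n\<close> independent inverse Gaussian variables. They have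
  mean 1 and are not constant, so the mean of their square root is less than 1
  (\<open>inv_gauss_sqrt_mean_less_1\<close>), and by Markov's inequality \<open>F\<close> tends to 0 in probability
  (\<open>R_ind_undecayed\<close>).

  In the standard environment the product telescopes to \<open>G(\<phi>, x\<^sub>n) / G(\<phi>, \<phi>)\<close>, which is at least
  \<open>\<psi>(\<phi>) \<psi>(x\<^sub>n) / (2 \<gamma> G(\<phi>, \<phi>))\<close>. Hence \<open>F\<close> does not tend to 0 in probability as soon as
  \<open>\<psi>(x) \<ge> 1/2\<close> has probability at least 3/4 for every vertex \<open>x\<close> (\<open>R_st_undecayed\<close>). This is a strong
  form of transience, and it is where \<open>W\<close> has to be large.

  All that is needed about the law of the potential follows from one computation (\<open>nu_density_insert\<close>).
  Let \<open>k\<close> be a vertex outside the finite set \<open>U\<close>, let \<open>g\<close> be 1 at \<open>k\<close> and \<open>G\<^sub>U W\<^sub>U\<^sub>,\<^sub>k\<close> on \<open>U\<close>, let \<open>y\<close> be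
  the Schur complement \<open>1 / G\<^sub>U\<^sub>+\<^sub>k(k, k)\<close> and \<open>a = \<langle>g, \<eta>\<rangle>\<close>. Then the density on \<open>U \<union> {k}\<close> with
  field \<open>\<eta>\<close> is the density on \<open>U\<close> with field \<open>\<eta> + W\<^sub>U\<^sub>,\<^sub>k\<close> times the conditional density
  \<open>exp (- (y - a)\<^sup>2 / (2 y)) / sqrt (2 \<pi> y)\<close> of \<open>y\<close>, and the latter has total mass 1 for every
  \<open>a \<ge> 0\<close>. There are three consequences.

  First, the finite-volume laws are consistent probabilities, so that the infinite-volume law exists by
  Kolmogorov's extension theorem and is unique (\<open>is_nu_nu\<close>).

  Secondly, the limits defining \<open>G\<close> and \<open>\<psi>\<close> exist almost surely (\<open>AE_limits\<close>). The finite-volume Green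
  functions increase, and they are tight because the density of \<open>y\<close> is at most \<open>1 / sqrt (2 \<pi> y)\<close>.
  Adding \<open>\<theta>\<close> to the field at \<open>x\<close> multiplies the density by \<open>exp \<theta>\<close> times
  \<open>exp (- \<theta> \<psi>\<^sub>n(x) - \<theta>\<^sup>2 / 2 * G\<^sub>n(x, x))\<close>; by consistency this last expression is a bounded martingale,
  and its convergence yields that of \<open>\<psi>\<^sub>n(x)\<close>.

  Thirdly, \<open>\<psi>\<close> can be bounded below by a recursion on the tree rooted at \<open>x\<close>
  (\<open>prod_defect_integral\<close>, \<open>psi_small_unlikely\<close>). Let \<open>L\<^sub>j\<close> be the contribution to \<open>\<psi>\<close> of the branch below
  \<open>j\<close>. Then \<open>L\<^sub>j = S / y\<close>, where \<open>S\<close> is \<open>W\<close> times the sum of \<open>L\<close> over the children of \<open>j\<close>, and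
  \<open>y\<close> has parameter \<open>a = S + W\<close>. For large \<open>W\<close> the variable \<open>y\<close> is close to \<open>a\<close>, so \<open>L\<^sub>j\<close> is
  close to \<open>s / (1 + s)\<close> with \<open>s\<close> the sum over at least two children, and 0 is a repelling fixed point of
  this recursion. At the root \<open>\<psi>(x) = a / y\<close> with \<open>a\<close> large, hence \<open>\<psi>(x)\<close> is close to 1.
\<close>

section \<open>Adding one vertex to a finite matrix\<close>

text \<open>The conditions that single out \<open>inverse_on U A\<close>.\<close>

definition inverse_pair :: "'v set \<Rightarrow> ('v \<Rightarrow> 'v \<Rightarrow> real) \<Rightarrow> ('v \<Rightarrow> 'v \<Rightarrow> real) \<Rightarrow> bool" where
  "inverse_pair U A B \<longleftrightarrow>
     (\<forall>i j. i \<notin> U \<or> j \<notin> U \<longrightarrow> B i j = 0) \<and>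
     (\<forall>i\<in>U. \<forall>j\<in>U. (\<Sum>k\<in>U. A i k * B k j) = (if i = j then 1 else 0)) \<and>
     (\<forall>i\<in>U. \<forall>j\<in>U. (\<Sum>k\<in>U. B i k * A k j) = (if i = j then 1 else 0))"

definition sym_on :: "'v set \<Rightarrow> ('v \<Rightarrow> 'v \<Rightarrow> real) \<Rightarrow> bool" where
  "sym_on U A \<longleftrightarrow> (\<forall>i\<in>U. \<forall>j\<in>U. A i j = A j i)"

lemma sym_onD: "sym_on U A \<Longrightarrow> i \<in> U \<Longrightarrow> j \<in> U \<Longrightarrow> A i j = A j i"
  unfolding sym_on_def by blast

lemma pos_def_onD: "pos_def_on U A \<Longrightarrow> i \<in> U \<Longrightarrow> f i \<noteq> 0 \<Longrightarrow> 0 < form_on U A f"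
  unfolding pos_def_on_def by blast

lemma inverse_pair_unique:
  assumes U: "finite U" and B: "inverse_pair U A B" and C: "inverse_pair U A C"
  shows "B = C"
proof (intro ext)
  fix i j
  show "B i j = C i j"
  proof (cases "i \<in> U \<and> j \<in> U")
    case True
    have "B i j = (\<Sum>k\<in>U. B i k * (if k = j then 1 else 0))"
      using True U by (simp add: if_distrib cong: if_cong)
    also have "\<dots> = (\<Sum>k\<in>U. B i k * (\<Sum>l\<in>U. A k l * C l j))"
      using True C by (intro sum.cong) (auto simp: inverse_pair_def)
    also have "\<dots> = (\<Sum>l\<in>U. (\<Sum>k\<in>U. B i k * A k l) * C l j)"
      unfolding sum_distrib_left sum_distrib_right by (subst sum.swap) (simp add: mult.assoc)
    also have "\<dots> = (\<Sum>l\<in>U. (if i = l then 1 else 0) * C l j)"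
      using True B by (intro sum.cong) (auto simp: inverse_pair_def)
    also have "\<dots> = C i j"
      using True U by (simp add: if_distrib if_distribR cong: if_cong)
    finally show ?thesis .
  next
    case False
    then show ?thesis using B C by (auto simp: inverse_pair_def)
  qed
qed

lemma inverse_on_eqI:
  assumes "finite U" "inverse_pair U A B"
  shows "inverse_on U A = B"
  unfolding inverse_on_def using assms inverse_pair_unique[OF assms(1)]
  by (intro the_equality) (auto simp: inverse_pair_def)

lemma inverse_pair_symmetric:
  assumes U: "finite U" and A: "sym_on U A" and B: "inverse_pair U A B"
  shows "B i j = B j i"
proof -
  have "inverse_pair U A (\<lambda>i j. B j i)"
    unfolding inverse_pair_def
  proof (intro conjI ballI allI impI)
    fix i j assume ij: "i \<in> U" "j \<in> U"
    have "(\<Sum>k\<in>U. A i k * B j k) = (\<Sum>k\<in>U. B j k * A k i)"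
      using A ij by (intro sum.cong) (auto simp: sym_on_def)
    then show "(\<Sum>k\<in>U. A i k * B j k) = (if i = j then 1 else 0)"
      using B ij by (auto simp: inverse_pair_def)
    have "(\<Sum>k\<in>U. B k i * A k j) = (\<Sum>k\<in>U. A j k * B k i)"
      using A ij by (intro sum.cong) (auto simp: sym_on_def)
    then show "(\<Sum>k\<in>U. B k i * A k j) = (if i = j then 1 else 0)"
      using B ij by (auto simp: inverse_pair_def)
  qed (use B in \<open>auto simp: inverse_pair_def\<close>)
  from inverse_pair_unique[OF U B this] show ?thesis by metis
qed

text \<open>The vector \<open>g\<close> with \<open>g k = 1\<close> and \<open>A g = 0\<close> on \<open>U\<close>, as used by Gaussian elimination of \<open>U\<close>.\<close>

definition elim_vec :: "'v set \<Rightarrow> ('v \<Rightarrow> 'v \<Rightarrow> real) \<Rightarrow> 'v \<Rightarrow> 'v \<Rightarrow> real" where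
  "elim_vec U A k i = (if i = k then 1 else - (\<Sum>l\<in>U. inverse_on U A i l * A l k))"

text \<open>The entry of \<open>A g\<close> at \<open>k\<close>, that is the Schur complement of \<open>U\<close> in \<open>insert k U\<close>.\<close>

definition schur :: "'v set \<Rightarrow> ('v \<Rightarrow> 'v \<Rightarrow> real) \<Rightarrow> 'v \<Rightarrow> real" where
  "schur U A k = (\<Sum>i\<in>insert k U. A k i * elim_vec U A k i)"

context
  fixes U :: "'v set" and A :: "'v \<Rightarrow> 'v \<Rightarrow> real" and k :: 'v
  assumes U: "finite U" and k: "k \<notin> U" and sym: "sym_on (insert k U) A"
    and inv: "inverse_pair U A (inverse_on U A)"
begin

private abbreviation "G \<equiv> inverse_on U A"
private abbreviation "g \<equiv> elim_vec U A k"
private abbreviation "y \<equiv> schur U A k"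

lemma sym_on_smaller: "sym_on U A" using sym by (auto simp: sym_on_def)

lemma inverse_on_sym: "G i j = G j i" by (rule inverse_pair_symmetric[OF U sym_on_smaller inv])

lemma inverse_on_outside: "i \<notin> U \<or> j \<notin> U \<Longrightarrow> G i j = 0"
  using inv by (auto simp: inverse_pair_def)

lemma elim_vec_outside: "i \<notin> insert k U \<Longrightarrow> g i = 0"
  by (auto simp: elim_vec_def inverse_on_outside)

lemma elim_vec_self: "g k = 1"
  by (simp add: elim_vec_def)

lemma matrix_times_inverse: "i \<in> U \<Longrightarrow> j \<in> U \<Longrightarrow> (\<Sum>l\<in>U. A i l * G l j) = (if i = j then 1 else 0)"
  using inv by (auto simp: inverse_pair_def)

lemma matrix_elim_vec:
  assumes "i \<in> insert k U"
  shows "(\<Sum>l\<in>insert k U. A i l * g l) = (if i = k then y else 0)"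
proof (cases "i = k")
  case False
  with assms have i: "i \<in> U" by auto
  have "(\<Sum>l\<in>U. A i l * g l) = (\<Sum>l\<in>U. A i l * (- (\<Sum>m\<in>U. G l m * A m k)))"
    using k by (intro sum.cong) (auto simp: elim_vec_def)
  also have "\<dots> = - (\<Sum>l\<in>U. \<Sum>m\<in>U. A i l * G l m * A m k)"
    by (simp add: sum_distrib_left sum_negf mult.assoc)
  also have "\<dots> = - (\<Sum>m\<in>U. (\<Sum>l\<in>U. A i l * G l m) * A m k)"
    by (subst sum.swap) (simp add: sum_distrib_right)
  also have "\<dots> = - (\<Sum>m\<in>U. (if i = m then 1 else 0) * A m k)"
    using i by (simp add: matrix_times_inverse)
  also have "\<dots> = - A i k" using i U by (simp add: if_distrib if_distribR cong: if_cong)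
  finally show ?thesis using False U k by (simp add: elim_vec_self)
qed (simp add: schur_def)

lemma row_times_inverse:
  assumes "j \<in> U"
  shows "(\<Sum>l\<in>U. A k l * G l j) = - g j"
proof -
  have "(\<Sum>l\<in>U. A k l * G l j) = (\<Sum>l\<in>U. G j l * A l k)"
  proof (intro sum.cong refl)
    fix l assume "l \<in> U"
    then show "A k l * G l j = G j l * A l k"
      using sym_onD[OF sym, of k l] inverse_on_sym[of l j] by (metis insertI1 insertI2 mult.commute)
  qed
  then show ?thesis using assms k by (auto simp: elim_vec_def)
qed

text \<open>Since \<open>A g = y e\<^sub>k\<close>, the rank one term \<open>g g\<^sup>T / y\<close> contributes \<open>e\<^sub>k g\<^sup>T\<close> to the product with \<open>A\<close>. The
  inverse on \<open>U\<close> contributes the identity on \<open>U\<close> and \<open>- g\<close> in the row \<open>k\<close>, which cancels the rest.\<close>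

lemma inverse_pair_insert:
  assumes y: "y \<noteq> 0"
  shows "inverse_pair (insert k U) A (\<lambda>i j. G i j + g i * g j / y)"
proof -
  let ?B = "\<lambda>i j. G i j + g i * g j / y"
  have 1: "(\<Sum>l\<in>insert k U. A i l * ?B l j) = (if i = j then 1 else 0)"
    if i: "i \<in> insert k U" and j: "j \<in> insert k U" for i j
  proof -
    have "(\<Sum>l\<in>insert k U. A i l * ?B l j)
        = (\<Sum>l\<in>insert k U. A i l * G l j) + (\<Sum>l\<in>insert k U. A i l * g l) * (g j / y)"
      unfolding sum_distrib_right sum.distrib[symmetric]
      by (intro sum.cong refl) (simp add: algebra_simps)
    also have "(\<Sum>l\<in>insert k U. A i l * G l j) = (\<Sum>l\<in>U. A i l * G l j)"
      using U k by (simp add: inverse_on_outside)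
    also have "(\<Sum>l\<in>insert k U. A i l * g l) = (if i = k then y else 0)"
      by (rule matrix_elim_vec[OF i])
    also have "(\<Sum>l\<in>U. A i l * G l j) =
        (if j = k then 0 else if i = k then - g j else if i = j then 1 else 0)"
    proof (cases "j = k")
      case False
      then have "j \<in> U" using j by auto
      then show ?thesis using i k row_times_inverse matrix_times_inverse by auto
    qed (use k in \<open>simp add: inverse_on_outside\<close>)
    finally show ?thesis using y i j k by (auto simp: elim_vec_self)
  qed
  have sB: "?B i j = ?B j i" for i j by (simp add: inverse_on_sym[of i j] mult.commute)
  show ?thesis unfolding inverse_pair_def
  proof (intro conjI ballI allI impI)
    fix i j assume ij: "i \<in> insert k U" "j \<in> insert k U"
    show "(\<Sum>l\<in>insert k U. A i l * ?B l j) = (if i = j then 1 else 0)" by (rule 1[OF ij])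
    have "(\<Sum>l\<in>insert k U. ?B i l * A l j) = (\<Sum>l\<in>insert k U. A j l * ?B l i)"
    proof (intro sum.cong refl)
      fix l assume "l \<in> insert k U"
      then show "?B i l * A l j = A j l * ?B l i"
        using sym_onD[OF sym ij(2)] by (simp only: sB[of i l] mult.commute)
    qed
    then show "(\<Sum>l\<in>insert k U. ?B i l * A l j) = (if i = j then 1 else 0)"
      using 1[OF ij(2,1)] by auto
  qed (auto simp: inverse_on_outside elim_vec_outside)
qed

lemma inverse_on_insert:
  assumes "y \<noteq> 0"
  shows "inverse_on (insert k U) A i j = G i j + g i * g j / y"
  using inverse_on_eqI[OF _ inverse_pair_insert[OF assms]] U by simp

text \<open>Completing the square: \<open>f = f k * g + f'\<close> with \<open>f'\<close> supported on \<open>U\<close>, and \<open>f'\<close> is orthogonal to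
  \<open>A g\<close>.\<close>

lemma form_on_insert:
  "form_on (insert k U) A f = form_on U A (\<lambda>i. f i - f k * g i) + y * (f k)\<^sup>2"
proof -
  let ?I = "insert k U"
  let ?f = "\<lambda>i. f i - f k * g i"
  have Af: "(\<Sum>j\<in>?I. A i j * f j) = (\<Sum>j\<in>U. A i j * ?f j) + (if i = k then y * f k else 0)"
    if "i \<in> ?I" for i
  proof -
    have "(\<Sum>j\<in>?I. A i j * f j) = (\<Sum>j\<in>?I. A i j * ?f j) + f k * (\<Sum>j\<in>?I. A i j * g j)"
      by (simp add: right_diff_distrib sum_subtractf sum_distrib_left algebra_simps)
    then show ?thesis using matrix_elim_vec[OF that] U k by (simp add: elim_vec_self)
  qed
  have gA: "(\<Sum>i\<in>?I. g i * A i j) = 0" if "j \<in> U" for j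
  proof -
    have "(\<Sum>i\<in>?I. g i * A i j) = (\<Sum>i\<in>?I. A j i * g i)"
      using that sym by (intro sum.cong) (auto simp: sym_on_def)
    then show ?thesis using matrix_elim_vec[of j] that k by auto
  qed
  have "form_on ?I A f = (\<Sum>i\<in>?I. f i * (\<Sum>j\<in>?I. A i j * f j))"
    by (simp add: form_on_def sum_distrib_left mult.assoc)
  also have "\<dots> = (\<Sum>i\<in>?I. f i * ((\<Sum>j\<in>U. A i j * ?f j) + (if i = k then y * f k else 0)))"
    by (intro sum.cong refl) (simp only: Af)
  also have "\<dots> = (\<Sum>i\<in>?I. f i * (\<Sum>j\<in>U. A i j * ?f j)) + y * (f k)\<^sup>2"
    unfolding distrib_left sum.distrib
    using U k by (simp add: if_distrib sum.delta power2_eq_square cong: if_cong)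
  also have "(\<Sum>i\<in>?I. f i * (\<Sum>j\<in>U. A i j * ?f j))
      = (\<Sum>i\<in>?I. ?f i * (\<Sum>j\<in>U. A i j * ?f j)) + f k * (\<Sum>i\<in>?I. g i * (\<Sum>j\<in>U. A i j * ?f j))"
    unfolding sum_distrib_left[of "f k"] sum.distrib[symmetric]
    by (intro sum.cong refl) (simp add: algebra_simps)
  also have "(\<Sum>i\<in>?I. g i * (\<Sum>j\<in>U. A i j * ?f j)) = (\<Sum>j\<in>U. (\<Sum>i\<in>?I. g i * A i j) * ?f j)"
    unfolding sum_distrib_left sum_distrib_right by (subst sum.swap) (simp only: mult.assoc)
  also have "\<dots> = 0" using gA by simp
  also have "(\<Sum>i\<in>?I. ?f i * (\<Sum>j\<in>U. A i j * ?f j)) = form_on U A ?f"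
    using U k by (simp add: elim_vec_self form_on_def sum_distrib_left mult.assoc)
  finally show ?thesis by simp
qed

lemma pos_def_on_insert: "pos_def_on (insert k U) A \<longleftrightarrow> pos_def_on U A \<and> 0 < y"
proof (intro iffI conjI)
  assume P: "pos_def_on (insert k U) A"
  show "pos_def_on U A" unfolding pos_def_on_def
  proof (intro allI impI)
    fix f :: "'v \<Rightarrow> real" assume f: "\<exists>i\<in>U. f i \<noteq> 0"
    from f obtain i where "i \<in> U" "f i \<noteq> 0" by blast
    then have "0 < form_on (insert k U) A (f(k := 0))"
      using k by (intro pos_def_onD[OF P, of i]) auto
    also have "\<dots> = form_on U A f"
      using k U by (auto simp: form_on_def intro!: sum.cong)
    finally show "0 < form_on U A f" .
  qed
  have "0 < form_on (insert k U) A g"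
    using P elim_vec_self by (force simp: pos_def_on_def)
  then show "0 < y" unfolding form_on_insert by (simp add: elim_vec_self form_on_def)
next
  assume P: "pos_def_on U A \<and> 0 < y"
  show "pos_def_on (insert k U) A" unfolding pos_def_on_def
  proof (intro allI impI)
    fix f :: "'v \<Rightarrow> real" assume f: "\<exists>i\<in>insert k U. f i \<noteq> 0"
    show "0 < form_on (insert k U) A f"
    proof (cases "f k = 0")
      case True
      then have "\<exists>i\<in>U. f i - f k * g i \<noteq> 0" using f by auto
      then show ?thesis unfolding form_on_insert using P True by (auto simp: pos_def_on_def)
    next
      case False
      have "0 \<le> form_on U A (\<lambda>i. f i - f k * g i)"
      proof (cases "\<exists>i\<in>U. f i - f k * g i \<noteq> 0")
        case True then show ?thesis using P by (auto simp: pos_def_on_def less_imp_le)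
      qed (simp add: form_on_def)
      then show ?thesis unfolding form_on_insert using P False by (simp add: add_nonneg_pos)
    qed
  qed
qed

lemma form_on_inverse_insert:
  assumes "y \<noteq> 0"
  shows "form_on (insert k U) (inverse_on (insert k U) A) f =
    form_on U G f + (\<Sum>i\<in>insert k U. g i * f i)\<^sup>2 / y"
proof -
  let ?I = "insert k U"
  have "form_on ?I (inverse_on ?I A) f
      = (\<Sum>i\<in>?I. \<Sum>j\<in>?I. f i * G i j * f j) + (\<Sum>i\<in>?I. \<Sum>j\<in>?I. (g i * f i) * (g j * f j) / y)"
    unfolding form_on_def inverse_on_insert[OF assms] sum.distrib[symmetric]
    by (intro sum.cong refl) (simp add: algebra_simps)
  also have "(\<Sum>i\<in>?I. \<Sum>j\<in>?I. f i * G i j * f j) = form_on U G f"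
    using U k by (simp add: form_on_def inverse_on_outside)
  also have "(\<Sum>i\<in>?I. \<Sum>j\<in>?I. (g i * f i) * (g j * f j) / y) = (\<Sum>i\<in>?I. g i * f i)\<^sup>2 / y"
    by (simp only: power2_eq_square sum_product sum_divide_distrib)
  finally show ?thesis .
qed

end

lemma inverse_on_pos_def:
  assumes "finite U" "sym_on U A" "pos_def_on U A"
  shows "inverse_pair U A (inverse_on U A)"
  using assms
proof (induction U)
  case empty
  have "inverse_pair {} A (\<lambda>_ _. 0)" by (simp add: inverse_pair_def)
  then show ?case using inverse_on_eqI[of "{}" A] by simp
next
  case (insert k U)
  have "form_on (insert k U) A (f(k := 0)) = form_on U A f" for f
    using insert(1,2) by (auto simp: form_on_def intro!: sum.cong)
  moreover have "\<exists>i\<in>insert k U. (f(k := 0)) i \<noteq> 0" if "\<exists>i\<in>U. f i \<noteq> 0" for f :: "'a \<Rightarrow> real"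
    using that insert(2) by force
  ultimately have "pos_def_on U A"
    using insert.prems(2) unfolding pos_def_on_def by metis
  moreover have "sym_on U A" using insert.prems by (auto simp: sym_on_def)
  ultimately have I: "inverse_pair U A (inverse_on U A)" using insert.IH by auto
  have "0 < schur U A k"
    using insert pos_def_on_insert[OF insert(1,2) insert.prems(1) I] by simp
  then show ?case
    using inverse_pair_insert[OF insert(1,2) insert.prems(1) I]
      inverse_on_eqI[of "insert k U" A] insert(1) by auto
qed

lemma pos_def_on_insertD:
  assumes "finite U" "k \<notin> U" "pos_def_on (insert k U) A"
  shows "pos_def_on U A"
  unfolding pos_def_on_def
proof (intro allI impI)
  fix f :: "'a \<Rightarrow> real" assume f: "\<exists>i\<in>U. f i \<noteq> 0"
  from f obtain i where "i \<in> U" "f i \<noteq> 0" by blast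
  then have "0 < form_on (insert k U) A (f(k := 0))"
    using assms(2) by (intro pos_def_onD[OF assms(3), of i]) auto
  also have "form_on (insert k U) A (f(k := 0)) = form_on U A f"
    using assms(1,2) by (auto simp: form_on_def intro!: sum.cong)
  finally show "0 < form_on U A f" .
qed

subsection \<open>The Leibniz determinant\<close>

lemma det_on_row_sum:
  assumes U: "finite U" and k: "k \<in> U"
  shows "det_on U (\<lambda>i j. if i = k then (\<Sum>m\<in>M. c m * B m j) else A i j)
     = (\<Sum>m\<in>M. c m * det_on U (\<lambda>i j. if i = k then B m j else A i j))"
proof -
  have pr: "(\<Prod>i\<in>U. if i = k then x (p i) else A i (p i)) = x (p k) * (\<Prod>i\<in>U - {k}. A i (p i))"
    for x :: "'a \<Rightarrow> real" and p
    by (subst prod.remove[OF U k]) (auto intro!: prod.cong)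
  have "det_on U (\<lambda>i j. if i = k then (\<Sum>m\<in>M. c m * B m j) else A i j)
     = (\<Sum>p | p permutes U. \<Sum>m\<in>M. c m * (of_int (sign p) * (B m (p k) * (\<Prod>i\<in>U - {k}. A i (p i)))))"
    unfolding det_on_def
    by (intro sum.cong refl, subst pr)
       (simp add: sum_distrib_left sum_distrib_right algebra_simps)
  also have "\<dots> = (\<Sum>m\<in>M. c m * (\<Sum>p | p permutes U. of_int (sign p) * (B m (p k) * (\<Prod>i\<in>U - {k}. A i (p i)))))"
    by (subst sum.swap) (simp add: sum_distrib_left)
  also have "\<dots> = (\<Sum>m\<in>M. c m * det_on U (\<lambda>i j. if i = k then B m j else A i j))"
    unfolding det_on_def by (intro sum.cong refl arg_cong2[where f="(*)"], subst pr) auto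
  finally show ?thesis .
qed

lemma det_on_equal_rows:
  assumes U: "finite U" and k: "k \<in> U" and m: "m \<in> U" "m \<noteq> k" and eq: "\<And>j. A k j = A m j"
  shows "det_on U A = 0"
proof -
  let ?q = "Transposition.transpose k m"
  have q: "?q permutes U" using k m by (simp add: permutes_swap_id)
  have "det_on U A = (\<Sum>p | p permutes U. of_int (sign (p \<circ> ?q)) * (\<Prod>i\<in>U. A i ((p \<circ> ?q) i)))"
    unfolding det_on_def by (rule sum_permutations_compose_right[OF q])
  also have "\<dots> = (\<Sum>p | p permutes U. - (of_int (sign p) * (\<Prod>i\<in>U. A i (p i))))"
  proof (intro sum.cong refl)
    fix p assume p: "p \<in> {p. p permutes U}"
    have "sign (p \<circ> ?q) = - sign p"
      using p q m U by (subst sign_compose) (auto simp: sign_swap_id permutation_permutes)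
    moreover have "(\<Prod>i\<in>U. A i ((p \<circ> ?q) i)) = (\<Prod>i\<in>U. A (?q i) (p (?q i)))"
      using eq by (intro prod.cong refl) (auto simp: Transposition.transpose_def)
    moreover have "\<dots> = (\<Prod>i\<in>U. A i (p i))"
      by (rule prod.permute[OF q, symmetric, unfolded o_def])
    ultimately show "of_int (sign (p \<circ> ?q)) * (\<Prod>i\<in>U. A i ((p \<circ> ?q) i)) = - (of_int (sign p) * (\<Prod>i\<in>U. A i (p i)))"
      by simp
  qed
  also have "\<dots> = - det_on U A" by (simp add: det_on_def sum_negf)
  finally show ?thesis by simp
qed

lemma det_on_unit_row:
  assumes U: "finite U" and k: "k \<notin> U" and row: "\<And>j. j \<in> U \<Longrightarrow> A k j = 0"
  shows "det_on (insert k U) A = A k k * det_on U A"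
proof -
  have "det_on (insert k U) A = (\<Sum>p | p permutes U. of_int (sign p) * (\<Prod>i\<in>insert k U. A i (p i)))"
    unfolding det_on_def
  proof (intro sum.mono_neutral_right ballI)
    show "finite {p. p permutes insert k U}" using U by (simp add: finite_permutations)
    show "{p. p permutes U} \<subseteq> {p. p permutes insert k U}"
      by (auto intro: permutes_subset)
    fix p assume "p \<in> {p. p permutes insert k U} - {p. p permutes U}"
    then have p: "p permutes insert k U" "\<not> p permutes U" by auto
    have "p k \<noteq> k" using p permutes_superset[of p "insert k U" U] by auto
    then have "p k \<in> U" using p(1) permutes_in_image[of p "insert k U" k] by auto
    then show "of_int (sign p) * (\<Prod>i\<in>insert k U. A i (p i)) = 0"
      using U k row by simp
  qed
  also have "\<dots> = (\<Sum>p | p permutes U. A k k * (of_int (sign p) * (\<Prod>i\<in>U. A i (p i))))"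
    using U k by (intro sum.cong refl) (simp add: permutes_not_in)
  finally show ?thesis by (simp add: det_on_def sum_distrib_left)
qed

text \<open>Replacing the row \<open>k\<close> by the combination of rows with coefficients \<open>g\<close> does not change the
  determinant, and the new row is \<open>y e\<^sub>k\<close>.\<close>

lemma det_on_insert:
  assumes U: "finite U" and k: "k \<notin> U" and sym: "sym_on (insert k U) A"
    and inv: "inverse_pair U A (inverse_on U A)"
  shows "det_on (insert k U) A = schur U A k * det_on U A"
proof -
  let ?I = "insert k U" and ?g = "elim_vec U A k"
  let ?R = "\<lambda>m i j. if i = k then A m j else A i j"
  have row: "(\<Sum>m\<in>?I. ?g m * A m j) = (if j = k then schur U A k else 0)" if "j \<in> ?I" for j
  proof -
    have "(\<Sum>m\<in>?I. ?g m * A m j) = (\<Sum>m\<in>?I. A j m * ?g m)"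
      using that sym by (intro sum.cong) (auto simp: sym_on_def)
    then show ?thesis using matrix_elim_vec[OF U k sym inv that] by simp
  qed
  have "det_on ?I (?R m) = 0" if "m \<in> U" for m
    using that U k by (intro det_on_equal_rows[of ?I k m]) auto
  then have "(\<Sum>m\<in>?I. ?g m * det_on ?I (?R m)) = ?g k * det_on ?I (?R k)"
    using U k by simp
  also have "?R k = A" by (intro ext) auto
  finally have "det_on ?I A = det_on ?I (\<lambda>i j. if i = k then \<Sum>m\<in>?I. ?g m * A m j else A i j)"
    using U by (subst det_on_row_sum) (auto simp: elim_vec_def)
  also have "\<dots> = (\<Sum>m\<in>?I. ?g m * A m k) * det_on U (\<lambda>i j. if i = k then \<Sum>m\<in>?I. ?g m * A m j else A i j)"
    using U k row by (subst det_on_unit_row) auto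
  also have "(\<Sum>m\<in>?I. ?g m * A m k) = schur U A k" using row[of k] by simp
  also have "det_on U (\<lambda>i j. if i = k then \<Sum>m\<in>?I. ?g m * A m j else A i j) = det_on U A"
    unfolding det_on_def using k
    by (intro sum.cong refl arg_cong2[where f="(*)"] prod.cong) auto
  finally show ?thesis .
qed

section \<open>The reciprocal inverse Gaussian density\<close>

definition std_normal_cdf :: "real \<Rightarrow> real" where
  "std_normal_cdf = cdf (density lborel std_normal_density)"

lemma std_normal_cdf_limits:
  "(std_normal_cdf \<longlongrightarrow> 1) at_top" "(std_normal_cdf \<longlongrightarrow> 0) at_bot"
proof -
  interpret prob_space "density lborel std_normal_density"
    by (rule prob_space_normal_density) simp
  interpret real_distribution "density lborel std_normal_density"
    by unfold_locales auto
  show "(std_normal_cdf \<longlongrightarrow> 1) at_top" "(std_normal_cdf \<longlongrightarrow> 0) at_bot"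
    unfolding std_normal_cdf_def by (rule cdf_lim_at_top_prob cdf_lim_at_bot)+
qed

lemma std_normal_cdf_has_derivative:
  "(std_normal_cdf has_real_derivative std_normal_density x) (at x)"
proof -
  interpret prob_space "density lborel std_normal_density"
    by (rule prob_space_normal_density) simp
  interpret real_distribution "density lborel std_normal_density"
    by unfold_locales auto
  let ?a = "x - 1" and ?b = "x + 1"
  have cont: "continuous_on A std_normal_density" for A
    unfolding std_normal_density_def by (intro continuous_intros) auto
  have eq: "std_normal_cdf u = std_normal_cdf ?a + (LBINT y=?a..u. std_normal_density y)"
    if "u \<in> {?a<..<?b}" for u
  proof -
    have "std_normal_cdf u - std_normal_cdf ?a = measure (density lborel std_normal_density) {?a<..u}"
      unfolding std_normal_cdf_def using that by (intro cdf_diff_eq) auto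
    also have "\<dots> = (LBINT y:{?a<..u}. std_normal_density y)"
    proof -
      have "measure (density lborel std_normal_density) {?a<..u}
          = enn2real (\<integral>\<^sup>+y. ennreal (std_normal_density y * indicator {?a<..u} y) \<partial>lborel)"
        unfolding measure_def
        by (subst emeasure_density) (auto intro!: arg_cong[where f=enn2real] nn_integral_cong split: split_indicator)
      also have "\<dots> = (\<integral>y. std_normal_density y * indicator {?a<..u} y \<partial>lborel)"
        by (rule integral_eq_nn_integral[symmetric]) auto
      finally show ?thesis by (simp add: set_lebesgue_integral_def mult.commute)
    qed
    also have "\<dots> = (LBINT y=?a..u. std_normal_density y)"
      using that by (subst interval_integral_Ioc) auto
    finally show ?thesis by simp
  qed
  have "((\<lambda>u. LBINT y=?a..u. std_normal_density y) has_vector_derivative std_normal_density x)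
      (at x within {?a..?b})"
    by (intro interval_integral_FTC2 cont) auto
  then have "((\<lambda>u. LBINT y=?a..u. std_normal_density y) has_real_derivative std_normal_density x)
      (at x within {?a<..<?b})"
    unfolding has_real_derivative_iff_has_vector_derivative
    by (rule has_vector_derivative_within_subset) auto
  then have "((\<lambda>u. LBINT y=?a..u. std_normal_density y) has_real_derivative std_normal_density x) (at x)"
    by (subst (asm) at_within_open) auto
  then have "((\<lambda>u. std_normal_cdf ?a + (LBINT y=?a..u. std_normal_density y)) has_real_derivative std_normal_density x) (at x)"
    by (auto intro!: derivative_eq_intros)
  then show ?thesis
    by (rule has_field_derivative_transform_within_open[of _ _ _ "{?a<..<?b}"])
      (auto simp: eq)
qed

text \<open>The density of \<open>a / X\<close> for \<open>X\<close> inverse Gaussian with parameters \<open>(a, 1)\<close>. For \<open>a = 0\<close> it is that of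
  the square of a standard normal variable.\<close>

definition rig_density :: "real \<Rightarrow> real \<Rightarrow> real" where
  "rig_density a y = (if 0 < y then exp (- (y - a)\<^sup>2 / (2 * y)) / sqrt (2 * pi * y) else 0)"

lemma rig_density_nonneg: "0 \<le> rig_density a y"
  by (simp add: rig_density_def)

lemma rig_density_measurable [measurable]:
  "(\<lambda>x. rig_density (f x) (g x)) \<in> borel_measurable M"
  if [measurable]: "f \<in> borel_measurable M" "g \<in> borel_measurable M"
  unfolding rig_density_def by measurable

text \<open>For \<open>s = -1\<close> this is the distribution function of the reciprocal inverse Gaussian law, and for
  \<open>s = 1\<close> that of the inverse Gaussian law after scaling by \<open>a\<close>. Both are handled at once because
  \<open>exp (2 a)\<close> times the normal density at \<open>- sqrt y - a / sqrt y\<close> equals the normal density at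
  \<open>sqrt y - a / sqrt y\<close>.\<close>

definition rig_cdf :: "real \<Rightarrow> real \<Rightarrow> real \<Rightarrow> real" where
  "rig_cdf s a y = std_normal_cdf (sqrt y - a / sqrt y) + s * exp (2 * a) * std_normal_cdf (- sqrt y - a / sqrt y)"

lemma sqrt_shift_square: "0 < y \<Longrightarrow> (sqrt y - a / sqrt y)\<^sup>2 = (y - a)\<^sup>2 / y"
  "0 < y \<Longrightarrow> (- sqrt y - a / sqrt y)\<^sup>2 = (y + a)\<^sup>2 / y"
  by (simp_all add: power2_eq_square field_simps)

lemma std_normal_density_shift:
  assumes "0 < y"
  shows "std_normal_density (sqrt y - a / sqrt y) = sqrt y * rig_density a y"
    and "exp (2 * a) * std_normal_density (- sqrt y - a / sqrt y) = sqrt y * rig_density a y"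
proof -
  show "std_normal_density (sqrt y - a / sqrt y) = sqrt y * rig_density a y"
    using assms by (simp add: std_normal_density_def sqrt_shift_square rig_density_def real_sqrt_mult field_simps)
  have "exp (2 * a) * exp (- ((y + a)\<^sup>2 / y) / 2) = exp (- (y - a)\<^sup>2 / (2 * y))"
    unfolding exp_add[symmetric] using assms by (simp add: field_simps power2_eq_square)
  moreover have "(- y - a)\<^sup>2 = (a + y)\<^sup>2" by (simp add: power2_eq_square algebra_simps)
  ultimately show "exp (2 * a) * std_normal_density (- sqrt y - a / sqrt y) = sqrt y * rig_density a y"
    using assms by (simp add: std_normal_density_def sqrt_shift_square rig_density_def real_sqrt_mult field_simps)
qed

lemma rig_cdf_has_derivative:
  assumes y: "0 < y"
  shows "(rig_cdf s a has_real_derivative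
    ((1 - s) / 2 + (1 + s) / 2 * (a / y)) * rig_density a y) (at y)"
proof -
  have "(rig_cdf s a has_real_derivative
     (std_normal_density (sqrt y - a / sqrt y) * (inverse (sqrt y) / 2 + a * inverse (sqrt y) / 2 / (sqrt y)\<^sup>2)
      + s * exp (2 * a) * (std_normal_density (- sqrt y - a / sqrt y) * (- inverse (sqrt y) / 2 + a * inverse (sqrt y) / 2 / (sqrt y)\<^sup>2)))) (at y)"
    unfolding rig_cdf_def[abs_def] using y
    by (auto intro!: derivative_eq_intros DERIV_chain2[OF std_normal_cdf_has_derivative] DERIV_real_sqrt
        simp: power2_eq_square field_simps)
  also have "(std_normal_density (sqrt y - a / sqrt y) * (inverse (sqrt y) / 2 + a * inverse (sqrt y) / 2 / (sqrt y)\<^sup>2)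
      + s * exp (2 * a) * (std_normal_density (- sqrt y - a / sqrt y) * (- inverse (sqrt y) / 2 + a * inverse (sqrt y) / 2 / (sqrt y)\<^sup>2)))
    = ((sqrt y * rig_density a y) * (inverse (sqrt y) / 2 + a * inverse (sqrt y) / 2 / y)
      + s * (sqrt y * rig_density a y) * (- inverse (sqrt y) / 2 + a * inverse (sqrt y) / 2 / y))"
    using std_normal_density_shift[OF y, of a] y by (simp add: algebra_simps)
  also have "\<dots> = ((1 - s) / 2 + (1 + s) / 2 * (a / y)) * rig_density a y"
    using y by (simp add: field_simps)
  finally show ?thesis .
qed

lemma nn_integral_FTC_greaterThan_0:
  fixes f F :: "real \<Rightarrow> real"
  assumes F: "\<And>y. 0 < y \<Longrightarrow> (F has_real_derivative f y) (at y)"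
    and f: "\<And>y. 0 < y \<Longrightarrow> isCont f y" "\<And>y. 0 < y \<Longrightarrow> 0 \<le> f y"
    and A: "(F \<longlongrightarrow> A) (at_right 0)" and B: "(F \<longlongrightarrow> B) at_top"
  shows "(\<integral>\<^sup>+y. ennreal (f y) * indicator {0<..} y \<partial>lborel) = ennreal (B - A)"
proof -
  have A': "((F \<circ> real_of_ereal) \<longlongrightarrow> A) (at_right 0)"
    using A by (simp add: zero_ereal_def ereal_tendsto_simps)
  have B': "((F \<circ> real_of_ereal) \<longlongrightarrow> B) (at_left \<infinity>)"
    using B by (simp add: ereal_tendsto_simps)
  note FTC = interval_integral_FTC_nonneg[of 0 \<infinity> F f, OF _ F f(1) _ A' B']
  have eq: "einterval 0 \<infinity> = {0<..}" by (auto simp: einterval_iff)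
  have int: "set_integrable lborel {0<..} f"
    using FTC(1) f(2) by (simp add: eq)
  have "(LBINT x=0..\<infinity>. f x) = B - A"
    using FTC(2) f(2) by simp
  then have val: "(LBINT x:{0<..}. f x) = B - A"
    by (simp add: interval_lebesgue_integral_def eq)
  have "(\<integral>\<^sup>+y. ennreal (f y) * indicator {0<..} y \<partial>lborel) = (\<integral>\<^sup>+y. ennreal (indicator {0<..} y *\<^sub>R f y) \<partial>lborel)"
    by (intro nn_integral_cong) (auto split: split_indicator)
  also have "\<dots> = ennreal (LBINT x:{0<..}. f x)"
    unfolding set_lebesgue_integral_def using int f(2)
    by (intro nn_integral_eq_integral) (auto simp: set_integrable_def split: split_indicator)
  finally show ?thesis using val by simp
qed

lemma rig_density_isCont: "0 < y \<Longrightarrow> isCont (rig_density a) y"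
proof -
  assume y: "0 < y"
  have "isCont (\<lambda>y. exp (- (y - a)\<^sup>2 / (2 * y)) / sqrt (2 * pi * y)) y"
    using y by (intro continuous_intros) auto
  moreover have "\<forall>\<^sub>F x in nhds y. rig_density a x = exp (- (x - a)\<^sup>2 / (2 * x)) / sqrt (2 * pi * x)"
    using y unfolding eventually_nhds
    by (intro exI[of _ "{0<..}"]) (auto simp: rig_density_def)
  ultimately show ?thesis by (simp add: isCont_cong)
qed

lemma filterlim_arguments_rig_cdf:
  fixes a :: real
  shows "filterlim (\<lambda>y. sqrt y - a / sqrt y) at_top at_top"
    and "filterlim (\<lambda>y. - sqrt y - a / sqrt y) at_bot at_top"
    and "0 < a \<Longrightarrow> filterlim (\<lambda>y. sqrt y - a / sqrt y) at_bot (at_right 0)"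
    and "0 < a \<Longrightarrow> filterlim (\<lambda>y. - sqrt y - a / sqrt y) at_bot (at_right 0)"
  by real_asymp+

lemma rig_cdf_at_top: "(rig_cdf s a \<longlongrightarrow> 1) at_top"
proof -
  have "((\<lambda>y. std_normal_cdf (sqrt y - a / sqrt y) + s * exp (2 * a) * std_normal_cdf (- sqrt y - a / sqrt y))
    \<longlongrightarrow> 1 + s * exp (2 * a) * 0) at_top"
    by (intro tendsto_intros filterlim_compose[OF std_normal_cdf_limits(1)]
        filterlim_compose[OF std_normal_cdf_limits(2)] filterlim_arguments_rig_cdf)
  then show ?thesis by (simp add: rig_cdf_def[abs_def])
qed

lemma rig_cdf_at_right_0:
  assumes "0 \<le> a" "a = 0 \<Longrightarrow> s = -1"
  shows "(rig_cdf s a \<longlongrightarrow> 0) (at_right 0)"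
proof (cases "a = 0")
  case True
  have c: "isCont std_normal_cdf x" for x
    using std_normal_cdf_has_derivative DERIV_isCont by blast
  have "((\<lambda>y. std_normal_cdf (sqrt y) - std_normal_cdf (- sqrt y))
     \<longlongrightarrow> std_normal_cdf (sqrt 0) - std_normal_cdf (- sqrt 0)) (at_right 0)"
    by (intro tendsto_intros isCont_tendsto_compose[OF c])
  then show ?thesis using True assms(2) by (simp add: rig_cdf_def[abs_def])
next
  case False
  then have a: "0 < a" using assms by simp
  have "((\<lambda>y. std_normal_cdf (sqrt y - a / sqrt y) + s * exp (2 * a) * std_normal_cdf (- sqrt y - a / sqrt y))
    \<longlongrightarrow> 0 + s * exp (2 * a) * 0) (at_right 0)"
    by (intro tendsto_intros filterlim_compose[OF std_normal_cdf_limits(2)]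
        filterlim_arguments_rig_cdf a)
  then show ?thesis by (simp add: rig_cdf_def[abs_def])
qed

lemma nn_integral_rig_density:
  assumes "0 \<le> a"
  shows "(\<integral>\<^sup>+y. ennreal (rig_density a y) \<partial>lborel) = 1"
proof -
  have "(\<integral>\<^sup>+y. ennreal (rig_density a y) * indicator {0<..} y \<partial>lborel) = ennreal (1 - 0)"
  proof (rule nn_integral_FTC_greaterThan_0)
    show "(rig_cdf (-1) a has_real_derivative rig_density a y) (at y)" if "0 < y" for y
      using rig_cdf_has_derivative[OF that, of "-1" a] by simp
    show "(rig_cdf (-1) a \<longlongrightarrow> 0) (at_right 0)" using assms by (intro rig_cdf_at_right_0) auto
  qed (auto simp: rig_density_isCont rig_density_nonneg rig_cdf_at_top)
  moreover have "ennreal (rig_density a y) * indicator {0<..} y = ennreal (rig_density a y)" for y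
    by (auto simp: rig_density_def split: split_indicator)
  ultimately show ?thesis by simp
qed

lemma nn_integral_rig_density_div:
  assumes "0 < a"
  shows "(\<integral>\<^sup>+y. ennreal (a / y * rig_density a y) \<partial>lborel) = 1"
proof -
  have "(\<integral>\<^sup>+y. ennreal (a / y * rig_density a y) * indicator {0<..} y \<partial>lborel) = ennreal (1 - 0)"
  proof (rule nn_integral_FTC_greaterThan_0)
    show "(rig_cdf 1 a has_real_derivative a / y * rig_density a y) (at y)" if "0 < y" for y
      using rig_cdf_has_derivative[OF that, of 1 a] by simp
    show "(rig_cdf 1 a \<longlongrightarrow> 0) (at_right 0)" using assms by (intro rig_cdf_at_right_0) auto
    show "isCont (\<lambda>y. a / y * rig_density a y) y" if "0 < y" for y
      using that by (intro continuous_intros rig_density_isCont) auto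
  qed (use assms in \<open>auto simp: rig_density_nonneg rig_cdf_at_top\<close>)
  moreover have "ennreal (a / y * rig_density a y) * indicator {0<..} y = ennreal (a / y * rig_density a y)" for y
    by (auto simp: rig_density_def split: split_indicator)
  ultimately show ?thesis by simp
qed

text \<open>Half of the exponent is used for the bound \<open>exp (- m)\<close>. What remains is, up to the factor \<open>sqrt 2\<close>,
  the density with parameter \<open>a / 2\<close> after scaling by 2, so that only its total mass is needed.\<close>

lemma nn_integral_rig_density_tail:
  assumes a: "0 \<le> a" and m: "0 \<le> m"
    and S: "\<And>y. y \<in> S \<Longrightarrow> 0 < y \<Longrightarrow> m \<le> (y - a)\<^sup>2 / (4 * y)" and [measurable]: "S \<in> sets borel"
  shows "(\<integral>\<^sup>+y. ennreal (rig_density a y) * indicator S y \<partial>lborel) \<le> ennreal (sqrt 2 * exp (- m))"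
proof -
  have *: "rig_density a y * indicator S y \<le> exp (- m) / sqrt 2 * rig_density (a / 2) (y / 2)" for y
  proof (cases "0 < y \<and> y \<in> S")
    case True
    then have y: "0 < y" "y \<in> S" by auto
    have "- (y - a)\<^sup>2 / (2 * y) = - ((y - a)\<^sup>2 / (4 * y)) - (y / 2 - a / 2)\<^sup>2 / (2 * (y / 2))"
      using y by (simp add: field_simps power2_eq_square)
    also have "\<dots> \<le> - m - (y / 2 - a / 2)\<^sup>2 / (2 * (y / 2))" using S[OF y(2,1)] by simp
    finally have "exp (- (y - a)\<^sup>2 / (2 * y)) \<le> exp (- m) * exp (- (y / 2 - a / 2)\<^sup>2 / (2 * (y / 2)))"
      by (simp add: exp_add[symmetric])
    then have "exp (- (y - a)\<^sup>2 / (2 * y)) / sqrt (2 * pi * y)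
        \<le> exp (- m) * exp (- (y / 2 - a / 2)\<^sup>2 / (2 * (y / 2))) / sqrt (2 * pi * y)"
      using y by (intro divide_right_mono) auto
    also have "sqrt (2 * pi * y) = sqrt 2 * sqrt (2 * pi * (y / 2))"
      using y by (simp add: real_sqrt_mult[symmetric])
    finally show ?thesis using y by (simp add: rig_density_def real_sqrt_mult)
  qed (auto simp: rig_density_def)
  have "(\<integral>\<^sup>+y. ennreal (rig_density a y) * indicator S y \<partial>lborel)
      = (\<integral>\<^sup>+y. ennreal (rig_density a y * indicator S y) \<partial>lborel)"
    by (intro nn_integral_cong) (auto split: split_indicator)
  also have "\<dots> \<le> (\<integral>\<^sup>+y. ennreal (exp (- m) / sqrt 2 * rig_density (a / 2) (y / 2)) \<partial>lborel)"
    by (intro nn_integral_mono ennreal_leI *)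
  also have "\<dots> = ennreal (exp (- m) / sqrt 2) * (\<integral>\<^sup>+y. ennreal (rig_density (a / 2) (y / 2)) \<partial>lborel)"
    by (subst nn_integral_cmult[symmetric]) (auto intro!: nn_integral_cong ennreal_mult' simp del: times_divide_eq_left)
  also have "(\<integral>\<^sup>+y. ennreal (rig_density (a / 2) (y / 2)) \<partial>lborel) = 2 * (\<integral>\<^sup>+y. ennreal (rig_density (a / 2) y) \<partial>lborel)"
    by (subst nn_integral_real_affine[where c=2 and t=0]) auto
  also have "\<dots> = 2" using a by (simp add: nn_integral_rig_density)
  also have "ennreal (exp (- m) / sqrt 2) * 2 = ennreal (exp (- m) / sqrt 2 * 2)"
    by (subst ennreal_mult'') simp_all
  also have "exp (- m) / sqrt 2 * 2 = sqrt 2 * exp (- m)"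
    by (simp add: field_simps)
  finally show ?thesis .
qed

text \<open>The density is at most \<open>1 / sqrt (2 \<pi> y)\<close>, uniformly in \<open>a\<close>, and \<open>2 \<pi> \<ge> 4\<close>.\<close>

lemma nn_integral_rig_density_small:
  assumes s: "0 < s"
  shows "(\<integral>\<^sup>+y. ennreal (rig_density a y) * indicator {..s} y \<partial>lborel) \<le> ennreal (sqrt s)"
proof -
  have *: "ennreal (rig_density a y) * indicator {..s} y \<le> ennreal (1 / (2 * sqrt y)) * indicator {0..s} y" for y
  proof (cases "0 < y")
    case True
    have "rig_density a y \<le> 1 / sqrt (2 * pi * y)"
      using True by (auto simp: rig_density_def intro!: divide_right_mono)
    also have "\<dots> \<le> 1 / (2 * sqrt y)"
    proof -
      have "2 * sqrt y = sqrt (4 * y)" by (simp add: real_sqrt_mult)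
      also have "\<dots> \<le> sqrt (2 * pi * y)" using True pi_gt3 by (intro real_sqrt_le_mono mult_right_mono) auto
      finally show ?thesis using True by (intro divide_left_mono) auto
    qed
    finally show ?thesis using True by (auto intro!: ennreal_leI split: split_indicator)
  qed (auto simp: rig_density_def)
  have "(\<integral>\<^sup>+y. ennreal (rig_density a y) * indicator {..s} y \<partial>lborel)
      \<le> (\<integral>\<^sup>+y. ennreal (1 / (2 * sqrt y)) * indicator {0..s} y \<partial>lborel)"
    by (intro nn_integral_mono *)
  also have "\<dots> \<le> ennreal (sqrt s)"
  proof -
    have "((\<lambda>y. 1 / (2 * sqrt y)) has_integral (sqrt s - sqrt 0)) {0..s}"
    proof (rule fundamental_theorem_of_calculus_interior)
      show "continuous_on {0..s} sqrt" by (intro continuous_intros)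
      show "(sqrt has_vector_derivative 1 / (2 * sqrt y)) (at y)" if "y \<in> {0<..<s}" for y
        using that unfolding has_real_derivative_iff_has_vector_derivative[symmetric]
        by (auto intro!: derivative_eq_intros simp: field_simps)
    qed (use s in auto)
    then have "(\<integral>\<^sup>+y. ennreal (1 / (2 * sqrt y)) * indicator {0..s} y \<partial>lborel) = ennreal (sqrt s - sqrt 0)"
      by (intro nn_integral_has_integral_lebesgue') auto
    then show ?thesis by simp
  qed
  finally show ?thesis .
qed

text \<open>The two identities reduce the mass and the mean of the inverse Gaussian law to integrals of the
  reciprocal density.\<close>

lemma inv_gauss_density_eq_rig:
  assumes W: "0 < W"
  shows "inv_gauss_density W s = W * (W / (W * s) * rig_density W (W * s))"
    and "s * inv_gauss_density W s = W * rig_density W (W * s)"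
proof -
  have "inv_gauss_density W s = W * (W / (W * s) * rig_density W (W * s))
    \<and> s * inv_gauss_density W s = W * rig_density W (W * s)"
  proof (cases "0 < s")
    case True
    have e: "(W * s - W)\<^sup>2 / (2 * (W * s)) = W * (s - 1)\<^sup>2 / (2 * s)"
    proof -
      have "(W * s - W)\<^sup>2 = W * (W * (s - 1)\<^sup>2)" by (simp add: power2_eq_square algebra_simps)
      moreover have "2 * (W * s) = W * (2 * s)" by simp
      ultimately show ?thesis using W by (simp only: mult_divide_mult_cancel_left_if) simp
    qed
    have r: "sqrt (W / (2 * pi * s ^ 3)) = W / (s * sqrt (2 * pi * (W * s)))"
    proof (rule real_sqrt_unique)
      show "(W / (s * sqrt (2 * pi * (W * s))))\<^sup>2 = W / (2 * pi * s ^ 3)"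
        using True W by (simp add: power_divide power_mult_distrib) (simp add: field_simps eval_nat_numeral)
    qed (use True W in auto)
    have e': "- (W * s - W)\<^sup>2 / (2 * (W * s)) = - W * (s - 1)\<^sup>2 / (2 * s)" using e by simp
    have "0 < W * s" using True W by simp
    then show ?thesis using True W
      unfolding inv_gauss_density_def rig_density_def r e' by simp
  next
    case False
    then have "\<not> 0 < W * s" using W by (simp add: zero_less_mult_iff)
    then show ?thesis using False by (auto simp: inv_gauss_density_def rig_density_def split: split_indicator)
  qed
  then show "inv_gauss_density W s = W * (W / (W * s) * rig_density W (W * s))"
    "s * inv_gauss_density W s = W * rig_density W (W * s)" by auto
qed

lemma inv_gauss_density_measurable [measurable]: "inv_gauss_density W \<in> borel_measurable borel"
  unfolding inv_gauss_density_def[abs_def] by measurable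

lemma inv_gauss_density_nonneg: "0 < W \<Longrightarrow> 0 \<le> inv_gauss_density W s"
  by (auto simp: inv_gauss_density_def split: split_indicator)

lemma sets_inv_gauss [simp, measurable_cong]: "sets (inv_gauss W) = sets borel"
  and space_inv_gauss [simp]: "space (inv_gauss W) = UNIV"
  by (simp_all add: inv_gauss_def)

lemma prob_space_inv_gauss:
  assumes W: "0 < W"
  shows "prob_space (inv_gauss W)"
proof
  have "emeasure (inv_gauss W) (space (inv_gauss W)) = (\<integral>\<^sup>+s. ennreal (inv_gauss_density W s) \<partial>lborel)"
    by (simp add: inv_gauss_def emeasure_density)
  also have "\<dots> = (\<integral>\<^sup>+s. ennreal W * ennreal (W / (W * s) * rig_density W (W * s)) \<partial>lborel)"
    unfolding inv_gauss_density_eq_rig(1)[OF W] using W by (intro nn_integral_cong ennreal_mult') simp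
  also have "\<dots> = ennreal W * (\<integral>\<^sup>+s. ennreal (W / (W * s) * rig_density W (W * s)) \<partial>lborel)"
    by (rule nn_integral_cmult) simp
  also have "\<dots> = (\<integral>\<^sup>+y. ennreal (W / y * rig_density W y) \<partial>lborel)"
    using W by (subst nn_integral_real_affine[where c=W and t=0]) auto
  also have "\<dots> = 1" by (rule nn_integral_rig_density_div[OF W])
  finally show "emeasure (inv_gauss W) (space (inv_gauss W)) = 1" .
qed

lemma AE_inv_gauss_pos: "AE s in inv_gauss W. 0 < s"
  unfolding inv_gauss_def
proof (subst AE_density)
  show "AE s in lborel. 0 < ennreal (inv_gauss_density W s) \<longrightarrow> 0 < s"
  proof (intro AE_I2 impI)
    fix s assume "0 < ennreal (inv_gauss_density W s)"
    then have "s \<noteq> 0" "\<not> s < 0" by (auto simp: inv_gauss_density_def)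
    then show "0 < s" by simp
  qed
qed simp

lemma nn_integral_inv_gauss_mean:
  assumes W: "0 < W"
  shows "(\<integral>\<^sup>+s. ennreal s \<partial>inv_gauss W) = 1"
proof -
  have "(\<integral>\<^sup>+s. ennreal s \<partial>inv_gauss W) = (\<integral>\<^sup>+s. ennreal (inv_gauss_density W s) * ennreal s \<partial>lborel)"
    by (simp add: inv_gauss_def nn_integral_density)
  also have "\<dots> = (\<integral>\<^sup>+s. ennreal W * ennreal (rig_density W (W * s)) \<partial>lborel)"
  proof (intro nn_integral_cong)
    fix s
    show "ennreal (inv_gauss_density W s) * ennreal s = ennreal W * ennreal (rig_density W (W * s))"
      using inv_gauss_density_eq_rig(2)[OF W, of s] inv_gauss_density_nonneg[OF W, of s] W
      by (subst ennreal_mult'[symmetric], simp, subst ennreal_mult'[symmetric]) (simp_all add: mult.commute)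
  qed
  also have "\<dots> = ennreal W * (\<integral>\<^sup>+s. ennreal (rig_density W (W * s)) \<partial>lborel)"
    by (rule nn_integral_cmult) simp
  also have "\<dots> = (\<integral>\<^sup>+y. ennreal (rig_density W y) \<partial>lborel)"
    using W by (subst nn_integral_real_affine[where c=W and t=0]) auto
  also have "\<dots> = 1" using W by (intro nn_integral_rig_density) simp
  finally show ?thesis .
qed

text \<open>The mean of \<open>(sqrt A - 1)\<^sup>2\<close> equals \<open>2 - 2 E (sqrt A)\<close> since \<open>E A = 1\<close>, and it is positive because
  \<open>A\<close> has a density.\<close>

lemma inv_gauss_sqrt_mean_less_1:
  assumes W: "0 < W"
  shows "(\<integral>\<^sup>+s. ennreal (sqrt s) \<partial>inv_gauss W) < 1"
proof -
  let ?M = "inv_gauss W"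
  interpret prob_space ?M by (rule prob_space_inv_gauss[OF W])
  have int: "integrable ?M (\<lambda>s. s)" and mean: "(\<integral>s. s \<partial>?M) = 1"
  proof -
    show "integrable ?M (\<lambda>s. s)"
      using nn_integral_inv_gauss_mean[OF W] AE_inv_gauss_pos[of W]
      by (intro integrableI_nonneg) auto
    show "(\<integral>s. s \<partial>?M) = 1"
      using nn_integral_inv_gauss_mean[OF W] AE_inv_gauss_pos[of W]
      by (subst integral_eq_nn_integral) auto
  qed
  have ints: "integrable ?M sqrt"
  proof (rule Bochner_Integration.integrable_bound)
    show "integrable ?M (\<lambda>s. 1 + s)" using int by (intro Bochner_Integration.integrable_add) simp_all
    show "sqrt \<in> borel_measurable ?M" by measurable
    show "AE x in ?M. norm (sqrt x) \<le> norm (1 + x)"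
      using AE_inv_gauss_pos[of W]
    proof eventually_elim
      case (elim x)
      have "0 \<le> (sqrt x - 1)\<^sup>2" by simp
      then have "2 * sqrt x \<le> 1 + x" using elim by (simp add: power2_diff)
      moreover have "0 \<le> sqrt x" using elim by simp
      ultimately show ?case using elim by simp
    qed
  qed
  have sq: "AE s in ?M. (sqrt s - 1)\<^sup>2 = s + 1 - 2 * sqrt s"
    using AE_inv_gauss_pos[of W] by eventually_elim (simp add: power2_diff)
  have intq: "integrable ?M (\<lambda>s. (sqrt s - 1)\<^sup>2)"
  proof -
    have "integrable ?M (\<lambda>s. s + 1 - 2 * sqrt s)"
      using int ints
      by (intro Bochner_Integration.integrable_diff Bochner_Integration.integrable_add integrable_mult_right) simp_all
    then show ?thesis
      by (rule Bochner_Integration.integrable_cong_AE_imp) (use sq in \<open>auto elim: AE_mp\<close>)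
  qed
  have "(\<integral>s. (sqrt s - 1)\<^sup>2 \<partial>?M) = (\<integral>s. s + 1 - 2 * sqrt s \<partial>?M)"
    using sq by (intro integral_cong_AE) auto
  also have "\<dots> = 2 - 2 * (\<integral>s. sqrt s \<partial>?M)"
    using int ints mean prob_space by (simp add: Bochner_Integration.integral_diff Bochner_Integration.integral_add)
  finally have eq: "(\<integral>s. (sqrt s - 1)\<^sup>2 \<partial>?M) = 2 - 2 * (\<integral>s. sqrt s \<partial>?M)" .
  have "(\<integral>s. (sqrt s - 1)\<^sup>2 \<partial>?M) \<noteq> 0"
  proof
    assume "(\<integral>s. (sqrt s - 1)\<^sup>2 \<partial>?M) = 0"
    then have "AE s in ?M. (sqrt s - 1)\<^sup>2 = 0"
      using intq by (subst (asm) integral_nonneg_eq_0_iff_AE) auto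
    then have "AE s in ?M. s = 1" by eventually_elim simp
    moreover have "AE s in ?M. s \<noteq> 1"
      unfolding inv_gauss_def by (subst AE_density) (auto intro: AE_mp[OF AE_lborel_singleton])
    ultimately have "AE s in ?M. False" by eventually_elim simp
    then show False by simp
  qed
  moreover have "0 \<le> (\<integral>s. (sqrt s - 1)\<^sup>2 \<partial>?M)" by simp
  ultimately have "(\<integral>s. sqrt s \<partial>?M) < 1" using eq by linarith
  moreover have "(\<integral>\<^sup>+s. ennreal (sqrt s) \<partial>?M) = ennreal (\<integral>s. sqrt s \<partial>?M)"
    using ints AE_inv_gauss_pos[of W] by (intro nn_integral_eq_integral) auto
  ultimately show ?thesis by (simp add: ennreal_less_one_iff)
qed

lemma sets_gamma_half [simp, measurable_cong]: "sets gamma_half = sets borel"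
  and space_gamma_half [simp]: "space gamma_half = UNIV"
  by (simp_all add: gamma_half_def)

lemma prob_space_gamma_half: "prob_space gamma_half"
proof
  have *: "indicator {0<..} x / sqrt (pi * x) * exp (- x) = 2 * rig_density 0 (2 * x)" for x :: real
  proof (cases "0 < x")
    case True
    have "sqrt (2 * pi * (2 * x)) = sqrt (4 * (pi * x))" by (simp add: algebra_simps)
    also have "\<dots> = 2 * sqrt (pi * x)" by (simp add: real_sqrt_mult)
    finally show ?thesis using True by (simp add: rig_density_def power2_eq_square)
  qed (auto simp: rig_density_def)
  have "emeasure gamma_half (space gamma_half) = (\<integral>\<^sup>+x. ennreal (2 * rig_density 0 (2 * x)) \<partial>lborel)"
    unfolding gamma_half_def * by (simp add: emeasure_density)
  also have "\<dots> = ennreal 2 * (\<integral>\<^sup>+x. ennreal (rig_density 0 (2 * x)) \<partial>lborel)"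
    by (subst nn_integral_cmult[symmetric]) (auto simp: ennreal_mult rig_density_nonneg intro!: nn_integral_cong)
  also have "\<dots> = (\<integral>\<^sup>+y. ennreal (rig_density 0 y) \<partial>lborel)"
    by (subst nn_integral_real_affine[where c=2 and t=0]) auto
  also have "\<dots> = 1" by (rule nn_integral_rig_density) simp
  finally show "emeasure gamma_half (space gamma_half) = 1" .
qed

lemma AE_gamma_half_pos: "AE x in gamma_half. 0 < x"
  unfolding gamma_half_def by (subst AE_density) (auto split: split_indicator)

section \<open>The finite-volume laws of the potential\<close>

locale weighted_graph =
  fixes E :: "'v set set" and W :: real
  assumes no_loop: "{i} \<notin> E" and finite_nbrs: "finite (nbrs E i)" and W_pos: "0 < W"
begin

abbreviation "H \<equiv> H_mat E W"
abbreviation "w \<equiv> cond E W"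

lemma cond_sym: "w i j = w j i"
  by (simp add: cond_def insert_commute)

lemma cond_self [simp]: "w i i = 0"
  by (simp add: cond_def no_loop)

lemma cond_nonneg: "0 \<le> w i j"
  using W_pos by (simp add: cond_def)

lemma H_diag: "H \<beta> i i = 2 * \<beta> i"
  by (simp add: H_mat_def)

lemma sym_H: "sym_on U (H \<beta>)"
  by (auto simp: sym_on_def H_mat_def cond_sym)

text \<open>The Green function of \<open>U\<close>, set to 0 at potentials that are not positive definite on \<open>U\<close> so that it is
  a measurable and nonnegative function of every potential.\<close>

definition green :: "'v set \<Rightarrow> ('v \<Rightarrow> real) \<Rightarrow> 'v \<Rightarrow> 'v \<Rightarrow> real" where
  "green U \<beta> i j = (if pos_def_on U (H \<beta>) then inverse_on U (H \<beta>) i j else 0)"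

text \<open>Where \<open>H \<beta>\<close> is positive definite on \<open>U\<close>, this is the vector of Gaussian elimination: the extension of
  the value 1 at \<open>k\<close> that is annihilated by \<open>H \<beta>\<close> on \<open>U\<close> and vanishes outside \<open>insert k U\<close>.\<close>

definition harm_ext :: "'v set \<Rightarrow> ('v \<Rightarrow> real) \<Rightarrow> 'v \<Rightarrow> 'v \<Rightarrow> real" where
  "harm_ext U \<beta> k i = (if i = k then 1 else \<Sum>l\<in>U. green U \<beta> i l * w l k)"

text \<open>Where \<open>H \<beta>\<close> is positive definite on \<open>U\<close>, the Schur complement of \<open>U\<close> at \<open>k\<close> is \<open>2 * \<beta> k\<close>
  minus this quantity, which depends on \<open>\<beta>\<close> only
  through its values on \<open>U\<close>.\<close>

definition self_energy :: "'v set \<Rightarrow> ('v \<Rightarrow> real) \<Rightarrow> 'v \<Rightarrow> real" where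
  "self_energy U \<beta> k = (\<Sum>i\<in>U. w k i * harm_ext U \<beta> k i)"

text \<open>The field that \<open>k\<close> feels once \<open>U\<close> has been eliminated; it is the parameter of the conditional law of
  the Schur complement at \<open>k\<close>.\<close>

definition eff_field :: "'v set \<Rightarrow> ('v \<Rightarrow> real) \<Rightarrow> ('v \<Rightarrow> real) \<Rightarrow> 'v \<Rightarrow> real" where
  "eff_field U \<beta> \<eta> k = (\<Sum>i\<in>insert k U. harm_ext U \<beta> k i * \<eta> i)"

lemma green_inverse_pair:
  "finite U \<Longrightarrow> pos_def_on U (H \<beta>) \<Longrightarrow> inverse_pair U (H \<beta>) (green U \<beta>)"
  using inverse_on_pos_def[OF _ sym_H] by (simp add: green_def[abs_def])

lemma green_outside: "finite U \<Longrightarrow> i \<notin> U \<or> j \<notin> U \<Longrightarrow> green U \<beta> i j = 0"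
  using green_inverse_pair[of U \<beta>] by (auto simp: green_def inverse_pair_def)

lemma green_sym: "finite U \<Longrightarrow> green U \<beta> i j = green U \<beta> j i"
  using inverse_pair_symmetric[OF _ sym_H green_inverse_pair, of U \<beta>]
  by (cases "pos_def_on U (H \<beta>)") (auto simp: green_def)

lemma elim_vec_H:
  assumes "k \<notin> U" "pos_def_on U (H \<beta>)"
  shows "elim_vec U (H \<beta>) k i = harm_ext U \<beta> k i"
proof -
  have "(\<Sum>l\<in>U. inverse_on U (H \<beta>) i l * H \<beta> l k) = - (\<Sum>l\<in>U. inverse_on U (H \<beta>) i l * w l k)"
    unfolding sum_negf[symmetric] using assms(1) by (intro sum.cong) (auto simp: H_mat_def)
  then show ?thesis using assms(2) by (simp add: elim_vec_def harm_ext_def green_def)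
qed

lemma schur_H:
  assumes "finite U" "k \<notin> U" "pos_def_on U (H \<beta>)"
  shows "schur U (H \<beta>) k = 2 * \<beta> k - self_energy U \<beta> k"
proof -
  have "(\<Sum>i\<in>U. H \<beta> k i * harm_ext U \<beta> k i) = - (\<Sum>i\<in>U. w k i * harm_ext U \<beta> k i)"
    unfolding sum_negf[symmetric] using assms(2) by (intro sum.cong) (auto simp: H_mat_def)
  then show ?thesis using assms elim_vec_H[OF assms(2,3)]
    by (simp add: schur_def self_energy_def H_diag) (simp add: harm_ext_def)
qed

lemma pos_def_insert:
  assumes U: "finite U" "k \<notin> U"
  shows "pos_def_on (insert k U) (H \<beta>) \<longleftrightarrow> pos_def_on U (H \<beta>) \<and> 0 < 2 * \<beta> k - self_energy U \<beta> k"
proof (cases "pos_def_on U (H \<beta>)")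
  case True
  then show ?thesis
    using pos_def_on_insert[OF U sym_H inverse_on_pos_def[OF U(1) sym_H True]] schur_H[OF U True] by simp
qed (use pos_def_on_insertD[OF U] in blast)

lemma green_insert:
  assumes U: "finite U" "k \<notin> U" and P: "pos_def_on (insert k U) (H \<beta>)"
  shows "green (insert k U) \<beta> i j = green U \<beta> i j + harm_ext U \<beta> k i * harm_ext U \<beta> k j / (2 * \<beta> k - self_energy U \<beta> k)"
proof -
  have P': "pos_def_on U (H \<beta>)" "0 < 2 * \<beta> k - self_energy U \<beta> k" using P pos_def_insert[OF U] by auto
  then show ?thesis
    using inverse_on_insert[OF U sym_H inverse_on_pos_def[OF U(1) sym_H P'(1)], of i j] P
    by (simp add: schur_H[OF U P'(1)] elim_vec_H[OF U(2) P'(1)] green_def)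
qed

text \<open>All terms of the formula for adding a vertex are nonnegative, because the off-diagonal entries of
  \<open>H \<beta>\<close> are not positive.\<close>

lemma green_nonneg: "finite U \<Longrightarrow> 0 \<le> green U \<beta> i j"
proof (induction U arbitrary: i j rule: finite_induct)
  case (insert k U)
  have g: "0 \<le> harm_ext U \<beta> k i" for i
    unfolding harm_ext_def by (auto intro!: sum_nonneg mult_nonneg_nonneg insert.IH cond_nonneg)
  show ?case
  proof (cases "pos_def_on (insert k U) (H \<beta>)")
    case True
    then have "0 < 2 * \<beta> k - self_energy U \<beta> k" using pos_def_insert[OF insert(1,2)] by auto
    then show ?thesis unfolding green_insert[OF insert(1,2) True]
      by (intro add_nonneg_nonneg insert.IH divide_nonneg_pos mult_nonneg_nonneg g)
  qed (simp add: green_def)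
qed (simp add: green_outside)

lemma harm_ext_nonneg: "finite U \<Longrightarrow> 0 \<le> harm_ext U \<beta> k i"
  unfolding harm_ext_def by (auto intro!: sum_nonneg mult_nonneg_nonneg green_nonneg cond_nonneg)

lemma harm_ext_self [simp]: "harm_ext U \<beta> k k = 1"
  by (simp add: harm_ext_def)

lemma eff_field_nonneg:
  assumes "finite U" "\<And>i. i \<in> insert k U \<Longrightarrow> 0 \<le> \<eta> i"
  shows "0 \<le> eff_field U \<beta> \<eta> k"
  unfolding eff_field_def using assms harm_ext_nonneg by (intro sum_nonneg mult_nonneg_nonneg) auto

subsection \<open>Dependence on the potential\<close>

lemma form_on_cong:
  "(\<And>i j. i \<in> U \<Longrightarrow> j \<in> U \<Longrightarrow> A i j = B i j) \<Longrightarrow> (\<And>i. i \<in> U \<Longrightarrow> f i = h i) \<Longrightarrow> form_on U A f = form_on U B h"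
  unfolding form_on_def by (intro sum.cong) auto

lemma pos_def_cong:
  assumes "\<And>i. i \<in> U \<Longrightarrow> \<beta> i = \<beta>' i"
  shows "pos_def_on U (H \<beta>) = pos_def_on U (H \<beta>')"
proof -
  have "form_on U (H \<beta>) f = form_on U (H \<beta>') f" for f
    by (rule form_on_cong) (simp_all add: H_mat_def assms)
  then show ?thesis by (simp add: pos_def_on_def)
qed

lemma inverse_on_H_cong:
  assumes "\<And>i. i \<in> U \<Longrightarrow> \<beta> i = \<beta>' i"
  shows "inverse_on U (H \<beta>) = inverse_on U (H \<beta>')"
proof -
  have "(\<Sum>k\<in>U. H \<beta> i k * B k j) = (\<Sum>k\<in>U. H \<beta>' i k * B k j)"
    "(\<Sum>k\<in>U. B i k * H \<beta> k j) = (\<Sum>k\<in>U. B i k * H \<beta>' k j)" if "i \<in> U" "j \<in> U" for B i j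
    using assms that by (auto intro!: sum.cong simp: H_mat_def)
  then show ?thesis unfolding inverse_on_def by (simp cong: ball_cong conj_cong)
qed

lemma green_cong:
  assumes "\<And>i. i \<in> U \<Longrightarrow> \<beta> i = \<beta>' i"
  shows "green U \<beta> = green U \<beta>'"
proof (intro ext)
  fix i j
  have "inverse_on U (H \<beta>) = inverse_on U (H \<beta>')" by (rule inverse_on_H_cong) (rule assms)
  moreover have "pos_def_on U (H \<beta>) = pos_def_on U (H \<beta>')" by (rule pos_def_cong) (rule assms)
  ultimately show "green U \<beta> i j = green U \<beta>' i j" by (simp add: green_def)
qed

lemma harm_ext_cong:
  assumes "\<And>i. i \<in> U \<Longrightarrow> \<beta> i = \<beta>' i"
  shows "harm_ext U \<beta> = harm_ext U \<beta>'"
proof -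
  have *: "green U \<beta> = green U \<beta>'" by (rule green_cong) (rule assms)
  show ?thesis unfolding harm_ext_def[abs_def] * ..
qed

lemma self_energy_cong:
  assumes "\<And>i. i \<in> U \<Longrightarrow> \<beta> i = \<beta>' i"
  shows "self_energy U \<beta> = self_energy U \<beta>'"
proof -
  have *: "harm_ext U \<beta> = harm_ext U \<beta>'" by (rule harm_ext_cong) (rule assms)
  show ?thesis unfolding self_energy_def[abs_def] * ..
qed

lemma eff_field_cong:
  assumes "\<And>i. i \<in> U \<Longrightarrow> \<beta> i = \<beta>' i"
  shows "eff_field U \<beta> = eff_field U \<beta>'"
proof -
  have *: "harm_ext U \<beta> = harm_ext U \<beta>'" by (rule harm_ext_cong) (rule assms)
  show ?thesis unfolding eff_field_def[abs_def] * ..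
qed

lemma nu_density_cong:
  assumes "\<And>i. i \<in> U \<Longrightarrow> \<beta> i = \<beta>' i" "\<And>i. i \<in> U \<Longrightarrow> \<eta> i = \<eta>' i"
  shows "nu_density E W U \<eta> \<beta> = nu_density E W U \<eta>' \<beta>'"
proof -
  have "form_on U (H \<beta>) (\<lambda>_. 1) = form_on U (H \<beta>') (\<lambda>_. 1)"
    by (rule form_on_cong) (simp_all add: H_mat_def assms)
  moreover have "form_on U (inverse_on U (H \<beta>)) \<eta> = form_on U (inverse_on U (H \<beta>')) \<eta>'"
    using inverse_on_H_cong[of U \<beta> \<beta>'] assms by (intro form_on_cong) simp_all
  moreover have "det_on U (H \<beta>) = det_on U (H \<beta>')"
    unfolding det_on_def using assms
    by (intro sum.cong refl arg_cong2[where f="(*)"] prod.cong) (simp add: H_mat_def)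
  moreover have "sum \<eta> U = sum \<eta>' U" using assms by simp
  ultimately show ?thesis
    using pos_def_cong[of U \<beta> \<beta>'] assms(1) by (simp add: nu_density_def)
qed

lemma det_on_pos: "finite U \<Longrightarrow> pos_def_on U (H \<beta>) \<Longrightarrow> 0 < det_on U (H \<beta>)"
proof (induction U rule: finite_induct)
  case empty
  then show ?case by (simp add: det_on_def)
next
  case (insert k U)
  then have P: "pos_def_on U (H \<beta>)" "0 < 2 * \<beta> k - self_energy U \<beta> k"
    using pos_def_insert[OF insert(1,2)] by auto
  show ?case
    using det_on_insert[OF insert(1,2) sym_H inverse_on_pos_def[OF insert(1) sym_H P(1)]]
      schur_H[OF insert(1,2) P(1)] P insert.IH by simp
qed

text \<open>With the Schur complement \<open>y\<close>, the self energy \<open>c\<close>, the effective field \<open>a\<close> and the vector \<open>w\<close> of the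
  conductances to \<open>k\<close>:
  \<open>\<langle>1, H 1\<rangle>\<close> grows by \<open>y + c - 2 \<langle>w, 1\<rangle>\<close>, \<open>\<langle>\<eta>, G \<eta>\<rangle>\<close> grows by \<open>a\<^sup>2 / y\<close>, and replacing \<open>\<eta>\<close> by
  \<open>\<eta> + w\<close> on \<open>U\<close> adds \<open>2 (a - \<eta> k) + c\<close> to \<open>\<langle>\<eta>, G \<eta>\<rangle>\<close> on \<open>U\<close>. The difference of the exponents is
  therefore \<open>- (y + a\<^sup>2 / y) / 2 + a = - (y - a)\<^sup>2 / (2 y)\<close>. The factor 2 is the Jacobian of
  \<open>y = 2 * \<beta> k - c\<close>.\<close>

lemma nu_density_insert:
  assumes U: "finite U" "k \<notin> U"
  shows "nu_density E W (insert k U) \<eta> \<beta> =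
    nu_density E W U (\<lambda>i. \<eta> i + w i k) \<beta> * (2 * rig_density (eff_field U \<beta> \<eta> k) (2 * \<beta> k - self_energy U \<beta> k))"
proof (cases "pos_def_on (insert k U) (H \<beta>)")
  case False
  then have "\<not> pos_def_on U (H \<beta>) \<or> \<not> 0 < 2 * \<beta> k - self_energy U \<beta> k"
    using pos_def_insert[OF U] by auto
  then show ?thesis using False by (auto simp: nu_density_def rig_density_def)
next
  case True
  then have P: "pos_def_on U (H \<beta>)" and ypos: "0 < 2 * \<beta> k - self_energy U \<beta> k"
    using pos_def_insert[OF U] by auto
  note inv = inverse_on_pos_def[OF U(1) sym_H P]
  define y where "y = 2 * \<beta> k - self_energy U \<beta> k"
  define a where "a = eff_field U \<beta> \<eta> k"
  define G where "G = inverse_on U (H \<beta>)"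
  define D where "D = det_on U (H \<beta>)"
  let ?g = "harm_ext U \<beta> k"
  let ?e = "\<lambda>i. \<eta> i + w i k"
  have y: "schur U (H \<beta>) k = y" "0 < y" using schur_H[OF U P] ypos by (simp_all add: y_def)
  have g: "elim_vec U (H \<beta>) k = ?g" using elim_vec_H[OF U(2) P] by auto
  have D: "0 < D" "det_on (insert k U) (H \<beta>) = y * D"
    using det_on_pos[OF U(1) P] det_on_insert[OF U sym_H inv] y by (simp_all add: D_def)
  have inveq: "form_on (insert k U) (inverse_on (insert k U) (H \<beta>)) \<eta> = form_on U G \<eta> + a\<^sup>2 / y"
    using form_on_inverse_insert[OF U sym_H inv, of \<eta>] y by (simp add: g a_def eff_field_def G_def)
  have one: "form_on (insert k U) (H \<beta>) (\<lambda>_. 1) = form_on U (H \<beta>) (\<lambda>_. 1) + 2 * \<beta> k - 2 * (\<Sum>i\<in>U. w i k)"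
  proof -
    have "(\<Sum>j\<in>U. H \<beta> k j) = - (\<Sum>i\<in>U. w i k)" "(\<Sum>i\<in>U. H \<beta> i k) = - (\<Sum>i\<in>U. w i k)"
      unfolding sum_negf[symmetric] using U by (auto intro!: sum.cong simp: H_mat_def cond_sym)
    then show ?thesis using U by (simp add: form_on_def sum.distrib H_diag)
  qed
  have Gsym: "G i j = G j i" for i j
    using inverse_pair_symmetric[OF U(1) sym_H inv] by (simp add: G_def)
  have Gw: "(\<Sum>j\<in>U. G i j * w j k) = ?g i" if "i \<in> U" for i
    using that U P by (auto simp: harm_ext_def green_def G_def)
  have gU: "(\<Sum>i\<in>U. ?g i * \<eta> i) = a - \<eta> k" using U by (simp add: a_def eff_field_def harm_ext_self)
  have gw: "(\<Sum>i\<in>U. ?g i * w i k) = self_energy U \<beta> k"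
    unfolding self_energy_def by (intro sum.cong) (auto simp: cond_sym mult.commute)
  have new: "form_on U G ?e = form_on U G \<eta> + 2 * (a - \<eta> k) + self_energy U \<beta> k"
  proof -
    have "form_on U G ?e = (\<Sum>i\<in>U. \<Sum>j\<in>U. \<eta> i * G i j * \<eta> j + \<eta> i * G i j * w j k + \<eta> j * G j i * w i k + w i k * G i j * w j k)"
      unfolding form_on_def by (intro sum.cong refl) (use Gsym in \<open>simp add: algebra_simps\<close>)
    also have "\<dots> = form_on U G \<eta> + (\<Sum>i\<in>U. \<Sum>j\<in>U. \<eta> i * G i j * w j k)
        + (\<Sum>i\<in>U. \<Sum>j\<in>U. \<eta> j * G j i * w i k) + (\<Sum>i\<in>U. \<Sum>j\<in>U. w i k * G i j * w j k)"
      by (simp only: sum.distrib form_on_def)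
    also have "(\<Sum>i\<in>U. \<Sum>j\<in>U. \<eta> j * G j i * w i k) = (\<Sum>i\<in>U. \<Sum>j\<in>U. \<eta> i * G i j * w j k)"
      by (rule sum.swap)
    also have "(\<Sum>i\<in>U. \<Sum>j\<in>U. \<eta> i * G i j * w j k) = (\<Sum>i\<in>U. \<eta> i * (\<Sum>j\<in>U. G i j * w j k))"
      by (simp only: sum_distrib_left mult.assoc)
    also have "\<dots> = (\<Sum>i\<in>U. ?g i * \<eta> i)" by (intro sum.cong refl) (simp add: Gw mult.commute)
    also have "(\<Sum>i\<in>U. \<Sum>j\<in>U. w i k * G i j * w j k) = (\<Sum>i\<in>U. w i k * (\<Sum>j\<in>U. G i j * w j k))"
      by (simp only: sum_distrib_left mult.assoc)
    also have "\<dots> = (\<Sum>i\<in>U. ?g i * w i k)" by (intro sum.cong refl) (simp add: Gw mult.commute)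
    finally show ?thesis by (simp add: gU gw)
  qed
  have expo: "- 1/2 * (form_on (insert k U) (H \<beta>) (\<lambda>_. 1) + (form_on U G \<eta> + a\<^sup>2 / y)) + (\<Sum>i\<in>insert k U. \<eta> i)
      = (- 1/2 * (form_on U (H \<beta>) (\<lambda>_. 1) + form_on U G ?e) + (\<Sum>i\<in>U. ?e i)) + (- (y - a)\<^sup>2 / (2 * y))"
  proof -
    have "- (y - a)\<^sup>2 / (2 * y) = - (y + a\<^sup>2 / y) / 2 + a"
      using y by (simp add: field_simps power2_eq_square)
    then show ?thesis unfolding one new using U by (simp add: sum.distrib y_def field_simps)
  qed
  have const: "(2 / pi) powr (real (card (insert k U)) / 2) * (y * D) powr (- 1/2)
      = (2 / pi) powr (real (card U) / 2) * D powr (- 1/2) * (2 / sqrt (2 * pi * y))"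
  proof -
    have "(2 / pi) powr (real (card (insert k U)) / 2) = (2 / pi) powr (real (card U) / 2) * (2 / pi) powr (1/2)"
      using U by (simp add: powr_add[symmetric] add_divide_distrib add.commute)
    moreover have "(y * D) powr (- 1/2) = D powr (- 1/2) * y powr (- 1/2)"
      using y D by (simp add: powr_mult)
    moreover have "(2 / pi) powr (1/2) * y powr (- 1/2) = 2 / sqrt (2 * pi * y)"
    proof -
      have 1: "y powr (- 1/2) = 1 / sqrt y"
        using y by (simp add: powr_minus_divide powr_half_sqrt)
      have 2: "(2 / pi) powr (1/2) = sqrt 2 / sqrt pi"
        by (simp add: powr_half_sqrt real_sqrt_divide)
      have 3: "sqrt (2 * pi * y) = sqrt 2 * (sqrt pi * sqrt y)"
        by (simp add: real_sqrt_mult)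
      show ?thesis unfolding 1 2 3 using y by (simp add: field_simps)
    qed
    ultimately show ?thesis by (simp add: mult.assoc mult.left_commute)
  qed
  have "nu_density E W (insert k U) \<eta> \<beta> = ((2 / pi) powr (real (card (insert k U)) / 2) * (y * D) powr (- 1/2))
     * exp (- 1/2 * (form_on (insert k U) (H \<beta>) (\<lambda>_. 1) + (form_on U G \<eta> + a\<^sup>2 / y)) + (\<Sum>i\<in>insert k U. \<eta> i))"
    using True unfolding nu_density_def inveq D(2) by simp
  also have "\<dots> = nu_density E W U ?e \<beta> * (2 * rig_density a y)"
    unfolding expo const exp_add[of _ "- (y - a)\<^sup>2 / (2 * y)"] using P y
    by (simp add: nu_density_def G_def D_def rig_density_def)
  finally show ?thesis by (simp add: a_def y_def)
qed

end

section \<open>Integrating out one vertex\<close>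

context weighted_graph
begin

abbreviation "PiL U \<equiv> PiM U (\<lambda>_. lborel :: real measure)"
abbreviation "bw \<equiv> boundary_weight E W"

text \<open>Positivity and the Green function have to be treated together, since adding a vertex expresses each of
  them through both.\<close>

lemma measurable_finite_green_aux:
  assumes "finite U" "\<And>i. i \<in> U \<Longrightarrow> (\<lambda>x. b x i) \<in> borel_measurable M"
  shows "Measurable.pred M (\<lambda>x. pos_def_on U (H (b x))) \<and> (\<forall>i j. (\<lambda>x. green U (b x) i j) \<in> borel_measurable M)"
  using assms
proof (induction U rule: finite_induct)
  case empty
  then show ?case by (simp add: pos_def_on_def green_outside)
next
  case (insert k U)
  have pred [measurable]: "Measurable.pred M (\<lambda>x. pos_def_on U (H (b x)))"
    and green [measurable]: "\<And>i j. (\<lambda>x. green U (b x) i j) \<in> borel_measurable M"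
    using insert by auto
  have bk [measurable]: "(\<lambda>x. b x k) \<in> borel_measurable M" using insert.prems by simp
  have harm_ext [measurable]: "(\<lambda>x. harm_ext U (b x) k i) \<in> borel_measurable M" for i
    unfolding harm_ext_def by (cases "i = k") (auto intro!: borel_measurable_sum)
  have self_energy [measurable]: "(\<lambda>x. self_energy U (b x) k) \<in> borel_measurable M"
    unfolding self_energy_def by measurable
  have pred': "Measurable.pred M (\<lambda>x. pos_def_on (insert k U) (H (b x)))"
    unfolding pos_def_insert[OF insert(1,2)] by measurable
  have eq: "green (insert k U) (b x) i j = (if pos_def_on (insert k U) (H (b x))
      then green U (b x) i j + harm_ext U (b x) k i * harm_ext U (b x) k j / (2 * b x k - self_energy U (b x) k) else 0)" for x i j
    using green_insert[OF insert(1,2)] by (auto simp: green_def)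
  note [measurable] = pred'
  show ?case
  proof (intro conjI allI)
    show "(\<lambda>x. green (insert k U) (b x) i j) \<in> borel_measurable M" for i j
      unfolding eq by measurable
  qed (rule pred')
qed

lemma
  assumes "finite U" "\<And>i. i \<in> U \<Longrightarrow> (\<lambda>x. b x i) \<in> borel_measurable M"
  shows measurable_pos_def: "Measurable.pred M (\<lambda>x. pos_def_on U (H (b x)))"
    and measurable_finite_green: "(\<lambda>x. green U (b x) i j) \<in> borel_measurable M"
    and measurable_self_energy: "(\<lambda>x. self_energy U (b x) k) \<in> borel_measurable M"
    and measurable_eff_field: "(\<lambda>x. eff_field U (b x) \<eta> k) \<in> borel_measurable M"
    and measurable_nu_density: "(\<lambda>x. nu_density E W U \<eta> (b x)) \<in> borel_measurable M"
proof -
  show pd [measurable]: "Measurable.pred M (\<lambda>x. pos_def_on U (H (b x)))"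
    using measurable_finite_green_aux[of U b M] assms by blast
  show green [measurable]: "(\<lambda>x. green U (b x) i j) \<in> borel_measurable M" for i j
    using measurable_finite_green_aux[of U b M] assms by blast
  have harm_ext [measurable]: "(\<lambda>x. harm_ext U (b x) k i) \<in> borel_measurable M" for k i
    unfolding harm_ext_def by (cases "i = k") (auto intro!: borel_measurable_sum)
  show "(\<lambda>x. self_energy U (b x) k) \<in> borel_measurable M"
    unfolding self_energy_def by measurable
  show "(\<lambda>x. eff_field U (b x) \<eta> k) \<in> borel_measurable M"
    unfolding eff_field_def by measurable
  have Hm: "(\<lambda>x. H (b x) i j) \<in> borel_measurable M" if "i \<in> U" for i j
    using assms(2)[OF that] unfolding H_mat_def by (cases "i = j") auto
  have det [measurable]: "(\<lambda>x. det_on U (H (b x))) \<in> borel_measurable M"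
    unfolding det_on_def using Hm by (intro borel_measurable_sum borel_measurable_times borel_measurable_prod) auto
  have f1 [measurable]: "(\<lambda>x. form_on U (H (b x)) (\<lambda>_. 1)) \<in> borel_measurable M"
    unfolding form_on_def using Hm by (intro borel_measurable_sum borel_measurable_times) auto
  have f2 [measurable]: "(\<lambda>x. form_on U (green U (b x)) \<eta>) \<in> borel_measurable M"
    unfolding form_on_def by measurable
  have "nu_density E W U \<eta> (b x) = (if pos_def_on U (H (b x)) then
        (2 / pi) powr (real (card U) / 2) *
        exp (- 1/2 * (form_on U (H (b x)) (\<lambda>_. 1) + form_on U (green U (b x)) \<eta>) + (\<Sum>i\<in>U. \<eta> i)) *
        det_on U (H (b x)) powr (- 1/2) else 0)" for x
    by (simp add: nu_density_def green_def[abs_def])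
  then show "(\<lambda>x. nu_density E W U \<eta> (b x)) \<in> borel_measurable M"
    by simp
qed

lemma PiL_component: "i \<in> U \<Longrightarrow> (\<lambda>\<beta>. \<beta> i) \<in> borel_measurable (PiL U)"
  using measurable_component_singleton[of i U "\<lambda>_. lborel :: real measure"] by simp

lemma nu_density_measurable [measurable]:
  "finite U \<Longrightarrow> (\<lambda>\<beta>. nu_density E W U \<eta> \<beta>) \<in> borel_measurable (PiL U)"
  by (rule measurable_nu_density) (auto intro: PiL_component)

lemma sets_nu_fin [simp, measurable_cong]: "sets (nu_fin E W U \<eta>) = sets (PiL U)"
  and space_nu_fin [simp]: "space (nu_fin E W U \<eta>) = space (PiL U)"
  by (simp_all add: nu_fin_def)

lemma nu_fin_cong:
  assumes "finite U" "\<And>i. i \<in> U \<Longrightarrow> \<eta> i = \<eta>' i"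
  shows "nu_fin E W U \<eta> = nu_fin E W U \<eta>'"
proof -
  have "nu_density E W U \<eta> \<beta> = nu_density E W U \<eta>' \<beta>" for \<beta>
    by (rule nu_density_cong) (simp_all add: assms)
  then show ?thesis by (simp add: nu_fin_def)
qed

text \<open>A sample on \<open>insert k U\<close> is obtained from one on \<open>U\<close>, with the field raised by the conductances to \<open>k\<close>,
  by drawing the Schur complement \<open>y\<close> at \<open>k\<close> from the reciprocal inverse Gaussian law. The estimates
  of the Green function and of \<open>\<psi>\<close> use the finite-volume laws in this form.\<close>

lemma nn_integral_nu_insert:
  assumes U: "finite U" "k \<notin> U" and f [measurable]: "f \<in> borel_measurable (PiL (insert k U))"
  shows "(\<integral>\<^sup>+\<beta>. f \<beta> \<partial>nu_fin E W (insert k U) \<eta>) =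
    (\<integral>\<^sup>+\<beta>. (\<integral>\<^sup>+y. ennreal (rig_density (eff_field U \<beta> \<eta> k) y) * f (\<beta>(k := (y + self_energy U \<beta> k) / 2)) \<partial>lborel)
      \<partial>nu_fin E W U (\<lambda>i. \<eta> i + w i k))"
proof -
  interpret product_sigma_finite "\<lambda>_::'v. lborel :: real measure" by unfold_locales
  let ?e = "\<lambda>i. \<eta> i + w i k"
  note [measurable] = nu_density_measurable[OF U(1)]
  have [measurable]: "(\<lambda>x. eff_field U (fst x) \<eta> k) \<in> borel_measurable (PiL U \<Otimes>\<^sub>M lborel)"
    "(\<lambda>x. self_energy U (fst x) k) \<in> borel_measurable (PiL U \<Otimes>\<^sub>M lborel)"
    by (auto intro!: measurable_eff_field measurable_self_energy U measurable_compose[OF measurable_fst PiL_component])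
  have upd [measurable]: "(\<lambda>x. (fst x)(k := (snd x + self_energy U (fst x) k) / 2)) \<in> PiL U \<Otimes>\<^sub>M lborel \<rightarrow>\<^sub>M PiL (insert k U)"
    by (rule measurable_fun_upd[where J=U]) auto
  have meas: "(\<lambda>\<beta>. \<integral>\<^sup>+y. ennreal (rig_density (eff_field U \<beta> \<eta> k) y) * f (\<beta>(k := (y + self_energy U \<beta> k) / 2)) \<partial>lborel)
      \<in> borel_measurable (PiL U)"
  proof -
    have "(\<lambda>x. ennreal (rig_density (eff_field U (fst x) \<eta> k) (snd x)) * f ((fst x)(k := (snd x + self_energy U (fst x) k) / 2)))
       \<in> borel_measurable (PiL U \<Otimes>\<^sub>M lborel)"
      by measurable
    from lborel.borel_measurable_nn_integral_fst[OF this] show ?thesis by simp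
  qed
  have "(\<integral>\<^sup>+\<beta>. f \<beta> \<partial>nu_fin E W (insert k U) \<eta>)
      = (\<integral>\<^sup>+\<beta>. ennreal (nu_density E W (insert k U) \<eta> \<beta>) * f \<beta> \<partial>PiL (insert k U))"
    unfolding nu_fin_def using U by (intro nn_integral_density) auto
  also have "\<dots> = (\<integral>\<^sup>+\<beta>. (\<integral>\<^sup>+t. ennreal (nu_density E W (insert k U) \<eta> (\<beta>(k := t))) * f (\<beta>(k := t)) \<partial>lborel) \<partial>PiL U)"
    using U by (intro product_nn_integral_insert) auto
  also have "\<dots> = (\<integral>\<^sup>+\<beta>. ennreal (nu_density E W U ?e \<beta>) *
      (\<integral>\<^sup>+y. ennreal (rig_density (eff_field U \<beta> \<eta> k) y) * f (\<beta>(k := (y + self_energy U \<beta> k) / 2)) \<partial>lborel) \<partial>PiL U)"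
  proof (intro nn_integral_cong)
    fix \<beta> assume \<beta>: "\<beta> \<in> space (PiL U)"
    define a c where "a = eff_field U \<beta> \<eta> k" and "c = self_energy U \<beta> k"
    have [measurable]: "(\<lambda>t. \<beta>(k := t)) \<in> borel \<rightarrow>\<^sub>M PiL (insert k U)"
      using measurable_component_update[OF \<beta> U(2)] by simp
    have ac: "eff_field U (\<beta>(k := t)) \<eta> k = a" "self_energy U (\<beta>(k := t)) k = c"
      "nu_density E W U ?e (\<beta>(k := t)) = nu_density E W U ?e \<beta>" for t
    proof -
      have *: "(\<beta>(k := t)) i = \<beta> i" if "i \<in> U" for i using that U by auto
      have "eff_field U (\<beta>(k := t)) = eff_field U \<beta>" by (rule eff_field_cong) (rule *)
      moreover have "self_energy U (\<beta>(k := t)) = self_energy U \<beta>" by (rule self_energy_cong) (rule *)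
      moreover have "nu_density E W U ?e (\<beta>(k := t)) = nu_density E W U ?e \<beta>"
        by (rule nu_density_cong) (rule *, simp_all)
      ultimately show "eff_field U (\<beta>(k := t)) \<eta> k = a" "self_energy U (\<beta>(k := t)) k = c"
        "nu_density E W U ?e (\<beta>(k := t)) = nu_density E W U ?e \<beta>" by (simp_all add: a_def c_def)
    qed
    have nn: "0 \<le> nu_density E W U ?e \<beta>" by (simp add: nu_density_def)
    have "(\<integral>\<^sup>+t. ennreal (nu_density E W (insert k U) \<eta> (\<beta>(k := t))) * f (\<beta>(k := t)) \<partial>lborel)
        = (\<integral>\<^sup>+t. ennreal (nu_density E W U ?e \<beta>) * (ennreal (2 * rig_density a (2 * t - c)) * f (\<beta>(k := t))) \<partial>lborel)"
      by (intro nn_integral_cong) (simp add: nu_density_insert[OF U] ac ennreal_mult'[OF nn] mult.assoc)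
    also have "\<dots> = ennreal (nu_density E W U ?e \<beta>) * (\<integral>\<^sup>+t. ennreal (2 * rig_density a (2 * t - c)) * f (\<beta>(k := t)) \<partial>lborel)"
      by (rule nn_integral_cmult) measurable
    also have "(\<integral>\<^sup>+t. ennreal (2 * rig_density a (2 * t - c)) * f (\<beta>(k := t)) \<partial>lborel)
        = ennreal (1/2) * (\<integral>\<^sup>+y. ennreal (2 * rig_density a (2 * (c / 2 + 1/2 * y) - c)) * f (\<beta>(k := c / 2 + 1/2 * y)) \<partial>lborel)"
      by (subst nn_integral_real_affine[where c="1/2" and t="c/2"]) auto
    also have "\<dots> = (\<integral>\<^sup>+y. ennreal (1/2) * (ennreal (2 * rig_density a (2 * (c / 2 + 1/2 * y) - c)) * f (\<beta>(k := c / 2 + 1/2 * y))) \<partial>lborel)"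
      by (rule nn_integral_cmult[symmetric]) measurable
    also have "\<dots> = (\<integral>\<^sup>+y. ennreal (rig_density a y) * f (\<beta>(k := (y + c) / 2)) \<partial>lborel)"
    proof (intro nn_integral_cong)
      fix y :: real
      have "ennreal (1/2) * ennreal (2 * rig_density a y) = ennreal (rig_density a y)"
        by (subst ennreal_mult'[symmetric]) auto
      moreover have "2 * (c / 2 + 1/2 * y) - c = y" "c / 2 + 1/2 * y = (y + c) / 2" by (simp_all add: field_simps)
      ultimately show "ennreal (1/2) * (ennreal (2 * rig_density a (2 * (c / 2 + 1/2 * y) - c)) * f (\<beta>(k := c / 2 + 1/2 * y)))
          = ennreal (rig_density a y) * f (\<beta>(k := (y + c) / 2))"
        by (simp only: mult.assoc[symmetric])
    qed
    finally show "(\<integral>\<^sup>+t. ennreal (nu_density E W (insert k U) \<eta> (\<beta>(k := t))) * f (\<beta>(k := t)) \<partial>lborel)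
      = ennreal (nu_density E W U ?e \<beta>) *
      (\<integral>\<^sup>+y. ennreal (rig_density (eff_field U \<beta> \<eta> k) y) * f (\<beta>(k := (y + self_energy U \<beta> k) / 2)) \<partial>lborel)"
      by (simp only: a_def c_def)
  qed
  also have "\<dots> = (\<integral>\<^sup>+\<beta>. (\<integral>\<^sup>+y. ennreal (rig_density (eff_field U \<beta> \<eta> k) y) * f (\<beta>(k := (y + self_energy U \<beta> k) / 2)) \<partial>lborel)
      \<partial>nu_fin E W U ?e)"
    unfolding nu_fin_def using meas by (subst nn_integral_density) auto
  finally show ?thesis .
qed

lemma nn_integral_nu_marginal:
  assumes U: "finite U" "k \<notin> U" and \<eta>: "\<And>i. i \<in> insert k U \<Longrightarrow> 0 \<le> \<eta> i"
    and f [measurable]: "f \<in> borel_measurable (PiL U)"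
  shows "(\<integral>\<^sup>+\<beta>. f (restrict \<beta> U) \<partial>nu_fin E W (insert k U) \<eta>) = (\<integral>\<^sup>+\<beta>. f \<beta> \<partial>nu_fin E W U (\<lambda>i. \<eta> i + w i k))"
proof -
  have [measurable]: "(\<lambda>\<beta>. restrict \<beta> U) \<in> PiL (insert k U) \<rightarrow>\<^sub>M PiL U"
    by (rule measurable_restrict_subset) auto
  have "(\<integral>\<^sup>+\<beta>. f (restrict \<beta> U) \<partial>nu_fin E W (insert k U) \<eta>)
    = (\<integral>\<^sup>+\<beta>. (\<integral>\<^sup>+y. ennreal (rig_density (eff_field U \<beta> \<eta> k) y) * f (restrict (\<beta>(k := (y + self_energy U \<beta> k) / 2)) U) \<partial>lborel)
      \<partial>nu_fin E W U (\<lambda>i. \<eta> i + w i k))"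
    by (rule nn_integral_nu_insert[OF U]) measurable
  also have "\<dots> = (\<integral>\<^sup>+\<beta>. f \<beta> \<partial>nu_fin E W U (\<lambda>i. \<eta> i + w i k))"
  proof (intro nn_integral_cong)
    fix \<beta> assume "\<beta> \<in> space (nu_fin E W U (\<lambda>i. \<eta> i + w i k))"
    then have "\<beta> \<in> extensional U" by (auto simp: space_PiM PiE_def)
    then have "restrict (\<beta>(k := t)) U = \<beta>" for t
      using U(2) by (auto simp: restrict_def extensional_def)
    moreover have "0 \<le> eff_field U \<beta> \<eta> k" using U \<eta> by (intro eff_field_nonneg) auto
    ultimately show "(\<integral>\<^sup>+y. ennreal (rig_density (eff_field U \<beta> \<eta> k) y) * f (restrict (\<beta>(k := (y + self_energy U \<beta> k) / 2)) U) \<partial>lborel) = f \<beta>"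
      by (simp add: nn_integral_multc nn_integral_rig_density)
  qed
  finally show ?thesis .
qed

lemma prob_space_nu_fin:
  assumes "finite U" "\<And>i. i \<in> U \<Longrightarrow> 0 \<le> \<eta> i"
  shows "prob_space (nu_fin E W U \<eta>)"
  using assms
proof (induction U arbitrary: \<eta> rule: finite_induct)
  case empty
  show ?case
  proof
    have "nu_density E W {} \<eta> \<beta> = 1" for \<beta>
      by (simp add: nu_density_def pos_def_on_def form_on_def det_on_def)
    then show "emeasure (nu_fin E W {} \<eta>) (space (nu_fin E W {} \<eta>)) = 1"
      by (simp add: nu_fin_def PiM_empty density_1)
  qed
next
  case (insert k U)
  have e: "0 \<le> \<eta> i + w i k" if "i \<in> U" for i using insert.prems that cond_nonneg by simp
  interpret prob_space "nu_fin E W U (\<lambda>i. \<eta> i + w i k)" by (rule insert.IH) (rule e)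
  show ?case
  proof
    have "emeasure (nu_fin E W (insert k U) \<eta>) (space (nu_fin E W (insert k U) \<eta>))
      = (\<integral>\<^sup>+\<beta>. (\<lambda>_. 1) (restrict \<beta> U) \<partial>nu_fin E W (insert k U) \<eta>)" by simp
    also have "\<dots> = (\<integral>\<^sup>+\<beta>. 1 \<partial>nu_fin E W U (\<lambda>i. \<eta> i + w i k))"
      using insert by (intro nn_integral_nu_marginal) auto
    finally show "emeasure (nu_fin E W (insert k U) \<eta>) (space (nu_fin E W (insert k U) \<eta>)) = 1"
      using emeasure_space_1 by simp
  qed
qed

lemma nu_fin_marginal_insert:
  assumes U: "finite U" "k \<notin> U" and \<eta>: "\<And>i. i \<in> insert k U \<Longrightarrow> 0 \<le> \<eta> i"
  shows "distr (nu_fin E W (insert k U) \<eta>) (PiL U) (\<lambda>\<beta>. restrict \<beta> U) = nu_fin E W U (\<lambda>i. \<eta> i + w i k)"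
proof (rule measure_eqI)
  fix A assume "A \<in> sets (distr (nu_fin E W (insert k U) \<eta>) (PiL U) (\<lambda>\<beta>. restrict \<beta> U))"
  then have [measurable]: "A \<in> sets (PiL U)" by simp
  have [measurable]: "(\<lambda>\<beta>. restrict \<beta> U) \<in> nu_fin E W (insert k U) \<eta> \<rightarrow>\<^sub>M PiL U"
    by (subst measurable_cong_sets[OF sets_nu_fin refl], rule measurable_restrict_subset) auto
  have "emeasure (distr (nu_fin E W (insert k U) \<eta>) (PiL U) (\<lambda>\<beta>. restrict \<beta> U)) A
     = (\<integral>\<^sup>+\<beta>. indicator A \<beta> \<partial>distr (nu_fin E W (insert k U) \<eta>) (PiL U) (\<lambda>\<beta>. restrict \<beta> U))"
    by simp
  also have "\<dots> = (\<integral>\<^sup>+\<beta>. indicator A (restrict \<beta> U) \<partial>nu_fin E W (insert k U) \<eta>)"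
    by (rule nn_integral_distr) measurable
  also have "\<dots> = (\<integral>\<^sup>+\<beta>. indicator A \<beta> \<partial>nu_fin E W U (\<lambda>i. \<eta> i + w i k))"
    by (rule nn_integral_nu_marginal[OF U \<eta>]) auto
  finally show "emeasure (distr (nu_fin E W (insert k U) \<eta>) (PiL U) (\<lambda>\<beta>. restrict \<beta> U)) A
      = emeasure (nu_fin E W U (\<lambda>i. \<eta> i + w i k)) A" by simp
qed simp

lemma bw_nonneg: "0 \<le> bw U i"
  unfolding boundary_weight_def by (intro sum_nonneg cond_nonneg)

lemma bw_insert:
  assumes "k \<notin> U"
  shows "bw U i = bw (insert k U) i + w i k"
proof (cases "k \<in> nbrs E i")
  case True
  then have *: "nbrs E i - U = insert k (nbrs E i - insert k U)" using assms by auto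
  have "finite (nbrs E i - insert k U)" using finite_nbrs[of i] by simp
  moreover have "k \<notin> nbrs E i - insert k U" by simp
  ultimately have "sum (w i) (insert k (nbrs E i - insert k U)) = w i k + sum (w i) (nbrs E i - insert k U)"
    by (rule sum.insert)
  then show ?thesis unfolding boundary_weight_def * by linarith
next
  case False
  then have *: "nbrs E i - U = nbrs E i - insert k U" and "w i k = 0" by (auto simp: cond_def nbrs_def)
  then show ?thesis unfolding boundary_weight_def * by linarith
qed

text \<open>The extra field \<open>\<xi>\<close> is kept since a field at one vertex serves to tilt the law below. Its values on the
  vertices that are integrated out disappear, because the conditional density has mass 1 for every
  parameter.\<close>

lemma nu_fin_marginal:
  assumes U: "finite V" "U \<subseteq> V" and \<xi>: "\<And>i. 0 \<le> \<xi> i"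
  shows "distr (nu_fin E W V (\<lambda>i. bw V i + \<xi> i)) (PiL U) (\<lambda>\<beta>. restrict \<beta> U)
    = nu_fin E W U (\<lambda>i. bw U i + \<xi> i)"
proof -
  have "finite D \<Longrightarrow> D \<inter> U = {} \<Longrightarrow>
     distr (nu_fin E W (U \<union> D) (\<lambda>i. bw (U \<union> D) i + \<xi> i)) (PiL U) (\<lambda>\<beta>. restrict \<beta> U)
       = nu_fin E W U (\<lambda>i. bw U i + \<xi> i)" for D
  proof (induction D rule: finite_induct)
    case empty
    have "distr (nu_fin E W U (\<lambda>i. bw U i + \<xi> i)) (PiL U) (\<lambda>\<beta>. restrict \<beta> U)
        = distr (nu_fin E W U (\<lambda>i. bw U i + \<xi> i)) (nu_fin E W U (\<lambda>i. bw U i + \<xi> i)) (\<lambda>\<beta>. \<beta>)"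
      by (rule distr_cong) (auto simp: space_PiM PiE_def extensional_restrict)
    also have "\<dots> = nu_fin E W U (\<lambda>i. bw U i + \<xi> i)" by (rule distr_id2) simp
    finally show ?case by (simp only: Un_empty_right)
  next
    case (insert k D)
    let ?X = "U \<union> D"
    have X: "finite ?X" "k \<notin> ?X" using U insert by (auto intro: finite_subset)
    have "distr (nu_fin E W (insert k ?X) (\<lambda>i. bw (insert k ?X) i + \<xi> i)) (PiL ?X) (\<lambda>\<beta>. restrict \<beta> ?X)
        = nu_fin E W ?X (\<lambda>i. bw (insert k ?X) i + \<xi> i + w i k)"
      using \<xi> bw_nonneg by (intro nu_fin_marginal_insert[OF X]) simp
    also have "\<dots> = nu_fin E W ?X (\<lambda>i. bw ?X i + \<xi> i)"
      using bw_insert[OF X(2)] by (intro nu_fin_cong X) simp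
    finally have step: "distr (nu_fin E W (insert k ?X) (\<lambda>i. bw (insert k ?X) i + \<xi> i)) (PiL ?X) (\<lambda>\<beta>. restrict \<beta> ?X)
        = nu_fin E W ?X (\<lambda>i. bw ?X i + \<xi> i)" .
    have m1: "(\<lambda>\<beta>. restrict \<beta> ?X) \<in> nu_fin E W (insert k ?X) (\<lambda>i. bw (insert k ?X) i + \<xi> i) \<rightarrow>\<^sub>M PiL ?X"
      by (subst measurable_cong_sets[OF sets_nu_fin refl], rule measurable_restrict_subset) auto
    have m2: "(\<lambda>\<beta>. restrict \<beta> U) \<in> PiL ?X \<rightarrow>\<^sub>M PiL U" by (rule measurable_restrict_subset) auto
    have "nu_fin E W U (\<lambda>i. bw U i + \<xi> i)
      = distr (distr (nu_fin E W (insert k ?X) (\<lambda>i. bw (insert k ?X) i + \<xi> i)) (PiL ?X) (\<lambda>\<beta>. restrict \<beta> ?X)) (PiL U) (\<lambda>\<beta>. restrict \<beta> U)"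
      unfolding step by (rule insert.IH[symmetric]) (use insert.prems in auto)
    also have "\<dots> = distr (nu_fin E W (insert k ?X) (\<lambda>i. bw (insert k ?X) i + \<xi> i)) (PiL U) ((\<lambda>\<beta>. restrict \<beta> U) \<circ> (\<lambda>\<beta>. restrict \<beta> ?X))"
      by (rule distr_distr[OF m2 m1])
    also have "(\<lambda>\<beta>. restrict \<beta> U) \<circ> (\<lambda>\<beta>. restrict \<beta> ?X) = (\<lambda>\<beta>::'v \<Rightarrow> real. restrict \<beta> U)"
      by (auto simp: fun_eq_iff)
    finally show ?case unfolding Un_insert_right by (rule sym)
  qed
  note this[of "V - U"]
  moreover have "U \<union> (V - U) = V" using U by blast
  ultimately show ?thesis using U by auto
qed

end

section \<open>The infinite-volume law of the potential\<close>

context weighted_graph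
begin

abbreviation "nuF U \<equiv> nu_fin E W U (bw U)"

lemma nuF_marginal:
  assumes "finite V" "U \<subseteq> V"
  shows "distr (nuF V) (PiL U) (\<lambda>\<beta>. restrict \<beta> U) = nuF U"
  using nu_fin_marginal[OF assms, of "\<lambda>_. 0"] by simp

lemma prob_space_nuF: "finite U \<Longrightarrow> prob_space (nuF U)"
  by (rule prob_space_nu_fin) (auto simp: bw_nonneg)

lemma AE_nu_fin_pos_def: "finite U \<Longrightarrow> AE \<beta> in nu_fin E W U \<eta>. pos_def_on U (H \<beta>)"
proof -
  assume U: "finite U"
  have "(\<lambda>\<beta>. ennreal (nu_density E W U \<eta> \<beta>)) \<in> borel_measurable (PiL U)"
    using nu_density_measurable[OF U] by measurable
  moreover have "pos_def_on U (H \<beta>)" if "0 < ennreal (nu_density E W U \<eta> \<beta>)" for \<beta>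
    using that by (auto simp: nu_density_def split: if_splits)
  ultimately show ?thesis unfolding nu_fin_def by (subst AE_density) (assumption, intro AE_I2 impI)
qed

lemma sets_PiB: "sets (PiL U) = sets (PiM U (\<lambda>_. borel))"
  by (rule sets_PiM_cong) auto

text \<open>The property that \<open>nu T E W\<close> selects.\<close>

definition is_nu :: "'v set \<Rightarrow> ('v \<Rightarrow> real) measure \<Rightarrow> bool" where
  "is_nu T N \<longleftrightarrow> prob_space N \<and>
     sets N = sets (restrict_space (\<Pi>\<^sub>M i\<in>T. borel) (pos_potentials T E W)) \<and>
     (\<forall>U. finite U \<and> U \<subseteq> T \<longrightarrow> distr N (PiL U) (\<lambda>\<beta>. restrict \<beta> U) = nuF U)"

lemma pos_potentials_eq:
  "pos_potentials T E W = {\<beta>\<in>space (PiM T (\<lambda>_. borel)). \<forall>U\<in>{U. finite U \<and> U \<subseteq> T}. pos_def_on U (H \<beta>)}"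
  by (auto simp: pos_potentials_def space_PiM PiE_def)

lemma PiB_component: "i \<in> T \<Longrightarrow> (\<lambda>\<beta>. \<beta> i) \<in> borel_measurable (PiM T (\<lambda>_. borel :: real measure))"
  by measurable

lemma sets_pos_potentials:
  assumes T: "countable T"
  shows "pos_potentials T E W \<in> sets (PiM T (\<lambda>_. borel))"
proof -
  have c: "countable {U. finite U \<and> U \<subseteq> T}" using countable_Collect_finite_subset[OF T] by simp
  let ?C = "{U. finite U \<and> U \<subseteq> T}" and ?B = "PiM T (\<lambda>_. borel :: real measure)"
  have "(\<Inter>U\<in>?C. {\<beta>\<in>space ?B. pos_def_on U (H \<beta>)}) \<in> sets ?B"
  proof (rule sets.countable_INT'[OF c])
    have "{\<beta>\<in>space ?B. pos_def_on U (H \<beta>)} \<in> sets ?B" if "U \<in> ?C" for U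
    proof -
      have "Measurable.pred ?B (\<lambda>\<beta>. pos_def_on U (H \<beta>))"
        using that by (intro measurable_pos_def PiB_component) auto
      then show ?thesis by measurable
    qed
    then show "(\<lambda>U. {\<beta>\<in>space ?B. pos_def_on U (H \<beta>)}) ` ?C \<subseteq> sets ?B" by blast
  qed blast
  also have "(\<Inter>U\<in>?C. {\<beta>\<in>space ?B. pos_def_on U (H \<beta>)}) = pos_potentials T E W"
    unfolding pos_potentials_eq by blast
  finally show ?thesis .
qed

text \<open>Kolmogorov's theorem gives a law on all potentials; it charges only the positive ones, as positivity is
  a countable intersection of conditions that hold almost surely in finite volume.\<close>

lemma is_nu_exists:
  assumes T: "countable T"
  shows "\<exists>N. is_nu T N"
proof -
  have "projective_family T nuF (\<lambda>_. borel)"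
  proof (rule projective_family.intro)
    show "prob_space (nuF J)" if "finite J" "J \<subseteq> T" for J using that by (simp add: prob_space_nuF)
    show "nuF J = distr (nuF H') (PiM J (\<lambda>_. borel)) (\<lambda>f. restrict f J)"
      if "J \<subseteq> H'" "finite H'" "H' \<subseteq> T" for J H'
    proof -
      have "distr (nuF H') (PiM J (\<lambda>_. borel)) (\<lambda>f. restrict f J) = distr (nuF H') (PiL J) (\<lambda>f. restrict f J)"
        by (rule distr_cong) (simp_all add: sets_PiB)
      then show ?thesis using nuF_marginal[OF that(2,1)] by simp
    qed
  qed
  then interpret K: polish_projective T nuF by (rule polish_projective.intro)
  let ?S = "pos_potentials T E W"
  let ?B = "PiM T (\<lambda>_. borel :: real measure)"
  have rest: "(\<lambda>\<beta>. restrict \<beta> U) \<in> K.lim \<rightarrow>\<^sub>M PiL U" if "U \<subseteq> T" for U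
    unfolding measurable_cong_sets[OF K.sets_lim sets_PiB] by (rule measurable_restrict_subset[OF that])
  have marg: "distr K.lim (PiL U) (\<lambda>\<beta>. restrict \<beta> U) = nuF U" if U: "finite U" "U \<subseteq> T" for U
  proof (rule measure_eqI)
    fix A assume "A \<in> sets (distr K.lim (PiL U) (\<lambda>\<beta>. restrict \<beta> U))"
    then have A: "A \<in> sets (PiL U)" by simp
    have "emeasure (distr K.lim (PiL U) (\<lambda>\<beta>. restrict \<beta> U)) A = emeasure K.lim ((\<lambda>\<beta>. restrict \<beta> U) -` A \<inter> space K.lim)"
      using A rest[OF U(2)] by (rule emeasure_distr[rotated])
    also have "(\<lambda>\<beta>. restrict \<beta> U) -` A \<inter> space K.lim = prod_emb T (\<lambda>_. borel) U A"
      by (simp add: prod_emb_def space_PiM)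
    also have "emeasure K.lim \<dots> = emeasure (nuF U) A"
      using A U by (intro K.emeasure_lim_emb) (simp_all add: sets_PiB)
    finally show "emeasure (distr K.lim (PiL U) (\<lambda>\<beta>. restrict \<beta> U)) A = emeasure (nuF U) A" .
  qed simp
  have S: "?S \<in> sets K.lim" using sets_pos_potentials[OF T] by simp
  have c: "countable {U. finite U \<and> U \<subseteq> T}" using countable_Collect_finite_subset[OF T] by simp
  have "AE \<beta> in K.lim. \<forall>U\<in>{U. finite U \<and> U \<subseteq> T}. pos_def_on U (H \<beta>)"
  proof (rule AE_ball_countable'[OF _ c])
    fix U assume "U \<in> {U. finite U \<and> U \<subseteq> T}"
    then have U: "finite U" "U \<subseteq> T" by auto
    have "AE \<beta> in distr K.lim (PiL U) (\<lambda>\<beta>. restrict \<beta> U). pos_def_on U (H \<beta>)"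
      unfolding marg[OF U] by (rule AE_nu_fin_pos_def[OF U(1)])
    moreover have "{\<beta> \<in> space (PiL U). pos_def_on U (H \<beta>)} \<in> sets (PiL U)"
      using measurable_pos_def[OF U(1), of "\<lambda>x. x" "PiL U"] PiL_component by measurable
    ultimately have "AE \<beta> in K.lim. pos_def_on U (H (restrict \<beta> U))"
      using rest[OF U(2)] by (simp add: AE_distr_iff)
    moreover have "pos_def_on U (H (restrict \<beta> U)) = pos_def_on U (H \<beta>)" for \<beta>
      by (rule pos_def_cong) simp
    ultimately show "AE \<beta> in K.lim. pos_def_on U (H \<beta>)" by simp
  qed
  then have AES: "AE \<beta> in K.lim. \<beta> \<in> ?S"
    by (rule AE_mp) (auto simp: pos_potentials_eq intro!: AE_I2)
  then have S1: "emeasure K.lim ?S = 1"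
  proof -
    have "emeasure K.lim ?S = emeasure K.lim (space K.lim)"
      using S AES by (intro emeasure_eq_AE) auto
    then show ?thesis using K.P.emeasure_space_1 by simp
  qed
  let ?N = "restrict_space K.lim ?S"
  have "is_nu T ?N" unfolding is_nu_def
  proof (intro conjI allI impI)
    show "prob_space ?N" by (rule prob_space_restrict_space[OF S S1])
    show "sets ?N = sets (restrict_space ?B ?S)" by (rule sets_restrict_space_cong) simp
    fix U assume "finite U \<and> U \<subseteq> T"
    then have U: "finite U" "U \<subseteq> T" by auto
    show "distr ?N (PiL U) (\<lambda>\<beta>. restrict \<beta> U) = nuF U"
    proof (rule measure_eqI)
      fix A assume "A \<in> sets (distr ?N (PiL U) (\<lambda>\<beta>. restrict \<beta> U))"
      then have A: "A \<in> sets (PiL U)" by simp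
      let ?f = "\<lambda>\<beta>. restrict \<beta> U :: 'v \<Rightarrow> real"
      have fA: "?f -` A \<inter> space K.lim \<in> sets K.lim" using rest[OF U(2)] A by measurable
      have spS: "?S \<subseteq> space K.lim" using S by (rule sets.sets_into_space)
      have "emeasure (distr ?N (PiL U) ?f) A = emeasure ?N (?f -` A \<inter> space ?N)"
        using A by (intro emeasure_distr measurable_restrict_space1 rest U)
      also have "\<dots> = emeasure K.lim (?f -` A \<inter> space ?N)"
        using S by (intro emeasure_restrict_space) (auto simp: space_restrict_space)
      also have "?f -` A \<inter> space ?N = (?f -` A \<inter> space K.lim) \<inter> ?S"
        using spS by (auto simp: space_restrict_space)
      also have "emeasure K.lim \<dots> = emeasure K.lim (?f -` A \<inter> space K.lim)"
        using fA S AES by (intro emeasure_eq_AE) auto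
      also have "\<dots> = emeasure (distr K.lim (PiL U) ?f) A"
        by (rule emeasure_distr[OF rest[OF U(2)] A, symmetric])
      finally show "emeasure (distr ?N (PiL U) ?f) A = emeasure (nuF U) A"
        by (simp only: marg[OF U])
    qed simp
  qed
  then show ?thesis ..
qed

lemma is_nu_unique:
  assumes T: "countable T" and N1: "is_nu T N1" and N2: "is_nu T N2"
  shows "N1 = N2"
proof -
  let ?B = "PiM T (\<lambda>_. borel :: real measure)"
  let ?S = "pos_potentials T E W"
  have S: "?S \<in> sets ?B" by (rule sets_pos_potentials[OF T])
  have sp: "space N = ?S" and setsN: "sets N = sets (restrict_space ?B ?S)" if "is_nu T N" for N
  proof -
    show e: "sets N = sets (restrict_space ?B ?S)" using that by (simp add: is_nu_def)
    have "space N = space (restrict_space ?B ?S)" by (rule sets_eq_imp_space_eq[OF e])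
    then show "space N = ?S" using sets.sets_into_space[OF S] by (auto simp: space_restrict_space)
  qed
  have id: "(\<lambda>\<beta>. \<beta>) \<in> N \<rightarrow>\<^sub>M ?B" if "is_nu T N" for N
    unfolding measurable_cong_sets[OF setsN[OF that] refl] by (rule measurable_restrict_space1) simp
  have eq: "distr N1 ?B (\<lambda>\<beta>. \<beta>) = distr N2 ?B (\<lambda>\<beta>. \<beta>)"
  proof (rule measure_eqI_PiM_infinite[where I=T and M="\<lambda>_. borel"])
    show "finite_measure (distr N1 ?B (\<lambda>\<beta>. \<beta>))"
    proof -
      have "prob_space N1" using N1 by (simp add: is_nu_def)
      then have "prob_space (distr N1 ?B (\<lambda>\<beta>. \<beta>))" by (rule prob_space.prob_space_distr[OF _ id[OF N1]])
      then show ?thesis by (rule prob_space.finite_measure)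
    qed
    fix A and J assume J: "finite J" "J \<subseteq> T" and A: "\<And>i. i \<in> J \<Longrightarrow> A i \<in> sets (borel :: real measure)"
    have "emeasure (distr N ?B (\<lambda>\<beta>. \<beta>)) (prod_emb T (\<lambda>_. borel) J (Pi\<^sub>E J A)) = emeasure (nuF J) (Pi\<^sub>E J A)"
      if N: "is_nu T N" for N
    proof -
      have PA: "Pi\<^sub>E J A \<in> sets (PiL J)" using J A by (intro sets_PiM_I_finite) auto
      have r: "(\<lambda>\<beta>. restrict \<beta> J) \<in> N \<rightarrow>\<^sub>M PiL J"
        using measurable_compose[OF id[OF N] measurable_restrict_subset[OF J(2)]]
        by (simp add: measurable_cong_sets[OF refl sets_PiB])
      have "emeasure (distr N ?B (\<lambda>\<beta>. \<beta>)) (prod_emb T (\<lambda>_. borel) J (Pi\<^sub>E J A))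
          = emeasure N ((\<lambda>\<beta>. \<beta>) -` prod_emb T (\<lambda>_. borel) J (Pi\<^sub>E J A) \<inter> space N)"
        using J A by (intro emeasure_distr id N sets_PiM_I) auto
      also have "(\<lambda>\<beta>. \<beta>) -` prod_emb T (\<lambda>_. borel) J (Pi\<^sub>E J A) \<inter> space N = (\<lambda>\<beta>. restrict \<beta> J) -` Pi\<^sub>E J A \<inter> space N"
        using sets.sets_into_space[OF S] by (auto simp: prod_emb_def sp[OF N] space_PiM)
      also have "emeasure N \<dots> = emeasure (distr N (PiL J) (\<lambda>\<beta>. restrict \<beta> J)) (Pi\<^sub>E J A)"
        by (rule emeasure_distr[OF r PA, symmetric])
      also have "\<dots> = emeasure (nuF J) (Pi\<^sub>E J A)" using N J by (simp add: is_nu_def)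
      finally show ?thesis .
    qed
    then show "emeasure (distr N1 ?B (\<lambda>\<beta>. \<beta>)) (prod_emb T (\<lambda>_. borel) J (Pi\<^sub>E J A)) =
       emeasure (distr N2 ?B (\<lambda>\<beta>. \<beta>)) (prod_emb T (\<lambda>_. borel) J (Pi\<^sub>E J A))" using N1 N2 by simp
  qed simp_all
  show ?thesis
  proof (rule measure_eqI)
    show "sets N1 = sets N2" using setsN N1 N2 by simp
    fix C assume "C \<in> sets N1"
    then obtain A where A: "A \<in> sets ?B" "C = ?S \<inter> A"
      using setsN[OF N1] by (auto simp: sets_restrict_space)
    have "emeasure N C = emeasure (distr N ?B (\<lambda>\<beta>. \<beta>)) A" if "is_nu T N" for N
      using emeasure_distr[OF id[OF that] A(1)] A(2) sp[OF that] by (simp add: Int_commute)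
    then show "emeasure N1 C = emeasure N2 C" using eq N1 N2 by simp
  qed
qed

lemma is_nu_nu:
  assumes "countable T"
  shows "is_nu T (nu T E W)"
proof -
  obtain N where N: "is_nu T N" using is_nu_exists[OF assms] ..
  have "nu T E W = (THE N. is_nu T N)" by (simp add: nu_def is_nu_def)
  also have "\<dots> = N" using N is_nu_unique[OF assms] by blast
  finally show ?thesis using N by simp
qed

lemma
  assumes T: "countable T"
  shows prob_space_nu: "prob_space (nu T E W)"
    and space_nu: "space (nu T E W) = pos_potentials T E W"
    and nu_component: "\<And>i. i \<in> T \<Longrightarrow> (\<lambda>\<beta>. \<beta> i) \<in> borel_measurable (nu T E W)"
    and nu_restrict: "\<And>U. U \<subseteq> T \<Longrightarrow> (\<lambda>\<beta>. restrict \<beta> U) \<in> nu T E W \<rightarrow>\<^sub>M PiL U"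
    and nu_marginal: "\<And>U. finite U \<Longrightarrow> U \<subseteq> T \<Longrightarrow> distr (nu T E W) (PiL U) (\<lambda>\<beta>. restrict \<beta> U) = nuF U"
proof -
  let ?B = "PiM T (\<lambda>_. borel :: real measure)"
  let ?S = "pos_potentials T E W"
  let ?N = "nu T E W"
  note N = is_nu_nu[OF T, unfolded is_nu_def]
  show "prob_space ?N" using N by blast
  have s: "sets ?N = sets (restrict_space ?B ?S)" using N by blast
  show "space ?N = ?S"
    using sets_eq_imp_space_eq[OF s] sets.sets_into_space[OF sets_pos_potentials[OF T]]
    by (auto simp: space_restrict_space)
  show "distr ?N (PiL U) (\<lambda>\<beta>. restrict \<beta> U) = nuF U" if "finite U" "U \<subseteq> T" for U
    using N that by blast
  show "(\<lambda>\<beta>. \<beta> i) \<in> borel_measurable ?N" if "i \<in> T" for i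
    unfolding measurable_cong_sets[OF s refl]
    by (rule measurable_restrict_space1) (rule PiB_component[OF that])
  show "(\<lambda>\<beta>. restrict \<beta> U) \<in> ?N \<rightarrow>\<^sub>M PiL U" if "U \<subseteq> T" for U
    unfolding measurable_cong_sets[OF s sets_PiB]
    by (rule measurable_restrict_space1) (rule measurable_restrict_subset[OF that])
qed

lemma nn_integral_nu:
  assumes T: "countable T" and U: "finite U" "U \<subseteq> T" and f: "f \<in> borel_measurable (PiL U)"
  shows "(\<integral>\<^sup>+\<beta>. f (restrict \<beta> U) \<partial>nu T E W) = (\<integral>\<^sup>+\<beta>. f \<beta> \<partial>nuF U)"
  unfolding nu_marginal[OF T U, symmetric]
  by (rule nn_integral_distr[OF nu_restrict[OF T U(2)], symmetric]) (simp add: f)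

end

section \<open>Convergence of bounded martingales\<close>

text \<open>The increments are orthogonal, so the second moments \<open>Q n\<close> increase to a finite limit \<open>L\<close>. Splitting
  according to the first time at which the oscillation after \<open>m\<close> reaches \<open>e\<close> gives a maximal inequality with
  the bound \<open>(L - Q m) / e\<^sup>2\<close>, which tends to 0; hence almost every path is a Cauchy sequence.\<close>

lemma bounded_martingale_converges:
  fixes M :: "nat \<Rightarrow> 'a \<Rightarrow> real"
  assumes N: "prob_space N" and sub: "\<And>n. subalgebra N (F n)"
    and mono: "\<And>k n. k \<le> n \<Longrightarrow> sets (F k) \<subseteq> sets (F n)"
    and M: "\<And>n. M n \<in> borel_measurable (F n)" and bnd: "\<And>n x. 0 \<le> M n x" "\<And>n x. M n x \<le> 1"
    and mart: "\<And>k n A. k \<le> n \<Longrightarrow> A \<in> sets (F k) \<Longrightarrow> (\<integral>x\<in>A. M n x \<partial>N) = (\<integral>x\<in>A. M k x \<partial>N)"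
  shows "AE x in N. convergent (\<lambda>n. M n x)"
proof -
  interpret prob_space N by (rule N)
  have MF: "f \<in> borel_measurable N" if "f \<in> borel_measurable (F n)" for f :: "'a \<Rightarrow> real" and n
    using measurable_from_subalg[OF sub that] .
  have MFn: "M k \<in> borel_measurable (F n)" if "k \<le> n" for k n
    using M[of k] mono[OF that] sub unfolding subalgebra_def by (auto simp: measurable_def)
  have MN [measurable]: "M n \<in> borel_measurable N" for n by (rule MF[OF M])
  have int: "integrable N f" if "f \<in> borel_measurable N" "\<And>x. \<bar>f x\<bar> \<le> c" for f :: "'a \<Rightarrow> real" and c
    using that by (intro integrable_const_bound[of _ c]) auto
  have orth: "(\<integral>x. f x * M n x \<partial>N) = (\<integral>x. f x * M k x \<partial>N)"
    if kn: "k \<le> n" and f: "f \<in> borel_measurable (F k)" "\<And>x. \<bar>f x\<bar> \<le> c" for f k n c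
  proof -
    interpret sigma_finite_subalgebra N "F k"
      by (rule finite_measure_subalgebra_is_sigma_finite) (unfold_locales, rule sub)
    have iM: "integrable N (M n)" for n using bnd by (intro int[of _ 1]) auto
    have "AE x in N. real_cond_exp N (F k) (M n) x = M k x"
      by (rule real_cond_exp_charact) (use mart[OF kn] iM M in auto)
    moreover have "(\<integral>x. f x * M n x \<partial>N) = (\<integral>x. f x * real_cond_exp N (F k) (M n) x \<partial>N)"
    proof (rule real_cond_exp_intg(2)[symmetric])
      have "\<bar>f x * M n x\<bar> \<le> c" for x
      proof -
        have "\<bar>f x * M n x\<bar> = \<bar>f x\<bar> * M n x" using bnd by (simp add: abs_mult)
        also have "\<dots> \<le> \<bar>f x\<bar> * 1" using bnd by (intro mult_left_mono) auto
        finally show ?thesis using f(2)[of x] by simp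
      qed
      then show "integrable N (\<lambda>x. f x * M n x)" using MF[OF f(1)] by (intro int[of _ c]) auto
    qed (use f in auto)
    ultimately show ?thesis
      using MF[OF f(1)] by (subst integral_cong_AE[of "\<lambda>x. f x * M k x" N "\<lambda>x. f x * real_cond_exp N (F k) (M n) x"]) auto
  qed
  define Q where "Q n = (\<integral>x. (M n x)\<^sup>2 \<partial>N)" for n
  have Mb: "\<bar>M n x\<bar> \<le> 1" for n x using bnd[of n x] by auto
  have diffb: "\<bar>M n x - M k x\<bar> \<le> 1" for n k x using bnd[of n x] bnd[of k x] by auto
  have sqb: "\<bar>(M n x - M k x)\<^sup>2\<bar> \<le> 1" for n k x
    using diffb[of n x k] abs_square_le_1[of "M n x - M k x"] by auto
  have prodb: "\<bar>M n x * M k x\<bar> \<le> 1" for n k x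
    using Mb[of n x] Mb[of k x] by (simp add: abs_mult mult_le_one)
  have i2: "integrable N (\<lambda>x. M n x * M k x)" for n k
    using prodb by (intro int[of _ 1]) auto
  have sq: "(\<integral>x. (M n x - M m x)\<^sup>2 \<partial>N) = Q n - Q m" if "m \<le> n" for m n
  proof -
    have "(\<integral>x. (M n x - M m x)\<^sup>2 \<partial>N) = (\<integral>x. M n x * M n x - 2 * (M m x * M n x) + M m x * M m x \<partial>N)"
      by (intro Bochner_Integration.integral_cong refl) (simp add: power2_eq_square algebra_simps)
    also have "\<dots> = (\<integral>x. M n x * M n x \<partial>N) - 2 * (\<integral>x. M m x * M n x \<partial>N) + (\<integral>x. M m x * M m x \<partial>N)"
      using i2 by (subst Bochner_Integration.integral_add, auto)
    also have "(\<integral>x. M m x * M n x \<partial>N) = (\<integral>x. M m x * M m x \<partial>N)"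
      by (rule orth[OF that M Mb])
    finally show ?thesis by (simp add: Q_def power2_eq_square)
  qed
  have "incseq Q"
  proof (rule incseq_SucI)
    fix n
    have "0 \<le> (\<integral>x. (M (Suc n) x - M n x)\<^sup>2 \<partial>N)" by simp
    then show "Q n \<le> Q (Suc n)" using sq[of n "Suc n"] by simp
  qed
  moreover have Qb: "Q n \<le> 1" for n
  proof -
    have "Q n \<le> (\<integral>x. 1 \<partial>N)" unfolding Q_def
      using i2[of n n] Mb by (intro integral_mono) (auto simp: power2_eq_square abs_square_le_1[unfolded power2_eq_square])
    then show ?thesis by (simp add: prob_space)
  qed
  ultimately obtain L where L: "Q \<longlonglongrightarrow> L" "\<And>n. Q n \<le> L"
    using incseq_convergent[of Q 1] by blast
  define B where "B e m n = {x\<in>space N. \<exists>k\<in>{m..n}. e \<le> \<bar>M k x - M m x\<bar>}" for e m n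
  have Bm [measurable]: "B e m n \<in> sets N" for e m n unfolding B_def by measurable
  have maximal: "prob (B e m n) \<le> (L - Q m) / e\<^sup>2" if e: "0 < e" for e m n
  proof (cases "m \<le> n")
    case False
    then have "B e m n = {}" by (auto simp: B_def)
    then show ?thesis using L(2)[of m] by simp
  next
    case True
    \<comment> \<open>The first time of an oscillation of size at least \<open>e\<close> is \<open>k\<close>.\<close>
    define A where "A k = {x\<in>space N. e \<le> \<bar>M k x - M m x\<bar> \<and> (\<forall>j\<in>{m..<k}. \<bar>M j x - M m x\<bar> < e)}" for k
    have AF: "A k \<in> sets (F k)" if "m \<le> k" for k
    proof -
      have sp: "space N = space (F k)" using sub by (simp add: subalgebra_def)
      have [measurable]: "M j \<in> borel_measurable (F k)" if "j \<in> insert k {m..<k}" for j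
        using that \<open>m \<le> k\<close> by (intro MFn) auto
      have [measurable]: "M m \<in> borel_measurable (F k)" "M k \<in> borel_measurable (F k)"
        using \<open>m \<le> k\<close> by (auto intro: MFn)
      have "Measurable.pred (F k) (\<lambda>x. \<forall>j\<in>{m..<k}. \<bar>M j x - M m x\<bar> < e)"
        by (rule pred_intros_finite(3)) auto
      then show ?thesis unfolding A_def sp by measurable
    qed
    then have AN [measurable]: "A k \<in> sets N" if "m \<le> k" for k
      using that sub unfolding subalgebra_def by blast
    have disj: "disjoint_family_on A {m..n}"
      unfolding disjoint_family_on_def
    proof (intro ballI impI)
      fix k l assume kl: "k \<in> {m..n}" "l \<in> {m..n}" "k \<noteq> l"
      have *: "A k \<inter> A l = {}" if "m \<le> k" "k < l" for k l
      proof (rule ccontr)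
        assume "A k \<inter> A l \<noteq> {}"
        then obtain x where x: "x \<in> A k" "x \<in> A l" by blast
        from x(2) have "\<bar>M k x - M m x\<bar> < e" using that by (simp add: A_def)
        with x(1) show False by (simp add: A_def)
      qed
      show "A k \<inter> A l = {}"
        using kl *[of k l] *[of l k] by (cases "k < l") (auto simp: Int_commute)
    qed
    have BA: "B e m n = (\<Union>k\<in>{m..n}. A k)"
    proof
      show "B e m n \<subseteq> (\<Union>k\<in>{m..n}. A k)"
      proof
        fix x assume x: "x \<in> B e m n"
        let ?P = "\<lambda>k. k \<in> {m..n} \<and> e \<le> \<bar>M k x - M m x\<bar>"
        obtain k where k: "?P k" using x by (auto simp: B_def)
        have "?P (LEAST k. ?P k)" using k by (rule LeastI)
        moreover have "\<not> ?P j" if "j < (LEAST k. ?P k)" for j using that by (rule not_less_Least)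
        ultimately have "x \<in> A (LEAST k. ?P k)" using x by (force simp: A_def B_def not_le)
        then show "x \<in> (\<Union>k\<in>{m..n}. A k)" using \<open>?P (LEAST k. ?P k)\<close> by blast
      qed
    qed (auto simp: A_def B_def)
    have step: "e\<^sup>2 * prob (A k) \<le> (\<integral>x. indicator (A k) x * (M n x - M m x)\<^sup>2 \<partial>N)"
      if k: "k \<in> {m..n}" for k
    proof -
      have mk: "m \<le> k" "k \<le> n" using k by auto
      have Ak [measurable]: "A k \<in> sets N" by (rule AN[OF mk(1)])
      have ib: "integrable N (\<lambda>x. indicator (A k) x * g x)" if "g \<in> borel_measurable N" "\<And>x. \<bar>g x\<bar> \<le> 1" for g :: "'a \<Rightarrow> real"
        using that by (intro int[of _ 1]) (auto split: split_indicator)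
      let ?h = "\<lambda>x. indicator (A k) x * (M k x - M m x)"
      have hF: "?h \<in> borel_measurable (F k)"
        using AF[OF mk(1)] MFn[OF mk(1)] M[of k] by measurable
      have hb: "\<bar>?h x\<bar> \<le> 1" for x using diffb[of k x m] by (auto split: split_indicator)
      have ih: "integrable N (\<lambda>x. ?h x * M j x)" for j
      proof (rule int[of _ 1])
        show "\<bar>?h x * M j x\<bar> \<le> 1" for x
          using mult_le_one[OF hb abs_ge_zero Mb] by (simp only: abs_mult)
      qed (use MF[OF hF] in measurable)
      \<comment> \<open>Adding this vanishing term completes the square of \<open>M n x - M m x\<close>.\<close>
      have cross: "(\<integral>x. ?h x * (M n x - M k x) \<partial>N) = 0"
        using orth[OF mk(2) hF hb] ih by (simp add: right_diff_distrib)
      have "e\<^sup>2 * prob (A k) = (\<integral>x. e\<^sup>2 * indicator (A k) x \<partial>N)"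
        using Ak by simp
      also have "\<dots> \<le> (\<integral>x. indicator (A k) x * (M k x - M m x)\<^sup>2 \<partial>N)"
      proof (rule integral_mono)
        show "integrable N (\<lambda>x. e\<^sup>2 * indicator (A k) x)" by (intro int[of _ "e\<^sup>2"]) (auto split: split_indicator)
        show "integrable N (\<lambda>x. indicator (A k) x * (M k x - M m x)\<^sup>2)" using sqb by (intro ib) auto
        show "e\<^sup>2 * indicator (A k) x \<le> indicator (A k) x * (M k x - M m x)\<^sup>2" for x
        proof (cases "x \<in> A k")
          case True
          then have "e \<le> \<bar>M k x - M m x\<bar>" by (simp add: A_def)
          then have "e\<^sup>2 \<le> \<bar>M k x - M m x\<bar>\<^sup>2" using e by (intro power_mono) auto
          then show ?thesis using True by simp
        qed simp
      qed
      also have "\<dots> \<le> (\<integral>x. indicator (A k) x * (M k x - M m x)\<^sup>2 \<partial>N) + (\<integral>x. indicator (A k) x * (M n x - M k x)\<^sup>2 \<partial>N)"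
        by simp
      also have "\<dots> = (\<integral>x. indicator (A k) x * (M k x - M m x)\<^sup>2 + indicator (A k) x * (M n x - M k x)\<^sup>2 \<partial>N)
          + 2 * (\<integral>x. ?h x * (M n x - M k x) \<partial>N)"
        using sqb cross by (subst Bochner_Integration.integral_add) (auto intro!: ib)
      also have "\<dots> = (\<integral>x. (indicator (A k) x * (M k x - M m x)\<^sup>2 + indicator (A k) x * (M n x - M k x)\<^sup>2)
          + 2 * (?h x * (M n x - M k x)) \<partial>N)"
      proof -
        have "integrable N (\<lambda>x. ?h x * (M n x - M k x))" using ih by (simp add: right_diff_distrib)
        moreover have "integrable N (\<lambda>x. indicator (A k) x * (M k x - M m x)\<^sup>2 + indicator (A k) x * (M n x - M k x)\<^sup>2)"
          using sqb by (intro Bochner_Integration.integrable_add ib) auto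
        ultimately show ?thesis by (subst Bochner_Integration.integral_add) auto
      qed
      also have "\<dots> = (\<integral>x. indicator (A k) x * (M n x - M m x)\<^sup>2 \<partial>N)"
        by (intro Bochner_Integration.integral_cong refl) (simp add: power2_eq_square algebra_simps)
      finally show ?thesis .
    qed
    have "e\<^sup>2 * prob (B e m n) = (\<Sum>k\<in>{m..n}. e\<^sup>2 * prob (A k))"
      unfolding BA using disj AN by (subst finite_measure_finite_Union) (auto simp: sum_distrib_left)
    also have "\<dots> \<le> (\<Sum>k\<in>{m..n}. (\<integral>x. indicator (A k) x * (M n x - M m x)\<^sup>2 \<partial>N))"
      by (intro sum_mono step)
    also have "\<dots> = (\<integral>x. (\<Sum>k\<in>{m..n}. indicator (A k) x * (M n x - M m x)\<^sup>2) \<partial>N)"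
    proof (rule Bochner_Integration.integral_sum[symmetric])
      fix k assume "k \<in> {m..n}"
      then have [measurable]: "A k \<in> sets N" by (intro AN) auto
      show "integrable N (\<lambda>x. indicator (A k) x * (M n x - M m x)\<^sup>2)"
        using sqb[of n _ m] by (intro int[of _ 1]) (auto split: split_indicator)
    qed
    also have "\<dots> \<le> (\<integral>x. (M n x - M m x)\<^sup>2 \<partial>N)"
    proof (rule integral_mono')
      show "integrable N (\<lambda>x. (M n x - M m x)\<^sup>2)" using sqb by (intro int[of _ 1]) auto
      show "(\<Sum>k\<in>{m..n}. indicator (A k) x * (M n x - M m x)\<^sup>2) \<le> (M n x - M m x)\<^sup>2" for x
      proof -
        have "(\<Sum>k\<in>{m..n}. indicator (A k) x) = (indicator (\<Union>k\<in>{m..n}. A k) x :: real)"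
          using disj by (intro indicator_UN_disjoint[symmetric]) auto
        then have "(\<Sum>k\<in>{m..n}. indicator (A k) x) \<le> (1 :: real)" by (simp add: indicator_le_1)
        then have "(\<Sum>k\<in>{m..n}. indicator (A k) x) * (M n x - M m x)\<^sup>2 \<le> 1 * (M n x - M m x)\<^sup>2"
          by (intro mult_right_mono) auto
        then show ?thesis by (simp add: sum_distrib_right)
      qed
    qed simp
    also have "\<dots> \<le> L - Q m" using sq[OF True] L(2)[of n] by simp
    finally show ?thesis using e by (simp add: field_simps)
  qed
  have AEc: "AE x in N. \<exists>m. \<forall>k\<ge>m. \<bar>M k x - M m x\<bar> < e" if e: "0 < e" for e
  proof -
    let ?C = "{x\<in>space N. \<forall>m. \<exists>k\<ge>m. e \<le> \<bar>M k x - M m x\<bar>}"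
    have C [measurable]: "?C \<in> sets N" by measurable
    have "prob ?C \<le> (L - Q m) / e\<^sup>2" for m
    proof -
      have "(\<lambda>n. prob (B e m n)) \<longlonglongrightarrow> prob (\<Union>n. B e m n)"
        by (intro finite_Lim_measure_incseq) (auto simp: incseq_def B_def)
      then have "prob (\<Union>n. B e m n) \<le> (L - Q m) / e\<^sup>2"
        by (rule LIMSEQ_le_const2) (auto intro: maximal[OF e])
      moreover have "?C \<subseteq> (\<Union>n. B e m n)"
      proof
        fix x assume x: "x \<in> ?C"
        then obtain k where "m \<le> k" "e \<le> \<bar>M k x - M m x\<bar>" by blast
        then have "x \<in> B e m k" using x by (auto simp: B_def)
        then show "x \<in> (\<Union>n. B e m n)" by blast
      qed
      then have "prob ?C \<le> prob (\<Union>n. B e m n)" by (intro finite_measure_mono) auto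
      ultimately show ?thesis by simp
    qed
    moreover have "(\<lambda>m. (L - Q m) / e\<^sup>2) \<longlonglongrightarrow> (L - L) / e\<^sup>2"
      using e by (intro tendsto_intros L) auto
    ultimately have "prob ?C \<le> 0" by (intro LIMSEQ_le_const[of _ "(L - L) / e\<^sup>2", simplified]) auto
    then have "prob ?C = 0" using measure_nonneg[of N ?C] by linarith
    then have "AE x in N. x \<notin> ?C" using C by (simp add: prob_eq_0)
    then show ?thesis
    proof (rule AE_mp, intro AE_I2 impI)
      fix x assume "x \<in> space N" "x \<notin> ?C"
      then obtain m where "\<not> (\<exists>k\<ge>m. e \<le> \<bar>M k x - M m x\<bar>)" by blast
      then show "\<exists>m. \<forall>k\<ge>m. \<bar>M k x - M m x\<bar> < e" by (metis not_le)
    qed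
  qed
  have "AE x in N. \<forall>j::nat. \<exists>m. \<forall>k\<ge>m. \<bar>M k x - M m x\<bar> < 1 / Suc j"
    by (subst AE_all_countable) (intro allI AEc, simp)
  then show ?thesis
  proof eventually_elim
    case (elim x)
    have "Cauchy (\<lambda>n. M n x)"
    proof (rule metric_CauchyI)
      fix e :: real assume "0 < e"
      then have "0 < e / 2" by simp
      then obtain j where j: "1 / Suc j < e / 2" using nat_approx_posE by blast
      obtain m where m: "\<forall>k\<ge>m. \<bar>M k x - M m x\<bar> < 1 / Suc j" using elim by blast
      have "dist (M k x) (M l x) < e" if "m \<le> k" "m \<le> l" for k l
        using m[rule_format, OF that(1)] m[rule_format, OF that(2)] j by (simp add: dist_real_def)
      then show "\<exists>M'. \<forall>k\<ge>M'. \<forall>l\<ge>M'. dist (M k x) (M l x) < e" by blast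
    qed
    then show ?case by (rule Cauchy_convergent)
  qed
qed

text \<open>The form of Fatou's lemma by which bounds in finite volume pass to the limit.\<close>

lemma (in prob_space) prob_eventually_le:
  fixes B :: "nat \<Rightarrow> 'a set"
  assumes B: "\<And>n. B n \<in> sets M" and le: "\<And>n. n0 \<le> n \<Longrightarrow> prob (B n) \<le> c"
  shows "prob {x\<in>space M. \<exists>m. \<forall>n\<ge>m. x \<in> B n} \<le> c"
proof -
  let ?D = "\<lambda>m. {x\<in>space M. \<forall>n\<ge>m. x \<in> B n}"
  note [measurable] = B
  have D: "?D m \<in> sets M" for m
  proof -
    have "{m..} \<noteq> {}" by (metis atLeast_iff empty_iff order_refl)
    then have "(\<Inter>n\<in>{m..}. B n) \<in> sets M" using B by (intro sets.countable_INT' countableI_type) auto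
    also have "(\<Inter>n\<in>{m..}. B n) = ?D m" using sets.sets_into_space[OF B] by auto
    finally show ?thesis .
  qed
  have "(\<lambda>m. prob (?D m)) \<longlonglongrightarrow> prob (\<Union>m. ?D m)"
    using D by (intro finite_Lim_measure_incseq) (auto simp: incseq_def)
  moreover have "\<exists>N. \<forall>m\<ge>N. prob (?D m) \<le> c"
  proof (intro exI allI impI)
    fix m assume "n0 \<le> m"
    have "prob (?D m) \<le> prob (B m)" using B by (intro finite_measure_mono) auto
    then show "prob (?D m) \<le> c" using le[OF \<open>n0 \<le> m\<close>] by simp
  qed
  ultimately have "prob (\<Union>m. ?D m) \<le> c" by (rule LIMSEQ_le_const2)
  also have "(\<Union>m. ?D m) = {x\<in>space M. \<exists>m. \<forall>n\<ge>m. x \<in> B n}" by auto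
  finally show ?thesis .
qed

section \<open>The finite-volume Green function and its tilting\<close>

context weighted_graph
begin

lemma green_mono_aux:
  assumes "finite D" "finite U" "D \<inter> U = {}" "pos_def_on (U \<union> D) (H \<beta>)"
  shows "green U \<beta> i j \<le> green (U \<union> D) \<beta> i j"
  using assms
proof (induction D rule: finite_induct)
  case (insert k D)
  let ?X = "U \<union> D"
  have X: "finite ?X" "k \<notin> ?X" using insert by auto
  have P: "pos_def_on (insert k ?X) (H \<beta>)" using insert.prems by simp
  then have P': "pos_def_on ?X (H \<beta>)" "0 < 2 * \<beta> k - self_energy ?X \<beta> k" using pos_def_insert[OF X] by auto
  have "green U \<beta> i j \<le> green ?X \<beta> i j" using insert P' by auto
  also have "\<dots> \<le> green (insert k ?X) \<beta> i j"
    unfolding green_insert[OF X P] using P'(2) harm_ext_nonneg[OF X(1)] by simp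
  finally show ?case by simp
qed simp

lemma green_mono:
  assumes V: "finite V" "U \<subseteq> V" and P: "pos_def_on V (H \<beta>)"
  shows "green U \<beta> i j \<le> green V \<beta> i j"
proof -
  have "U \<union> (V - U) = V" "finite U" using V finite_subset by auto
  then show ?thesis using green_mono_aux[of "V - U" U \<beta> i j] V P by auto
qed

text \<open>The form \<open>H \<beta>\<close> at the difference of the columns \<open>i\<close> and \<open>j\<close> of the Green function is
  \<open>G i i + G j j - 2 G i j\<close>.\<close>

lemma green_AM:
  assumes "finite U"
  shows "green U \<beta> i j \<le> (green U \<beta> i i + green U \<beta> j j) / 2"
proof (cases "pos_def_on U (H \<beta>) \<and> i \<in> U \<and> j \<in> U \<and> i \<noteq> j")
  case False
  then consider "\<not> pos_def_on U (H \<beta>)" | "i \<notin> U \<or> j \<notin> U" | "i = j" by blast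
  then show ?thesis
  proof cases
    case 2
    then have "green U \<beta> i j = 0" using green_outside[OF assms] by blast
    then show ?thesis using green_nonneg[OF assms] by simp
  qed (simp_all add: green_def)
next
  case True
  then have ij: "i \<in> U" "j \<in> U" "i \<noteq> j" and P: "pos_def_on U (H \<beta>)" by auto
  let ?G = "green U \<beta>"
  define f where "f k = ?G k i - ?G k j" for k
  have HG: "(\<Sum>l\<in>U. H \<beta> k l * ?G l m) = (if k = m then 1 else 0)" if "k \<in> U" "m \<in> U" for k m
    using green_inverse_pair[OF assms P] that by (simp add: inverse_pair_def)
  have "0 \<le> form_on U (H \<beta>) f"
  proof (cases "\<exists>k\<in>U. f k \<noteq> 0")
    case True then show ?thesis using P unfolding pos_def_on_def by (meson less_imp_le)
  qed (simp add: form_on_def)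
  also have "form_on U (H \<beta>) f = (\<Sum>k\<in>U. f k * (\<Sum>l\<in>U. H \<beta> k l * f l))"
    by (simp add: form_on_def sum_distrib_left mult.assoc)
  also have "\<dots> = (\<Sum>k\<in>U. f k * ((if k = i then 1 else 0) - (if k = j then 1 else 0)))"
    by (intro sum.cong refl) (simp add: f_def right_diff_distrib sum_subtractf HG ij)
  also have "\<dots> = (\<Sum>k\<in>U. (if k = i then f k else 0) - (if k = j then f k else 0))"
    by (intro sum.cong refl) auto
  also have "\<dots> = f i - f j"
    using ij assms by (simp add: sum_subtractf)
  also have "\<dots> = ?G i i + ?G j j - 2 * ?G i j"
    using green_sym[OF assms, of \<beta> j i] by (simp add: f_def)
  finally show ?thesis by simp
qed

text \<open>With \<open>\<eta>\<close> the boundary weight this is \<open>psi_n\<close> on \<open>U\<close>. The general field is needed because the branch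
  recursion combines the Green function of a set with the boundary weight of a larger one.\<close>

definition psi_fin :: "'v set \<Rightarrow> ('v \<Rightarrow> real) \<Rightarrow> ('v \<Rightarrow> real) \<Rightarrow> 'v \<Rightarrow> real" where
  "psi_fin U \<eta> \<beta> i = (\<Sum>k\<in>U. green U \<beta> i k * \<eta> k)"

lemma psi_fin_nonneg: "finite U \<Longrightarrow> (\<And>k. k \<in> U \<Longrightarrow> 0 \<le> \<eta> k) \<Longrightarrow> 0 \<le> psi_fin U \<eta> \<beta> i"
  unfolding psi_fin_def by (intro sum_nonneg mult_nonneg_nonneg green_nonneg) auto

lemma psi_fin_cong: "(\<And>i. i \<in> U \<Longrightarrow> \<beta> i = \<beta>' i) \<Longrightarrow> psi_fin U \<eta> \<beta> = psi_fin U \<eta> \<beta>'"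
proof -
  assume *: "\<And>i. i \<in> U \<Longrightarrow> \<beta> i = \<beta>' i"
  have "green U \<beta> = green U \<beta>'" by (rule green_cong) (rule *)
  then show ?thesis by (simp add: psi_fin_def[abs_def])
qed

lemma Ghat_n_eq: "pos_def_on U (H \<beta>) \<Longrightarrow> Ghat_n E W U \<beta> i j = green U \<beta> i j"
  by (simp add: Ghat_n_def green_def)

lemma H_op_eq:
  assumes "finite U" "i \<in> U" "\<And>j. j \<notin> U \<Longrightarrow> f j = 1"
  shows "H_op E W \<beta> f i = (\<Sum>j\<in>U. H \<beta> i j * f j) - bw U i"
proof -
  have "(\<Sum>j\<in>nbrs E i. w i j * f j) = (\<Sum>j\<in>nbrs E i \<inter> U. w i j * f j) + (\<Sum>j\<in>nbrs E i - U. w i j * f j)"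
    using finite_nbrs[of i] by (simp add: sum.Int_Diff[symmetric])
  also have "(\<Sum>j\<in>nbrs E i - U. w i j * f j) = bw U i"
    unfolding boundary_weight_def using assms(3) by (intro sum.cong) auto
  also have "(\<Sum>j\<in>nbrs E i \<inter> U. w i j * f j) = (\<Sum>j\<in>U. w i j * f j)"
    using assms(1) by (intro sum.mono_neutral_left) (auto simp: cond_def nbrs_def)
  finally have 1: "(\<Sum>j\<in>nbrs E i. w i j * f j) = (\<Sum>j\<in>U. w i j * f j) + bw U i" .
  have "(\<Sum>j\<in>U. H \<beta> i j * f j) = (\<Sum>j\<in>U. (if i = j then 2 * \<beta> i * f j else 0) - w i j * f j)"
    by (intro sum.cong refl) (simp add: H_mat_def left_diff_distrib)
  also have "\<dots> = 2 * \<beta> i * f i - (\<Sum>j\<in>U. w i j * f j)"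
    using assms(1,2) by (simp add: sum_subtractf)
  finally show ?thesis using 1 by (simp add: H_op_def)
qed

lemma psi_n_eq:
  assumes U: "finite U" and P: "pos_def_on U (H \<beta>)"
  shows "psi_n E W U \<beta> i = (if i \<in> U then psi_fin U (bw U) \<beta> i else 1)"
proof -
  let ?p = "\<lambda>i. if i \<in> U then psi_fin U (bw U) \<beta> i else 1"
  note inv = green_inverse_pair[OF U P]
  have "psi_n E W U \<beta> = ?p" unfolding psi_n_def
  proof (rule the_equality)
    have "(\<Sum>j\<in>U. H \<beta> i j * ?p j) = bw U i" if i: "i \<in> U" for i
    proof -
      have "(\<Sum>j\<in>U. H \<beta> i j * ?p j) = (\<Sum>j\<in>U. \<Sum>k\<in>U. H \<beta> i j * green U \<beta> j k * bw U k)"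
        by (intro sum.cong refl) (simp add: psi_fin_def sum_distrib_left mult.assoc)
      also have "\<dots> = (\<Sum>k\<in>U. (\<Sum>j\<in>U. H \<beta> i j * green U \<beta> j k) * bw U k)"
        by (subst sum.swap) (simp add: sum_distrib_right)
      also have "\<dots> = (\<Sum>k\<in>U. (if i = k then 1 else 0) * bw U k)"
        using inv i by (intro sum.cong refl) (auto simp: inverse_pair_def)
      also have "\<dots> = bw U i" using i U by (simp add: if_distrib if_distribR cong: if_cong)
      finally show ?thesis .
    qed
    then show "(\<forall>i\<in>U. H_op E W \<beta> ?p i = 0) \<and> (\<forall>i. i \<notin> U \<longrightarrow> ?p i = 1)"
      using H_op_eq[OF U, of _ ?p \<beta>] by auto
    fix f assume f: "(\<forall>i\<in>U. H_op E W \<beta> f i = 0) \<and> (\<forall>i. i \<notin> U \<longrightarrow> f i = 1)"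
    then have Hf: "(\<Sum>j\<in>U. H \<beta> i j * f j) = bw U i" if "i \<in> U" for i
      using H_op_eq[OF U that, of f \<beta>] that by auto
    show "f = ?p"
    proof
      fix i
      show "f i = ?p i"
      proof (cases "i \<in> U")
        case True
        have "psi_fin U (bw U) \<beta> i = (\<Sum>k\<in>U. \<Sum>j\<in>U. green U \<beta> i k * H \<beta> k j * f j)"
          unfolding psi_fin_def by (intro sum.cong refl) (simp add: Hf[symmetric] sum_distrib_left mult.assoc)
        also have "\<dots> = (\<Sum>j\<in>U. (\<Sum>k\<in>U. green U \<beta> i k * H \<beta> k j) * f j)"
          by (subst sum.swap) (simp add: sum_distrib_right)
        also have "\<dots> = (\<Sum>j\<in>U. (if i = j then 1 else 0) * f j)"
          using inv True by (intro sum.cong refl) (auto simp: inverse_pair_def)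
        also have "\<dots> = f i" using True U by (simp add: if_distrib if_distribR cong: if_cong)
        finally show ?thesis using True by simp
      qed (use f in simp)
    qed
  qed
  then show ?thesis by simp
qed

subsection \<open>Exponential tilting\<close>

definition tilt :: "real \<Rightarrow> 'v \<Rightarrow> 'v \<Rightarrow> real" where
  "tilt \<theta> x i = (if i = x then \<theta> else 0)"

definition tilt_mart :: "real \<Rightarrow> 'v set \<Rightarrow> 'v \<Rightarrow> ('v \<Rightarrow> real) \<Rightarrow> real" where
  "tilt_mart \<theta> U x \<beta> = exp (- \<theta> * psi_fin U (bw U) \<beta> x - \<theta>\<^sup>2 / 2 * green U \<beta> x x)"

text \<open>Raising the field at \<open>x\<close> by \<open>\<theta>\<close> adds \<open>2 \<theta> \<psi>(x) + \<theta>\<^sup>2 G(x, x)\<close> to \<open>\<langle>\<eta>, G \<eta>\<rangle>\<close> and \<open>\<theta>\<close> to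
  \<open>\<langle>\<eta>, 1\<rangle>\<close>.\<close>

lemma nu_density_tilt:
  assumes U: "finite U" and x: "x \<in> U"
  shows "nu_density E W U (\<lambda>i. bw U i + tilt \<theta> x i) \<beta> = exp \<theta> * (nu_density E W U (bw U) \<beta> * tilt_mart \<theta> U x \<beta>)"
proof (cases "pos_def_on U (H \<beta>)")
  case True
  let ?G = "green U \<beta>"
  have G: "inverse_on U (H \<beta>) = ?G" using True by (simp add: green_def[abs_def])
  have ts: "(\<Sum>j\<in>U. c j * tilt \<theta> x j) = c x * \<theta>" for c
    using U x by (simp add: tilt_def if_distrib cong: if_cong)
  have "form_on U ?G (\<lambda>i. bw U i + tilt \<theta> x i) = (\<Sum>i\<in>U. \<Sum>j\<in>U. bw U i * ?G i j * bw U j + bw U i * ?G i j * tilt \<theta> x j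
      + (?G i j * bw U j) * tilt \<theta> x i + ?G i j * tilt \<theta> x j * tilt \<theta> x i)"
    unfolding form_on_def by (intro sum.cong refl) (simp add: algebra_simps)
  also have "\<dots> = form_on U ?G (bw U) + (\<Sum>i\<in>U. \<Sum>j\<in>U. (bw U i * ?G i j) * tilt \<theta> x j)
      + (\<Sum>i\<in>U. (\<Sum>j\<in>U. ?G i j * bw U j) * tilt \<theta> x i) + (\<Sum>i\<in>U. (\<Sum>j\<in>U. ?G i j * tilt \<theta> x j) * tilt \<theta> x i)"
    by (simp only: sum.distrib form_on_def sum_distrib_right mult.assoc)
  also have "\<dots> = form_on U ?G (bw U) + (\<Sum>i\<in>U. bw U i * ?G i x * \<theta>) + psi_fin U (bw U) \<beta> x * \<theta> + ?G x x * \<theta> * \<theta>"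
    by (simp only: ts psi_fin_def)
  also have "(\<Sum>i\<in>U. bw U i * ?G i x * \<theta>) = psi_fin U (bw U) \<beta> x * \<theta>"
    unfolding psi_fin_def sum_distrib_right
    by (intro sum.cong refl) (simp add: green_sym[OF U, of \<beta> x] mult.commute)
  finally have form: "form_on U ?G (\<lambda>i. bw U i + tilt \<theta> x i)
      = form_on U ?G (bw U) + 2 * \<theta> * psi_fin U (bw U) \<beta> x + \<theta>\<^sup>2 * ?G x x"
    by (simp add: power2_eq_square algebra_simps)
  have sum: "(\<Sum>i\<in>U. bw U i + tilt \<theta> x i) = (\<Sum>i\<in>U. bw U i) + \<theta>"
    using ts[of "\<lambda>_. 1"] by (simp add: sum.distrib)
  have expo: "- 1/2 * (form_on U (H \<beta>) (\<lambda>_. 1) + (form_on U ?G (bw U) + 2 * \<theta> * psi_fin U (bw U) \<beta> x + \<theta>\<^sup>2 * ?G x x))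
      + ((\<Sum>i\<in>U. bw U i) + \<theta>)
    = \<theta> + ((- 1/2 * (form_on U (H \<beta>) (\<lambda>_. 1) + form_on U ?G (bw U)) + (\<Sum>i\<in>U. bw U i))
       + (- \<theta> * psi_fin U (bw U) \<beta> x - \<theta>\<^sup>2 / 2 * ?G x x))"
    by (simp add: field_simps)
  show ?thesis using True
    unfolding nu_density_def G form sum tilt_mart_def expo exp_add[of \<theta>]
      exp_add[of _ "- \<theta> * psi_fin U (bw U) \<beta> x - \<theta>\<^sup>2 / 2 * ?G x x"]
    by (simp add: ac_simps)
qed (simp add: nu_density_def)

lemma measurable_psi_fin:
  assumes "finite U" "\<And>i. i \<in> U \<Longrightarrow> (\<lambda>x. b x i) \<in> borel_measurable M"
  shows "(\<lambda>x. psi_fin U \<eta> (b x) i) \<in> borel_measurable M"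
  unfolding psi_fin_def using measurable_finite_green[of U b M] assms by (intro borel_measurable_sum borel_measurable_times) auto

lemma measurable_tilt_mart:
  assumes "finite U" "\<And>i. i \<in> U \<Longrightarrow> (\<lambda>x. b x i) \<in> borel_measurable M"
  shows "(\<lambda>x. tilt_mart \<theta> U y (b x)) \<in> borel_measurable M"
proof -
  have [measurable]: "(\<lambda>x. psi_fin U (bw U) (b x) y) \<in> borel_measurable M" "(\<lambda>x. green U (b x) y y) \<in> borel_measurable M"
    using measurable_psi_fin[of U b M] measurable_finite_green[of U b M] assms by auto
  show ?thesis unfolding tilt_mart_def by measurable
qed

lemma tilt_mart_cong: "(\<And>i. i \<in> U \<Longrightarrow> \<beta> i = \<beta>' i) \<Longrightarrow> tilt_mart \<theta> U x \<beta> = tilt_mart \<theta> U x \<beta>'"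
proof -
  assume *: "\<And>i. i \<in> U \<Longrightarrow> \<beta> i = \<beta>' i"
  have "green U \<beta> = green U \<beta>'" by (rule green_cong) (rule *)
  moreover have "psi_fin U (bw U) \<beta> = psi_fin U (bw U) \<beta>'" by (rule psi_fin_cong) (rule *)
  ultimately show ?thesis by (simp add: tilt_mart_def)
qed

lemma nn_integral_nuF_tilt_mart:
  assumes U: "finite U" and x: "x \<in> U" and f: "f \<in> borel_measurable (PiL U)"
  shows "(\<integral>\<^sup>+\<beta>. f \<beta> \<partial>nu_fin E W U (\<lambda>i. bw U i + tilt \<theta> x i))
    = ennreal (exp \<theta>) * (\<integral>\<^sup>+\<beta>. f \<beta> * ennreal (tilt_mart \<theta> U x \<beta>) \<partial>nuF U)"
proof -
  note [measurable] = nu_density_measurable[OF U] f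
  have [measurable]: "(\<lambda>\<beta>. tilt_mart \<theta> U x \<beta>) \<in> borel_measurable (PiL U)"
    by (rule measurable_tilt_mart[OF U]) (rule PiL_component)
  have nn: "0 \<le> nu_density E W U (bw U) \<beta>" "0 \<le> tilt_mart \<theta> U x \<beta>" for \<beta>
    by (simp_all add: nu_density_def tilt_mart_def)
  have "(\<integral>\<^sup>+\<beta>. f \<beta> \<partial>nu_fin E W U (\<lambda>i. bw U i + tilt \<theta> x i))
     = (\<integral>\<^sup>+\<beta>. ennreal (nu_density E W U (\<lambda>i. bw U i + tilt \<theta> x i) \<beta>) * f \<beta> \<partial>PiL U)"
    unfolding nu_fin_def by (intro nn_integral_density) auto
  also have "\<dots> = (\<integral>\<^sup>+\<beta>. ennreal (exp \<theta>) * (ennreal (nu_density E W U (bw U) \<beta>) * (f \<beta> * ennreal (tilt_mart \<theta> U x \<beta>))) \<partial>PiL U)"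
    unfolding nu_density_tilt[OF U x] using nn by (intro nn_integral_cong) (simp add: ennreal_mult ac_simps)
  also have "\<dots> = ennreal (exp \<theta>) * (\<integral>\<^sup>+\<beta>. ennreal (nu_density E W U (bw U) \<beta>) * (f \<beta> * ennreal (tilt_mart \<theta> U x \<beta>)) \<partial>PiL U)"
    by (rule nn_integral_cmult) measurable
  also have "(\<integral>\<^sup>+\<beta>. ennreal (nu_density E W U (bw U) \<beta>) * (f \<beta> * ennreal (tilt_mart \<theta> U x \<beta>)) \<partial>PiL U)
      = (\<integral>\<^sup>+\<beta>. f \<beta> * ennreal (tilt_mart \<theta> U x \<beta>) \<partial>nuF U)"
    unfolding nu_fin_def by (subst nn_integral_density) auto
  finally show ?thesis .
qed

text \<open>Both sides are \<open>exp (- \<theta>)\<close> times the integral of \<open>f\<close> against the tilted law on \<open>U\<close>, by consistency of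
  the tilted laws.\<close>

lemma tilt_mart_martingale:
  assumes T: "countable T" and V: "finite V" "V \<subseteq> T" and U: "U \<subseteq> V" "x \<in> U" and l: "0 \<le> \<theta>"
    and f: "f \<in> borel_measurable (PiL U)"
  shows "(\<integral>\<^sup>+\<beta>. f (restrict \<beta> U) * ennreal (tilt_mart \<theta> V x \<beta>) \<partial>nu T E W)
    = (\<integral>\<^sup>+\<beta>. f (restrict \<beta> U) * ennreal (tilt_mart \<theta> U x \<beta>) \<partial>nu T E W)"
proof -
  have U': "finite U" using U V finite_subset by blast
  have base: "ennreal (exp \<theta>) * (\<integral>\<^sup>+\<beta>. f (restrict \<beta> U) * ennreal (tilt_mart \<theta> X x \<beta>) \<partial>nu T E W)
      = (\<integral>\<^sup>+\<beta>. f \<beta> \<partial>nu_fin E W U (\<lambda>i. bw U i + tilt \<theta> x i))"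
    if X: "X = V \<or> X = U" for X
  proof -
    have X': "finite X" "X \<subseteq> T" "U \<subseteq> X" "x \<in> X" using X U V U' by auto
    have r: "(\<lambda>\<beta>. restrict \<beta> U) \<in> PiL X \<rightarrow>\<^sub>M PiL U" by (rule measurable_restrict_subset[OF X'(3)])
    have fr: "(\<lambda>\<beta>. f (restrict \<beta> U)) \<in> borel_measurable (PiL X)" by (rule measurable_compose[OF r f])
    have m: "(\<lambda>\<beta>. tilt_mart \<theta> X x \<beta>) \<in> borel_measurable (PiL X)"
      by (rule measurable_tilt_mart[OF X'(1)]) (rule PiL_component)
    have g: "(\<lambda>\<beta>. f (restrict \<beta> U) * ennreal (tilt_mart \<theta> X x \<beta>)) \<in> borel_measurable (PiL X)"
      using fr m by measurable
    have "(\<integral>\<^sup>+\<beta>. f (restrict \<beta> U) * ennreal (tilt_mart \<theta> X x \<beta>) \<partial>nu T E W)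
      = (\<integral>\<^sup>+\<beta>. f (restrict (restrict \<beta> X) U) * ennreal (tilt_mart \<theta> X x (restrict \<beta> X)) \<partial>nu T E W)"
    proof (intro nn_integral_cong)
      fix \<beta> :: "'v \<Rightarrow> real"
      have "restrict (restrict \<beta> X) U = restrict \<beta> U" using X'(3) by (simp add: Int_absorb1)
      moreover have "tilt_mart \<theta> X x (restrict \<beta> X) = tilt_mart \<theta> X x \<beta>" by (rule tilt_mart_cong) simp
      ultimately show "f (restrict \<beta> U) * ennreal (tilt_mart \<theta> X x \<beta>)
          = f (restrict (restrict \<beta> X) U) * ennreal (tilt_mart \<theta> X x (restrict \<beta> X))" by (simp only:)
    qed
    also have "\<dots> = (\<integral>\<^sup>+\<beta>. f (restrict \<beta> U) * ennreal (tilt_mart \<theta> X x \<beta>) \<partial>nuF X)"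
      by (rule nn_integral_nu[OF T X'(1,2) g])
    also have "ennreal (exp \<theta>) * \<dots> = (\<integral>\<^sup>+\<beta>. f (restrict \<beta> U) \<partial>nu_fin E W X (\<lambda>i. bw X i + tilt \<theta> x i))"
      by (rule nn_integral_nuF_tilt_mart[OF X'(1,4) fr, symmetric])
    also have "\<dots> = (\<integral>\<^sup>+\<beta>. f \<beta> \<partial>distr (nu_fin E W X (\<lambda>i. bw X i + tilt \<theta> x i)) (PiL U) (\<lambda>\<beta>. restrict \<beta> U))"
    proof (rule nn_integral_distr[symmetric])
      show "(\<lambda>\<beta>. restrict \<beta> U) \<in> nu_fin E W X (\<lambda>i. bw X i + tilt \<theta> x i) \<rightarrow>\<^sub>M PiL U"
        unfolding measurable_cong_sets[OF sets_nu_fin refl] by (rule r)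
    qed (simp add: f)
    also have "\<dots> = (\<integral>\<^sup>+\<beta>. f \<beta> \<partial>nu_fin E W U (\<lambda>i. bw U i + tilt \<theta> x i))"
      using l by (subst nu_fin_marginal[OF X'(1,3)]) (simp_all add: tilt_def)
    finally show ?thesis .
  qed
  have "ennreal (exp \<theta>) * (\<integral>\<^sup>+\<beta>. f (restrict \<beta> U) * ennreal (tilt_mart \<theta> V x \<beta>) \<partial>nu T E W)
     = ennreal (exp \<theta>) * (\<integral>\<^sup>+\<beta>. f (restrict \<beta> U) * ennreal (tilt_mart \<theta> U x \<beta>) \<partial>nu T E W)"
    using base[of V] base[of U] by simp
  then show ?thesis by (simp add: ennreal_mult_cancel_left)
qed

lemma tilt_mart_integral:
  assumes T: "countable T" and U: "finite U" "U \<subseteq> T" "x \<in> U" and l: "0 \<le> \<theta>"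
  shows "(\<integral>\<^sup>+\<beta>. ennreal (tilt_mart \<theta> U x \<beta>) \<partial>nu T E W) = ennreal (exp (- \<theta>))"
proof -
  interpret prob_space "nu_fin E W U (\<lambda>i. bw U i + tilt \<theta> x i)"
    using l bw_nonneg U by (intro prob_space_nu_fin) (auto simp: tilt_def)
  have m: "(\<lambda>\<beta>. ennreal (tilt_mart \<theta> U x \<beta>)) \<in> borel_measurable (PiL U)"
    using measurable_tilt_mart[OF U(1), of "\<lambda>\<beta>. \<beta>" "PiL U"] PiL_component by measurable
  have "tilt_mart \<theta> U x (restrict \<beta> U) = tilt_mart \<theta> U x \<beta>" for \<beta> by (rule tilt_mart_cong) simp
  then have "(\<integral>\<^sup>+\<beta>. ennreal (tilt_mart \<theta> U x \<beta>) \<partial>nu T E W) = (\<integral>\<^sup>+\<beta>. ennreal (tilt_mart \<theta> U x \<beta>) \<partial>nuF U)"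
    using nn_integral_nu[OF T U(1,2) m] by simp
  moreover have "ennreal (exp \<theta>) * (\<integral>\<^sup>+\<beta>. ennreal (tilt_mart \<theta> U x \<beta>) \<partial>nuF U) = 1"
    using nn_integral_nuF_tilt_mart[OF U(1,3), of "\<lambda>_. 1" \<theta>] emeasure_space_1 by simp
  moreover have "ennreal (exp \<theta>) * ennreal (exp (- \<theta>)) = 1"
    by (simp add: ennreal_mult'[symmetric] exp_minus_inverse)
  ultimately have "ennreal (exp \<theta>) * (\<integral>\<^sup>+\<beta>. ennreal (tilt_mart \<theta> U x \<beta>) \<partial>nu T E W) = ennreal (exp \<theta>) * ennreal (exp (- \<theta>))"
    by simp
  then show ?thesis by (simp add: ennreal_mult_cancel_left)
qed

end

section \<open>Almost sure limits along an exhaustion\<close>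

text \<open>On the event that \<open>X n\<close> tends to infinity, \<open>K \<le> X n\<close> holds eventually for every \<open>K\<close>; hence this
  event has probability at most \<open>c K\<close> for every \<open>K > 0\<close>.\<close>

lemma (in prob_space) AE_not_at_top:
  fixes X :: "nat \<Rightarrow> 'a \<Rightarrow> real"
  assumes X [measurable]: "\<And>n. X n \<in> borel_measurable M"
    and le: "\<And>n K. n0 \<le> n \<Longrightarrow> 0 < K \<Longrightarrow> prob {x\<in>space M. K \<le> X n x} \<le> c K"
    and c: "(c \<longlongrightarrow> 0) at_top"
  shows "AE x in M. \<not> filterlim (\<lambda>n. X n x) at_top sequentially"
proof -
  let ?E = "\<lambda>K. {x\<in>space M. \<exists>m. \<forall>n\<ge>m. x \<in> {x\<in>space M. K \<le> X n x}}"
  have E: "?E K \<in> sets M" for K by measurable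
  have pE: "prob (?E K) \<le> c K" if "0 < K" for K
    using le[OF _ that] by (intro prob_eventually_le[of _ n0]) auto
  let ?C = "\<Inter>k::nat. ?E (real (Suc k))"
  have C: "?C \<in> sets M" using E by (intro sets.countable_INT) auto
  have "prob ?C \<le> c (real (Suc k))" for k
  proof -
    have "prob ?C \<le> prob (?E (real (Suc k)))" using E by (intro finite_measure_mono) auto
    then show ?thesis using pE[of "real (Suc k)"] by simp
  qed
  moreover have "(\<lambda>k. c (real (Suc k))) \<longlonglongrightarrow> 0"
    by (rule filterlim_compose[OF c]) (rule filterlim_compose[OF filterlim_real_sequentially filterlim_Suc])
  ultimately have "prob ?C \<le> 0" by (intro LIMSEQ_le_const[of _ 0]) auto
  then have "prob ?C = 0" using measure_nonneg[of M ?C] by linarith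
  then have "AE x in M. x \<notin> ?C" using C prob_eq_0 by blast
  then show ?thesis
  proof (rule AE_mp, intro AE_I2 impI notI)
    fix x assume x: "x \<in> space M" "x \<notin> ?C" and lim: "filterlim (\<lambda>n. X n x) at_top sequentially"
    have "x \<in> ?E K" for K
    proof -
      have "eventually (\<lambda>n. K \<le> X n x) sequentially" using lim by (simp add: filterlim_at_top)
      then show ?thesis using x(1) by (auto simp: eventually_sequentially)
    qed
    then show False using x(2) by blast
  qed
qed

context weighted_graph
begin

lemma tilt_mart_pos: "0 < tilt_mart \<theta> U x \<beta>"
  by (simp add: tilt_mart_def)

text \<open>The potential at \<open>k\<close> is chosen such that the Schur complement at \<open>k\<close> equals \<open>y\<close>.\<close>

lemma green_insert_update:
  assumes U: "finite U" "k \<notin> U" and P: "pos_def_on U (H \<beta>)" and y: "0 < y"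
  shows "green (insert k U) (\<beta>(k := (y + self_energy U \<beta> k) / 2)) i j = green U \<beta> i j + harm_ext U \<beta> k i * harm_ext U \<beta> k j / y"
proof -
  let ?b = "\<beta>(k := (y + self_energy U \<beta> k) / 2)"
  have *: "?b i = \<beta> i" if "i \<in> U" for i using that U(2) by auto
  have e: "green U ?b = green U \<beta>" "harm_ext U ?b = harm_ext U \<beta>" "self_energy U ?b = self_energy U \<beta>" "pos_def_on U (H ?b) = pos_def_on U (H \<beta>)"
    by (rule green_cong harm_ext_cong self_energy_cong pos_def_cong, rule *, assumption)+
  have yy: "2 * ?b k - self_energy U ?b k = y" unfolding e(3) by (simp add: field_simps)
  then have "pos_def_on (insert k U) (H ?b)" using pos_def_insert[OF U] e P y by simp
  from green_insert[OF U this, of i j] show ?thesis unfolding yy e(1,2) .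
qed

lemma nuF_insert:
  assumes "k \<notin> U" "finite U"
  shows "nu_fin E W U (\<lambda>i. bw (insert k U) i + w i k) = nuF U"
  using bw_insert[OF assms(1)] assms(2) by (intro nu_fin_cong) auto

text \<open>The diagonal entry at \<open>x\<close> is the reciprocal of the Schur complement at \<open>x\<close>, whose law has little mass near 0
  whatever its parameter is.\<close>

lemma green_tight:
  assumes U: "finite U" "x \<in> U" and K: "0 < K"
  shows "emeasure (nuF U) {\<beta>\<in>space (nuF U). K \<le> green U \<beta> x x} \<le> ennreal (sqrt (1 / K))"
proof -
  define U' where "U' = U - {x}"
  have U': "finite U'" "x \<notin> U'" "U = insert x U'" using U by (auto simp: U'_def)
  interpret prob_space "nuF U'" by (rule prob_space_nuF[OF U'(1)])
  have m: "(\<lambda>\<beta>. green U \<beta> x x) \<in> borel_measurable (PiL U)"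
    by (rule measurable_finite_green[OF U(1)]) (rule PiL_component)
  let ?A = "{\<beta>\<in>space (PiL U). K \<le> green U \<beta> x x}"
  have A: "?A \<in> sets (PiL U)" using m by measurable
  have "emeasure (nuF U) {\<beta>\<in>space (nuF U). K \<le> green U \<beta> x x} = (\<integral>\<^sup>+\<beta>. indicator ?A \<beta> \<partial>nuF U)"
    using A by simp
  also have "\<dots> = (\<integral>\<^sup>+\<beta>. (\<integral>\<^sup>+y. ennreal (rig_density (eff_field U' \<beta> (bw U) x) y) * indicator ?A (\<beta>(x := (y + self_energy U' \<beta> x) / 2)) \<partial>lborel)
      \<partial>nuF U')"
    using nn_integral_nu_insert[OF U'(1,2), of "indicator ?A" "bw U"] A
    unfolding U'(3)[symmetric] nuF_insert[OF U'(2,1), unfolded U'(3)[symmetric]] by simp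
  also have "\<dots> \<le> (\<integral>\<^sup>+\<beta>. ennreal (sqrt (1 / K)) \<partial>nuF U')"
  proof (rule nn_integral_mono_AE)
    show "AE \<beta> in nuF U'. (\<integral>\<^sup>+y. ennreal (rig_density (eff_field U' \<beta> (bw U) x) y) * indicator ?A (\<beta>(x := (y + self_energy U' \<beta> x) / 2)) \<partial>lborel)
        \<le> ennreal (sqrt (1 / K))"
      using AE_nu_fin_pos_def[OF U'(1)]
    proof eventually_elim
      case (elim \<beta>)
      have *: "indicator ?A (\<beta>(x := (y + self_energy U' \<beta> x) / 2)) \<le> (indicator {..1/K} y :: ennreal)" for y
      proof (cases "0 < y")
        case True
        have G: "green U (\<beta>(x := (y + self_energy U' \<beta> x) / 2)) x x = 1 / y"
          using green_insert_update[OF U'(1,2) elim True, of x x] U'(2)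
          unfolding U'(3)[symmetric] by (simp add: green_outside[OF U'(1)])
        have "y \<le> 1 / K" if "K \<le> 1 / y" using that True K by (simp add: field_simps)
        then show ?thesis using G by (auto split: split_indicator)
      qed (use K in \<open>auto split: split_indicator simp: not_less intro: order_trans[of _ 0]\<close>)
      have "(\<integral>\<^sup>+y. ennreal (rig_density (eff_field U' \<beta> (bw U) x) y) * indicator ?A (\<beta>(x := (y + self_energy U' \<beta> x) / 2)) \<partial>lborel)
          \<le> (\<integral>\<^sup>+y. ennreal (rig_density (eff_field U' \<beta> (bw U) x) y) * indicator {..1/K} y \<partial>lborel)"
        by (intro nn_integral_mono mult_left_mono *) simp
      also have "\<dots> \<le> ennreal (sqrt (1 / K))" using K by (intro nn_integral_rig_density_small) simp
      finally show ?case .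
    qed
  qed
  also have "\<dots> = ennreal (sqrt (1 / K))" using emeasure_space_1 by simp
  finally show ?thesis .
qed

lemma prob_nu_eq:
  assumes T: "countable T" and U: "finite U" "U \<subseteq> T" and m: "{\<beta>\<in>space (PiL U). Q \<beta>} \<in> sets (PiL U)"
    and c: "\<And>\<beta>. Q (restrict \<beta> U) = Q \<beta>"
  shows "emeasure (nu T E W) {\<beta>\<in>space (nu T E W). Q \<beta>} = emeasure (nuF U) {\<beta>\<in>space (nuF U). Q \<beta>}"
proof -
  let ?A = "{\<beta>\<in>space (PiL U). Q \<beta>}"
  note r = nu_restrict[OF T U(2)]
  have "emeasure (nuF U) ?A = emeasure (distr (nu T E W) (PiL U) (\<lambda>\<beta>. restrict \<beta> U)) ?A"
    by (simp only: nu_marginal[OF T U])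
  also have "\<dots> = emeasure (nu T E W) ((\<lambda>\<beta>. restrict \<beta> U) -` ?A \<inter> space (nu T E W))"
    by (rule emeasure_distr[OF r m])
  also have "(\<lambda>\<beta>. restrict \<beta> U) -` ?A \<inter> space (nu T E W) = {\<beta>\<in>space (nu T E W). Q \<beta>}"
    using c by (auto simp: space_PiM)
  finally show ?thesis by simp
qed

end

locale exhausted_graph = weighted_graph E W for E :: "'v set set" and W +
  fixes T :: "'v set" and V :: "nat \<Rightarrow> 'v set"
  assumes V_mono: "incseq V" and V_finite: "finite (V n)" and V_Union: "(\<Union>n. V n) = T"
begin

abbreviation "N \<equiv> nu T E W"

lemma countable_T: "countable T"
  unfolding V_Union[symmetric] by (rule countable_UN[OF countableI_type]) (rule countable_finite[OF V_finite])

lemma V_sub: "V n \<subseteq> T" using V_Union by auto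

sublocale prob_space N by (rule prob_space_nu[OF countable_T])

lemma V_eventually: "x \<in> T \<Longrightarrow> \<exists>n0. \<forall>n\<ge>n0. x \<in> V n"
  using V_Union V_mono by (metis UN_E incseqD subsetD)

lemma pos_def_V: "\<beta> \<in> space N \<Longrightarrow> pos_def_on (V n) (H \<beta>)"
  using V_finite V_sub by (auto simp: space_nu[OF countable_T] pos_potentials_def)

lemma V_component: "i \<in> V n \<Longrightarrow> (\<lambda>\<beta>. \<beta> i) \<in> borel_measurable N"
  using nu_component[OF countable_T] V_sub by blast

lemma measurable_V:
  "(\<lambda>\<beta>. green (V n) \<beta> x y) \<in> borel_measurable N"
  "(\<lambda>\<beta>. psi_fin (V n) \<eta> \<beta> x) \<in> borel_measurable N"
  "(\<lambda>\<beta>. tilt_mart \<theta> (V n) x \<beta>) \<in> borel_measurable N"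
  by (rule measurable_finite_green measurable_psi_fin measurable_tilt_mart; use V_finite V_component in blast)+

lemma psi_V_nonneg: "0 \<le> psi_fin (V n) (bw (V n)) \<beta> x"
  by (intro psi_fin_nonneg V_finite bw_nonneg)

lemma green_incseq: "\<beta> \<in> space N \<Longrightarrow> incseq (\<lambda>n. green (V n) \<beta> x y)"
  by (intro incseq_SucI green_mono V_finite pos_def_V incseq_SucD[OF V_mono])

lemma prob_green_tight:
  assumes "x \<in> V n" "0 < K"
  shows "prob {\<beta>\<in>space N. K \<le> green (V n) \<beta> x x} \<le> sqrt (1 / K)"
proof -
  have m: "(\<lambda>\<beta>. green (V n) \<beta> x x) \<in> borel_measurable (PiL (V n))"
    by (rule measurable_finite_green[OF V_finite]) (rule PiL_component)
  have c: "green (V n) (restrict \<beta> (V n)) = green (V n) \<beta>" for \<beta> by (rule green_cong) simp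
  have "emeasure N {\<beta>\<in>space N. K \<le> green (V n) \<beta> x x} \<le> ennreal (sqrt (1 / K))"
    using green_tight[OF V_finite assms] m
    by (subst prob_nu_eq[OF countable_T V_finite V_sub[of n]]) (auto simp: c)
  then show ?thesis using assms(2) by (simp add: emeasure_eq_measure)
qed

lemma AE_green_convergent:
  assumes x: "x \<in> T"
  shows "AE \<beta> in N. convergent (\<lambda>n. green (V n) \<beta> x x)"
proof -
  obtain n0 where n0: "\<forall>n\<ge>n0. x \<in> V n" using V_eventually[OF x] by blast
  have "AE \<beta> in N. \<not> filterlim (\<lambda>n. green (V n) \<beta> x x) at_top sequentially"
  proof (rule AE_not_at_top[of _ n0 "\<lambda>K. sqrt (1 / K)"])
    show "((\<lambda>K. sqrt (1 / K)) \<longlongrightarrow> 0) at_top" by real_asymp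
  qed (use measurable_V prob_green_tight n0 in auto)
  then show ?thesis
  proof (rule AE_mp, intro AE_I2 impI)
    fix \<beta> assume \<beta>: "\<beta> \<in> space N" and nlim: "\<not> filterlim (\<lambda>n. green (V n) \<beta> x x) at_top sequentially"
    have inc: "incseq (\<lambda>n. green (V n) \<beta> x x)" by (rule green_incseq[OF \<beta>])
    obtain K where K: "\<And>n. green (V n) \<beta> x x \<le> K"
    proof -
      from nlim obtain K where "\<not> eventually (\<lambda>n. K \<le> green (V n) \<beta> x x) sequentially"
        by (auto simp: filterlim_at_top)
      then have "\<forall>m. \<exists>n\<ge>m. green (V n) \<beta> x x < K" by (auto simp: eventually_sequentially not_le)
      then have "green (V m) \<beta> x x \<le> K" for m using incseqD[OF inc] by (meson less_imp_le order_trans)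
      then show ?thesis using that by blast
    qed
    from incseq_convergent[OF inc, of K] K show "convergent (\<lambda>n. green (V n) \<beta> x x)"
      by (meson convergent_def)
  qed
qed

text \<open>The mean \<open>exp (- \<theta>)\<close> of the tilting martingale bounds that of \<open>exp (- \<theta> \<psi>\<^sub>n(x))\<close> from below, so \<open>\<psi>\<^sub>n(x)\<close>
  is rarely large compared with \<open>1 / \<theta>\<close>. The choice \<open>\<theta> = 1 / sqrt K\<close> makes the bound vanish as \<open>K\<close> grows.\<close>

lemma prob_psi_fin_tight:
  assumes x: "x \<in> V n" and K: "0 < K"
  shows "prob {\<beta>\<in>space N. K \<le> psi_fin (V n) (bw (V n)) \<beta> x} \<le> (1 - exp (- 1 / sqrt K)) / (1 - exp (- sqrt K))"
proof -
  let ?p = "\<lambda>\<beta>. psi_fin (V n) (bw (V n)) \<beta> x" and ?t = "1 / sqrt K"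
  let ?A = "{\<beta>\<in>space N. K \<le> ?p \<beta>}"
  have t: "0 < ?t" "?t * K = sqrt K" using K by (auto simp: real_div_sqrt)
  have [measurable]: "?p \<in> borel_measurable N" "(\<lambda>\<beta>. tilt_mart ?t (V n) x \<beta>) \<in> borel_measurable N" by (rule measurable_V)+
  have A [measurable]: "?A \<in> sets N" by measurable
  have le: "tilt_mart ?t (V n) x \<beta> \<le> 1 - (1 - exp (- sqrt K)) * indicator ?A \<beta>" if b: "\<beta> \<in> space N" for \<beta>
  proof -
    have G: "0 \<le> green (V n) \<beta> x x" by (rule green_nonneg[OF V_finite])
    have p: "0 \<le> ?p \<beta>" by (rule psi_V_nonneg)
    have M: "tilt_mart ?t (V n) x \<beta> \<le> exp (- ?t * ?p \<beta>)"
      unfolding tilt_mart_def using G by simp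
    show ?thesis
    proof (cases "K \<le> ?p \<beta>")
      case True
      have "?t * K \<le> ?t * ?p \<beta>" using True t by (intro mult_left_mono) auto
      then have "exp (- ?t * ?p \<beta>) \<le> exp (- sqrt K)" using t(2) by simp
      from order_trans[OF M this] show ?thesis using True b by simp
    next
      case False
      have "exp (- ?t * ?p \<beta>) \<le> 1" using p t by simp
      from order_trans[OF M this] show ?thesis using False by simp
    qed
  qed
  have "(\<integral>\<^sup>+\<beta>. ennreal (tilt_mart ?t (V n) x \<beta>) \<partial>N) = ennreal (exp (- ?t))"
    using t by (intro tilt_mart_integral countable_T V_finite V_sub x) simp
  then have "exp (- ?t) = (\<integral>\<beta>. tilt_mart ?t (V n) x \<beta> \<partial>N)"
    by (subst integral_eq_nn_integral) (auto simp: tilt_mart_def)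
  also have "\<dots> \<le> (\<integral>\<beta>. 1 - (1 - exp (- sqrt K)) * indicator ?A \<beta> \<partial>N)"
  proof (rule integral_mono_AE)
    show "integrable N (\<lambda>\<beta>. tilt_mart ?t (V n) x \<beta>)"
    proof (rule integrable_const_bound[of _ 1])
      show "AE \<beta> in N. norm (tilt_mart ?t (V n) x \<beta>) \<le> 1"
      proof (intro AE_I2)
        fix \<beta> assume "\<beta> \<in> space N"
        have "1 - (1 - exp (- sqrt K)) * indicator ?A \<beta> \<le> 1" using K by (auto split: split_indicator)
        from order_trans[OF le[OF \<open>\<beta> \<in> space N\<close>] this] show "norm (tilt_mart ?t (V n) x \<beta>) \<le> 1"
          using tilt_mart_pos[of ?t "V n" x \<beta>] by simp
      qed
    qed simp
    show "integrable N (\<lambda>\<beta>. 1 - (1 - exp (- sqrt K)) * indicator ?A \<beta>)"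
      using A by (intro Bochner_Integration.integrable_diff integrable_mult_right) (simp_all add: emeasure_eq_measure)
  qed (use le in \<open>auto intro!: AE_I2\<close>)
  also have "\<dots> = 1 - (1 - exp (- sqrt K)) * prob ?A"
  proof -
    have "integrable N (\<lambda>\<beta>. (1 - exp (- sqrt K)) * indicator ?A \<beta>)"
      using A by (intro integrable_mult_right) (simp_all add: emeasure_eq_measure)
    moreover have "(\<integral>\<beta>. indicator ?A \<beta> \<partial>N) = prob ?A"
      by (rule Bochner_Integration.integral_indicator[of N ?A, THEN trans])
        (rule arg_cong[where f=prob], use sets.sets_into_space[OF A] in blast)
    ultimately show ?thesis
      by (subst Bochner_Integration.integral_diff) (simp_all only: integral_mult_right_zero integrable_const, simp_all add: prob_space)
  qed
  finally have "(1 - exp (- sqrt K)) * prob ?A \<le> 1 - exp (- ?t)" by simp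
  then show ?thesis using K by (simp add: pos_le_divide_eq mult.commute)
qed

text \<open>The filtration is generated by the potential on the sets of the exhaustion.\<close>

lemma AE_tilt_mart_convergent:
  assumes x: "x \<in> T"
  shows "AE \<beta> in N. convergent (\<lambda>n. tilt_mart 1 (V n) x \<beta>)"
proof -
  obtain n0 where n0: "\<forall>n\<ge>n0. x \<in> V n" using V_eventually[OF x] by blast
  let ?V = "\<lambda>n. V (n + n0)"
  let ?r = "\<lambda>n \<beta>. restrict \<beta> (?V n) :: 'v \<Rightarrow> real"
  let ?F = "\<lambda>n. vimage_algebra (space N) (?r n) (PiL (?V n))"
  have r: "?r n \<in> N \<rightarrow>\<^sub>M PiL (?V n)" for n by (rule nu_restrict[OF countable_T V_sub])
  have rF: "?r n \<in> ?F n \<rightarrow>\<^sub>M PiL (?V n)" for n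
    using measurable_space[OF r] by (intro measurable_vimage_algebra1) auto
  have Vm: "?V k \<subseteq> ?V n" if "k \<le> n" for k n using incseqD[OF V_mono] that by simp
  have "AE \<beta> in N. convergent (\<lambda>n. tilt_mart 1 (?V n) x \<beta>)"
  proof (rule bounded_martingale_converges[OF prob_space_axioms, of ?F])
    show "subalgebra N (?F n)" for n
      unfolding subalgebra_def using r[of n]
      by (auto simp: sets_vimage_algebra2[OF measurable_space[OF r, THEN Pi_I]] measurable_sets)
    show "sets (?F k) \<subseteq> sets (?F n)" if "k \<le> n" for k n
    proof
      fix A assume "A \<in> sets (?F k)"
      then obtain B where B: "B \<in> sets (PiL (?V k))" "A = ?r k -` B \<inter> space N"
        by (auto simp: sets_vimage_algebra2[OF measurable_space[OF r, THEN Pi_I]])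
      have m: "(\<lambda>\<beta>. restrict (?r n \<beta>) (?V k)) \<in> ?F n \<rightarrow>\<^sub>M PiL (?V k)"
        by (rule measurable_compose[OF rF measurable_restrict_subset[OF Vm[OF that]]])
      have e: "restrict (?r n \<beta>) (?V k) = ?r k \<beta>" for \<beta>
        using Vm[OF that] by (simp add: Int_absorb1)
      show "A \<in> sets (?F n)"
        using measurable_sets[OF m B(1)] unfolding e B(2) by simp
    qed
    show "(\<lambda>\<beta>. tilt_mart 1 (?V n) x \<beta>) \<in> borel_measurable (?F n)" for n
    proof (rule measurable_tilt_mart[OF V_finite])
      fix i assume i: "i \<in> ?V n"
      have "(\<lambda>\<beta>. ?r n \<beta> i) \<in> borel_measurable (?F n)"
        by (rule measurable_compose[OF rF PiL_component[OF i]])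
      then show "(\<lambda>\<beta>. \<beta> i) \<in> borel_measurable (?F n)" using i by simp
    qed
    show "0 \<le> tilt_mart 1 (?V n) x \<beta>" "tilt_mart 1 (?V n) x \<beta> \<le> 1" for n \<beta>
      using green_nonneg[OF V_finite, of "n + n0" \<beta> x x] psi_V_nonneg[of "n + n0" \<beta> x]
      by (simp_all add: tilt_mart_def)
    fix k n A assume kn: "k \<le> n" and "A \<in> sets (?F k)"
    then obtain B where B: "B \<in> sets (PiL (?V k))" "A = ?r k -` B \<inter> space N"
      by (auto simp: sets_vimage_algebra2[OF measurable_space[OF r, THEN Pi_I]])
    have eq: "(\<integral>\<beta>\<in>A. tilt_mart 1 (?V m) x \<beta> \<partial>N) = enn2real (\<integral>\<^sup>+\<beta>. indicator B (?r k \<beta>) * ennreal (tilt_mart 1 (?V m) x \<beta>) \<partial>N)" for m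
    proof -
      have "A \<in> sets N" using measurable_sets[OF r B(1)] B(2) by simp
      then have "(\<integral>\<beta>\<in>A. tilt_mart 1 (?V m) x \<beta> \<partial>N) = enn2real (\<integral>\<^sup>+\<beta>. ennreal (indicator A \<beta> * tilt_mart 1 (?V m) x \<beta>) \<partial>N)"
        unfolding set_lebesgue_integral_def using measurable_V(3)
        by (subst integral_eq_nn_integral) (auto simp: less_imp_le[OF tilt_mart_pos] intro!: borel_measurable_times)
      also have "(\<integral>\<^sup>+\<beta>. ennreal (indicator A \<beta> * tilt_mart 1 (?V m) x \<beta>) \<partial>N) = (\<integral>\<^sup>+\<beta>. indicator B (?r k \<beta>) * ennreal (tilt_mart 1 (?V m) x \<beta>) \<partial>N)"
        by (intro nn_integral_cong) (simp add: B(2) indicator_def)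
      finally show ?thesis .
    qed
    show "(\<integral>\<beta>\<in>A. tilt_mart 1 (?V n) x \<beta> \<partial>N) = (\<integral>\<beta>\<in>A. tilt_mart 1 (?V k) x \<beta> \<partial>N)"
      unfolding eq
      by (subst tilt_mart_martingale[OF countable_T V_finite V_sub Vm[OF kn]]) (use n0 B(1) in auto)
  qed
  then show ?thesis
  proof eventually_elim
    case (elim \<beta>)
    then show ?case using convergent_ignore_initial_segment[of "\<lambda>n. tilt_mart 1 (V n) x \<beta>" n0] by simp
  qed
qed

text \<open>Convergence of the martingale and of the Green function determines that of \<open>\<psi>\<^sub>n(x)\<close>, unless the martingale
  tends to 0. In that case \<open>\<psi>\<^sub>n(x)\<close> tends to infinity, which tightness excludes.\<close>

lemma AE_psi_fin_convergent:
  assumes x: "x \<in> T"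
  shows "AE \<beta> in N. convergent (\<lambda>n. psi_fin (V n) (bw (V n)) \<beta> x)"
proof -
  obtain n0 where n0: "\<forall>n\<ge>n0. x \<in> V n" using V_eventually[OF x] by blast
  have "AE \<beta> in N. \<not> filterlim (\<lambda>n. psi_fin (V n) (bw (V n)) \<beta> x) at_top sequentially"
  proof (rule AE_not_at_top[of _ n0 "\<lambda>K. (1 - exp (- 1 / sqrt K)) / (1 - exp (- sqrt K))"])
    show "((\<lambda>K. (1 - exp (- 1 / sqrt K)) / (1 - exp (- sqrt K))) \<longlongrightarrow> 0) at_top" by real_asymp
  qed (use measurable_V prob_psi_fin_tight n0 in auto)
  with AE_tilt_mart_convergent[OF x] AE_green_convergent[OF x] show ?thesis
  proof eventually_elim
    case (elim \<beta>)
    let ?p = "\<lambda>n. psi_fin (V n) (bw (V n)) \<beta> x" and ?G = "\<lambda>n. green (V n) \<beta> x x" and ?M = "\<lambda>n. tilt_mart 1 (V n) x \<beta>"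
    obtain g where g: "?G \<longlonglongrightarrow> g" using elim(2) by (auto simp: convergent_def)
    obtain l where l: "?M \<longlonglongrightarrow> l" using elim(1) by (auto simp: convergent_def)
    have p: "?p n = - ln (?M n) - ?G n / 2" for n by (simp add: tilt_mart_def)
    have Mpos: "0 < ?M n" for n by (simp add: tilt_mart_def)
    have "0 \<le> l" by (rule LIMSEQ_le_const[OF l]) (use Mpos in \<open>auto intro: less_imp_le\<close>)
    show ?case
    proof (cases "l = 0")
      case True
      have "filterlim ?M (at_right 0) sequentially"
        using l True Mpos by (intro tendsto_imp_filterlim_at_right) auto
      then have "filterlim (\<lambda>n. ln (?M n)) at_bot sequentially"
        by (rule filterlim_compose[OF ln_at_0])
      then have "filterlim (\<lambda>n. - ln (?M n)) at_top sequentially"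
        by (simp add: filterlim_uminus_at_bot)
      then have "filterlim (\<lambda>n. - (?G n / 2) + - ln (?M n)) at_top sequentially"
        using g by (intro filterlim_tendsto_add_at_top[where c="- (g / 2)"] tendsto_intros) simp_all
      then have "filterlim ?p at_top sequentially" unfolding p by (simp add: add.commute)
      then show ?thesis using elim(3) by simp
    next
      case False
      then have "0 < l" using \<open>0 \<le> l\<close> by simp
      then have "(\<lambda>n. - ln (?M n) - ?G n / 2) \<longlonglongrightarrow> - ln l - g / 2"
        using l g by (intro tendsto_intros) auto
      then have "?p \<longlonglongrightarrow> - ln l - g / 2" by (simp only: p)
      then show ?thesis by (auto simp: convergent_def)
    qed
  qed
qed

lemma AE_limits:
  "AE \<beta> in N. \<forall>x\<in>T. (\<lambda>n. psi_n E W (V n) \<beta> x) \<longlonglongrightarrow> psi E W V \<beta> x \<and> 0 \<le> psi E W V \<beta> x \<and>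
     (\<forall>y\<in>T. 0 \<le> Ghat E W V \<beta> x y)"
proof -
  have 1: "AE \<beta> in N. \<forall>x\<in>T. convergent (\<lambda>n. psi_fin (V n) (bw (V n)) \<beta> x) \<and> convergent (\<lambda>n. green (V n) \<beta> x x)"
  proof (rule AE_ball_countable'[OF _ countable_T])
    fix x assume "x \<in> T"
    from AE_psi_fin_convergent[OF this] AE_green_convergent[OF this]
    show "AE \<beta> in N. convergent (\<lambda>n. psi_fin (V n) (bw (V n)) \<beta> x) \<and> convergent (\<lambda>n. green (V n) \<beta> x x)"
      by eventually_elim simp
  qed
  then show ?thesis
  proof (rule AE_mp, intro AE_I2 impI ballI)
    fix \<beta> x assume b: "\<beta> \<in> space N" and x: "x \<in> T"
      and *: "\<forall>x\<in>T. convergent (\<lambda>n. psi_fin (V n) (bw (V n)) \<beta> x) \<and> convergent (\<lambda>n. green (V n) \<beta> x x)"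
    obtain n0 where n0: "\<forall>n\<ge>n0. x \<in> V n" using V_eventually[OF x] by blast
    have ev: "eventually (\<lambda>n. psi_fin (V n) (bw (V n)) \<beta> x = psi_n E W (V n) \<beta> x) sequentially"
      unfolding eventually_sequentially
      by (rule exI[of _ n0]) (use n0 psi_n_eq[OF V_finite pos_def_V[OF b]] in auto)
    have "convergent (\<lambda>n. psi_n E W (V n) \<beta> x)"
      using * x convergent_cong[OF ev] by simp
    then have lim: "(\<lambda>n. psi_n E W (V n) \<beta> x) \<longlonglongrightarrow> psi E W V \<beta> x"
      unfolding psi_def by (simp add: convergent_LIMSEQ_iff)
    have nn: "0 \<le> psi_n E W (V n) \<beta> x" for n
      using psi_n_eq[OF V_finite pos_def_V[OF b], of n x] psi_V_nonneg[of n \<beta> x] by simp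
    have "0 \<le> psi E W V \<beta> x" using LIMSEQ_le_const[OF lim] nn by blast
    moreover have "0 \<le> Ghat E W V \<beta> x y" if y: "y \<in> T" for y
    proof -
      have Bd: "\<exists>K. \<forall>n. green (V n) \<beta> z z \<le> K" if "z \<in> T" for z
      proof -
        have "Bseq (\<lambda>n. green (V n) \<beta> z z)" using * that by (intro convergent_imp_Bseq) auto
        then obtain K where "\<And>n. norm (green (V n) \<beta> z z) \<le> K" by (auto simp: Bseq_def)
        then have "\<forall>n. green (V n) \<beta> z z \<le> K" by (simp add: abs_le_iff)
        then show ?thesis ..
      qed
      obtain K1 K2 where K: "\<And>n. green (V n) \<beta> x x \<le> K1" "\<And>n. green (V n) \<beta> y y \<le> K2"
        using Bd[OF x] Bd[OF y] by blast
      have bd: "green (V n) \<beta> x y \<le> (K1 + K2) / 2" for n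
        using green_AM[OF V_finite, of n \<beta> x y] K(1)[of n] K(2)[of n] by simp
      obtain L where L: "(\<lambda>n. green (V n) \<beta> x y) \<longlonglongrightarrow> L"
        using incseq_convergent[OF green_incseq[OF b], of x y "(K1 + K2) / 2"] bd by blast
      have "0 \<le> L" using LIMSEQ_le_const[OF L] green_nonneg[OF V_finite] by blast
      moreover have "Ghat E W V \<beta> x y = L"
        unfolding Ghat_def Ghat_n_eq[OF pos_def_V[OF b]] by (rule limI[OF L])
      ultimately show ?thesis by simp
    qed
    ultimately show "(\<lambda>n. psi_n E W (V n) \<beta> x) \<longlonglongrightarrow> psi E W V \<beta> x \<and> 0 \<le> psi E W V \<beta> x \<and>
     (\<forall>y\<in>T. 0 \<le> Ghat E W V \<beta> x y)" using lim by blast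
  qed
qed

lemma measurable_limits:
  shows "(\<lambda>\<beta>. psi E W V \<beta> x) \<in> borel_measurable N"
    and "(\<lambda>\<beta>. Ghat E W V \<beta> x y) \<in> borel_measurable N"
proof -
  have "(\<lambda>\<beta>. if x \<in> V n then psi_fin (V n) (bw (V n)) \<beta> x else 1) \<in> borel_measurable N" for n
    using measurable_V(2) by (cases "x \<in> V n") auto
  then have "(\<lambda>\<beta>. psi_n E W (V n) \<beta> x) \<in> borel_measurable N" for n
    using psi_n_eq[OF V_finite pos_def_V] by (subst measurable_cong) auto
  then show "(\<lambda>\<beta>. psi E W V \<beta> x) \<in> borel_measurable N"
    unfolding psi_def by (rule borel_measurable_lim_metric)
  have "(\<lambda>\<beta>. Ghat_n E W (V n) \<beta> x y) \<in> borel_measurable N" for n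
    using measurable_V(1) Ghat_n_eq[OF pos_def_V] by (subst measurable_cong) auto
  then show "(\<lambda>\<beta>. Ghat E W V \<beta> x y) \<in> borel_measurable N"
    unfolding Ghat_def by (rule borel_measurable_lim_metric)
qed

lemma prob_psi_less:
  assumes x: "x \<in> T" and le: "\<And>n. x \<in> V n \<Longrightarrow> emeasure (nuF (V n)) {\<beta>\<in>space (nuF (V n)). psi_fin (V n) (bw (V n)) \<beta> x < c} \<le> ennreal q"
    and q: "0 \<le> q"
  shows "prob {\<beta>\<in>space N. psi E W V \<beta> x < c} \<le> q"
proof -
  obtain n0 where n0: "\<forall>n\<ge>n0. x \<in> V n" using V_eventually[OF x] by blast
  let ?B = "\<lambda>n. {\<beta>\<in>space N. psi_fin (V n) (bw (V n)) \<beta> x < c}"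
  have B: "?B n \<in> sets N" for n using measurable_V(2) by measurable
  have "prob (?B n) \<le> q" if "n0 \<le> n" for n
  proof -
    have m: "(\<lambda>\<beta>. psi_fin (V n) (bw (V n)) \<beta> x) \<in> borel_measurable (PiL (V n))"
      by (rule measurable_psi_fin[OF V_finite]) (rule PiL_component)
    have cc: "psi_fin (V n) (bw (V n)) (restrict \<beta> (V n)) = psi_fin (V n) (bw (V n)) \<beta>" for \<beta> by (rule psi_fin_cong) simp
    have "emeasure N (?B n) \<le> ennreal q"
      using le[of n] n0 that m
      by (subst prob_nu_eq[OF countable_T V_finite V_sub[of n]]) (auto simp: cc)
    then show ?thesis using q by (simp add: emeasure_eq_measure)
  qed
  then have ev: "prob {\<beta>\<in>space N. \<exists>m. \<forall>n\<ge>m. \<beta> \<in> ?B n} \<le> q"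
    by (rule prob_eventually_le[OF B])
  have [measurable]: "(\<lambda>\<beta>. psi E W V \<beta> x) \<in> borel_measurable N" by (rule measurable_limits)
  have "AE \<beta> in N. \<beta> \<in> {\<beta>\<in>space N. psi E W V \<beta> x < c} \<longrightarrow> \<beta> \<in> {\<beta>\<in>space N. \<exists>m. \<forall>n\<ge>m. \<beta> \<in> ?B n}"
    using AE_limits
  proof (rule AE_mp, intro AE_I2 impI)
    fix \<beta> assume b: "\<beta> \<in> space N" "\<beta> \<in> {\<beta>\<in>space N. psi E W V \<beta> x < c}"
      and *: "\<forall>x\<in>T. (\<lambda>n. psi_n E W (V n) \<beta> x) \<longlonglongrightarrow> psi E W V \<beta> x \<and> 0 \<le> psi E W V \<beta> x \<and> (\<forall>y\<in>T. 0 \<le> Ghat E W V \<beta> x y)"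
    then have "eventually (\<lambda>n. psi_n E W (V n) \<beta> x < c) sequentially"
      using x by (intro order_tendstoD(2)[where y="psi E W V \<beta> x"]) auto
    then obtain m where m: "\<forall>n\<ge>m. psi_n E W (V n) \<beta> x < c" by (auto simp: eventually_sequentially)
    have "\<beta> \<in> ?B n" if "max m n0 \<le> n" for n
      using m n0 that psi_n_eq[OF V_finite pos_def_V[OF b(1)], of n x] b(1) by auto
    then show "\<beta> \<in> {\<beta>\<in>space N. \<exists>m. \<forall>n\<ge>m. \<beta> \<in> ?B n}" using b(1) by blast
  qed
  moreover have "{\<beta>\<in>space N. \<exists>m. \<forall>n\<ge>m. \<beta> \<in> ?B n} \<in> sets N"
  proof -
    have [measurable]: "(\<lambda>\<beta>. psi_fin (V n) (bw (V n)) \<beta> x) \<in> borel_measurable N" for n by (rule measurable_V)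
    have "{\<beta>\<in>space N. \<exists>m. \<forall>n\<ge>m. \<beta> \<in> ?B n} = {\<beta>\<in>space N. \<exists>m. \<forall>n\<ge>m. psi_fin (V n) (bw (V n)) \<beta> x < c}" by auto
    then show ?thesis by simp
  qed
  ultimately have "prob {\<beta>\<in>space N. psi E W V \<beta> x < c} \<le> prob {\<beta>\<in>space N. \<exists>m. \<forall>n\<ge>m. \<beta> \<in> ?B n}"
    by (rule finite_measure_mono_AE)
  then show ?thesis using ev by simp
qed

end

section \<open>Rooted trees\<close>

lemma walk_Cons: "walk E (x # y # xs) \<longleftrightarrow> {x, y} \<in> E \<and> walk E (y # xs)"
  by (simp add: walk_def)

lemma walk_single [simp]: "walk E [x]"
  by (simp add: walk_def)

lemma walk_append_iff:
  "xs \<noteq> [] \<Longrightarrow> ys \<noteq> [] \<Longrightarrow> walk E (xs @ ys) \<longleftrightarrow> walk E xs \<and> walk E ys \<and> {last xs, hd ys} \<in> E"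
  by (auto simp: walk_def successively_append_iff)

lemma walk_rev: "walk E (rev xs) \<longleftrightarrow> walk E xs"
  by (simp add: walk_def insert_commute)

lemma walk_distinct:
  assumes "walk E xs"
  shows "\<exists>ys. walk E ys \<and> distinct ys \<and> hd ys = hd xs \<and> last ys = last xs"
  using assms
proof (induction xs)
  case Nil
  then show ?case by (simp add: walk_def)
next
  case (Cons x xs)
  show ?case
  proof (cases "xs = []")
    case True
    then show ?thesis by (intro exI[of _ "[x]"]) simp
  next
    case False
    then obtain z zs where xs: "xs = z # zs" by (cases xs) auto
    then have zx: "{x, z} \<in> E" "walk E xs" using Cons.prems by (simp_all add: walk_Cons)
    then obtain ys where ys: "walk E ys" "distinct ys" "hd ys = hd xs" "last ys = last xs" using Cons.IH by blast
    have ne: "ys \<noteq> []" using ys(1) by (auto simp: walk_def)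
    show ?thesis
    proof (cases "x \<in> set ys")
      case False
      have "walk E ([x] @ ys)" using ne zx ys xs by (subst walk_append_iff) auto
      then show ?thesis using False ys ne xs by (intro exI[of _ "x # ys"]) auto
    next
      case True
      then obtain a b where ab: "ys = a @ x # b" by (meson split_list)
      have "walk E (x # b)"
        using ys(1) unfolding ab by (cases "a = []") (simp_all add: walk_append_iff)
      then show ?thesis using ys ab xs by (intro exI[of _ "x # b"]) auto
    qed
  qed
qed

locale tree_graph =
  fixes T :: "'v set" and E :: "'v set set"
  assumes tree: "tree T E"
begin

lemma no_cycle: "\<not> cycle E xs"
  using tree by (auto simp: tree_def)

lemma edge_in_T: "{i, j} \<in> E \<Longrightarrow> i \<in> T" "{i, j} \<in> E \<Longrightarrow> j \<in> T" "{i, j} \<in> E \<Longrightarrow> i \<noteq> j"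
proof -
  have *: "\<exists>a\<in>T. \<exists>b\<in>T. a \<noteq> b \<and> {i, j} = {a, b}" if "{i, j} \<in> E"
    using tree that by (auto simp: tree_def simple_graph_def)
  show "{i, j} \<in> E \<Longrightarrow> i \<in> T" "{i, j} \<in> E \<Longrightarrow> j \<in> T" "{i, j} \<in> E \<Longrightarrow> i \<noteq> j"
    using * by (auto simp: doubleton_eq_iff)
qed

text \<open>At the first vertex where two walks from \<open>x\<close> meet again after leaving \<open>x\<close> through different
  neighbours, the two initial pieces close up to a cycle.\<close>

lemma distinct_walk_unique:
  assumes "walk E xs" "distinct xs" "walk E ys" "distinct ys" "hd xs = hd ys" "last xs = last ys"
  shows "xs = ys"
  using assms
proof (induction xs arbitrary: ys)
  case Nil
  then show ?case by (simp add: walk_def)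
next
  case (Cons x p)
  obtain q where q: "ys = x # q" using Cons.prems by (cases ys) (auto simp: walk_def)
  show ?case
  proof (cases "p = [] \<or> q = []")
    case True
    then show ?thesis using Cons.prems q by (auto split: if_splits)
  next
    case False
    then have ne: "p \<noteq> []" "q \<noteq> []" by auto
    have walk_tl: "walk E r \<and> {x, hd r} \<in> E" if "walk E (x # r)" "r \<noteq> []" for r
      using that by (cases r) (auto simp: walk_Cons)
    have wp: "walk E p" "{x, hd p} \<in> E" and wq: "walk E q" "{x, hd q} \<in> E"
      using walk_tl[OF Cons.prems(1) ne(1)] walk_tl[OF Cons.prems(3)[unfolded q] ne(2)] by blast+
    have dp: "distinct p" "x \<notin> set p" and dq: "distinct q" "x \<notin> set q" using Cons.prems q by auto
    have l: "last p = last q" using Cons.prems(6) q ne by simp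
    show ?thesis
    proof (cases "hd p = hd q")
      case True
      then show ?thesis using Cons.IH[OF wp(1) dp(1) wq(1) dq(1) True l] q by simp
    next
      case False
      have "\<exists>v\<in>set p. v \<in> set q" using l ne by (metis last_in_set)
      then obtain p1 v p2 where p: "p = p1 @ v # p2" "v \<in> set q" "\<forall>u\<in>set p1. u \<notin> set q"
        using split_list_first_prop[of p "\<lambda>v. v \<in> set q"] by blast
      obtain q1 q2 where qq: "q = q1 @ v # q2" using p(2) by (meson split_list)
      have w1: "walk E (x # p1 @ [v])"
      proof (cases "p2 = []")
        case True then show ?thesis using Cons.prems(1) p by simp
      next
        case False
        have "walk E ((x # p1 @ [v]) @ p2)" using Cons.prems(1) p by simp
        then show ?thesis using False by (subst (asm) walk_append_iff) auto
      qed
      have w2: "walk E (q1 @ [v])"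
      proof (cases "q2 = []")
        case True then show ?thesis using wq qq by simp
      next
        case False
        have "walk E ((q1 @ [v]) @ q2)" using wq qq by simp
        then show ?thesis using False by (subst (asm) walk_append_iff) auto
      qed
      have "cycle E ((x # p1 @ [v]) @ rev q1)"
        unfolding cycle_def
      proof (intro conjI)
        show "3 \<le> length ((x # p1 @ [v]) @ rev q1)"
          using False p qq by (cases p1; cases q1) auto
        show "distinct ((x # p1 @ [v]) @ rev q1)"
          using dp dq p qq by auto
        show "walk E ((x # p1 @ [v]) @ rev q1)"
        proof (cases "q1 = []")
          case False
          have "walk E (rev q1)" "{v, last q1} \<in> E"
            using w2 False by (auto simp: walk_append_iff walk_rev insert_commute)
          then show ?thesis using w1 False by (subst walk_append_iff) (auto simp: hd_rev)
        qed (use w1 in simp)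
        have "last ((x # p1 @ [v]) @ rev q1) = hd q" using qq by (cases q1) (auto simp: last_rev)
        then show "{last ((x # p1 @ [v]) @ rev q1), hd ((x # p1 @ [v]) @ rev q1)} \<in> E"
          using wq(2) by (simp add: insert_commute)
      qed
      then show ?thesis using no_cycle by blast
    qed
  qed
qed

lemma rooted_walk_exists:
  assumes "\<rho> \<in> T" "v \<in> T"
  shows "\<exists>xs. walk E xs \<and> distinct xs \<and> hd xs = \<rho> \<and> last xs = v"
proof -
  obtain xs where "walk E xs" "hd xs = \<rho>" "last xs = v"
    using tree assms unfolding tree_def connected_in_def by blast
  then show ?thesis using walk_distinct[of E xs] by auto
qed

lemma parent_eqI:
  assumes "walk E (xs @ [j, i])" "distinct (xs @ [j, i])" "hd (xs @ [j, i]) = \<rho>"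
  shows "parent E \<rho> i = j"
  unfolding parent_def
proof (rule the_equality)
  show "\<exists>xs. walk E (xs @ [j, i]) \<and> distinct (xs @ [j, i]) \<and> hd (xs @ [j, i]) = \<rho>" using assms by blast
  fix j' assume "\<exists>xs. walk E (xs @ [j', i]) \<and> distinct (xs @ [j', i]) \<and> hd (xs @ [j', i]) = \<rho>"
  then obtain ys where "walk E (ys @ [j', i])" "distinct (ys @ [j', i])" "hd (ys @ [j', i]) = \<rho>" by blast
  then have "xs @ [j, i] = ys @ [j', i]" using assms by (intro distinct_walk_unique) auto
  then show "j' = j" by simp
qed

text \<open>A simple walk from the root to \<open>u\<close> either avoids \<open>v\<close> and extends to \<open>v\<close>, or contains \<open>v\<close>; in the latter
  case \<open>v\<close> is the last but one vertex, because otherwise the edge closes a cycle.\<close>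

lemma edge_parent:
  assumes \<rho>: "\<rho> \<in> T" and e: "{u, v} \<in> E"
  shows "(v \<noteq> \<rho> \<and> parent E \<rho> v = u) \<or> (u \<noteq> \<rho> \<and> parent E \<rho> u = v)"
proof -
  obtain xs where xs: "walk E xs" "distinct xs" "hd xs = \<rho>" "last xs = u"
    using rooted_walk_exists[OF \<rho> edge_in_T(1)[OF e]] by blast
  have ne: "xs \<noteq> []" using xs(1) by (auto simp: walk_def)
  show ?thesis
  proof (cases "v \<in> set xs")
    case False
    have bl: "xs @ [v] = butlast xs @ [u, v]" using append_butlast_last_id[OF ne] xs(4) by (metis append.assoc append_Cons append_Nil)
    have "walk E (xs @ [v])" using ne xs e by (subst walk_append_iff) auto
    moreover have "distinct (xs @ [v])" "hd (xs @ [v]) = \<rho>" using xs False ne by auto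
    ultimately have "parent E \<rho> v = u" unfolding bl by (rule parent_eqI)
    moreover have "v \<noteq> \<rho>" using False xs ne by (metis hd_in_set)
    ultimately show ?thesis by simp
  next
    case True
    then obtain a b where ab: "xs = a @ v # b" by (meson split_list)
    have b: "b \<noteq> []" using xs(4) ab edge_in_T(3)[OF e] by auto
    have wb: "walk E (v # b)" using xs(1) ab by (cases "a = []") (auto simp: walk_append_iff)
    have "\<not> 3 \<le> length (v # b)"
    proof
      assume "3 \<le> length (v # b)"
      moreover have "{last (v # b), hd (v # b)} \<in> E" using xs(4) ab b e by simp
      ultimately have "cycle E (v # b)" using wb xs(2) ab by (auto simp: cycle_def)
      then show False using no_cycle by blast
    qed
    then have "b = [u]" using b xs(4) ab by (cases b; cases "tl b") auto
    then have x: "xs = a @ [v, u]" using ab by simp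
    then have "parent E \<rho> u = v" using xs by (intro parent_eqI) auto
    moreover have "u \<noteq> \<rho>" using x xs by (cases a) auto
    ultimately show ?thesis by simp
  qed
qed

lemma parent_edge:
  assumes \<rho>: "\<rho> \<in> T" and v: "v \<in> T" "v \<noteq> \<rho>"
  shows "{parent E \<rho> v, v} \<in> E"
proof -
  obtain xs where xs: "walk E xs" "distinct xs" "hd xs = \<rho>" "last xs = v"
    using rooted_walk_exists[OF \<rho> v(1)] by blast
  have ne: "xs \<noteq> []" using xs(1) by (auto simp: walk_def)
  have "butlast xs \<noteq> []" using ne xs(3,4) v(2) by (metis append_butlast_last_id append_Nil list.sel(1))
  then have x: "xs = butlast (butlast xs) @ [last (butlast xs), v]"
    using ne xs(4) by (metis append.assoc append_Cons append_Nil append_butlast_last_id)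
  then have "parent E \<rho> v = last (butlast xs)" using xs by (metis parent_eqI)
  moreover have "walk E (butlast xs @ [v])" using xs ne append_butlast_last_id[OF ne] by simp
  ultimately show ?thesis using \<open>butlast xs \<noteq> []\<close> by (simp add: walk_append_iff)
qed

text \<open>Every vertex has a neighbour other than its parent, and such a neighbour cannot lie on the walk from the
  root.\<close>

lemma long_distinct_walk:
  assumes \<rho>: "\<rho> \<in> T" and deg: "\<And>i. i \<in> T \<Longrightarrow> finite (nbrs E i) \<and> 3 \<le> card (nbrs E i)"
  shows "\<exists>xs. walk E xs \<and> distinct xs \<and> hd xs = \<rho> \<and> set xs \<subseteq> T \<and> length xs = Suc n"
proof (induction n)
  case 0
  show ?case using \<rho> by (intro exI[of _ "[\<rho>]"]) simp
next
  case (Suc n)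
  then obtain xs where xs: "walk E xs" "distinct xs" "hd xs = \<rho>" "set xs \<subseteq> T" "length xs = Suc n" by blast
  have ne: "xs \<noteq> []" using xs(5) by auto
  let ?u = "last xs"
  have u: "?u \<in> T" using xs(4) ne by auto
  have "\<not> nbrs E ?u \<subseteq> {parent E \<rho> ?u}"
    using deg[OF u] card_mono[of "{parent E \<rho> ?u}" "nbrs E ?u"] by auto
  then obtain k where k: "{?u, k} \<in> E" "k \<noteq> parent E \<rho> ?u" by (auto simp: nbrs_def)
  then have pk: "parent E \<rho> k = ?u" "k \<noteq> \<rho>" using edge_parent[OF \<rho> k(1)] by auto
  have kT: "k \<in> T" by (rule edge_in_T(2)[OF k(1)])
  have "k \<notin> set xs"
  proof
    assume "k \<in> set xs"
    then obtain a b where ab: "xs = a @ k # b" by (meson split_list)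
    have b: "b \<noteq> []" using ab edge_in_T(3)[OF k(1)] by auto
    have a: "a \<noteq> []" using ab xs(3) pk(2) by auto
    have eq: "a @ [k] = butlast a @ [last a, k]" using append_butlast_last_id[OF a] by (metis append.assoc append_Cons append_Nil)
    have "walk E ((a @ [k]) @ b)" using xs(1) ab by simp
    then have "walk E (a @ [k])" using b by (subst (asm) walk_append_iff) auto
    moreover have "distinct (a @ [k])" "hd (a @ [k]) = \<rho>" using xs ab a by auto
    ultimately have "parent E \<rho> k = last a" unfolding eq by (rule parent_eqI)
    then have "last a = last b" using pk(1) ab b by simp
    then show False using xs(2) ab a b by (metis IntI UnI2 append_is_Nil_conv distinct_append empty_iff last_in_set set_append set_subset_Cons subsetD)
  qed
  moreover have "walk E (xs @ [k])" using ne xs(1) k(1) by (subst walk_append_iff) auto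
  ultimately show ?case using xs ne kT by (intro exI[of _ "xs @ [k]"]) auto
qed

lemma parent_nth:
  assumes xs: "walk E xs" "distinct xs" "hd xs = \<rho>" and k: "Suc k < length xs"
  shows "parent E \<rho> (xs ! Suc k) = xs ! k" "xs ! Suc k \<noteq> \<rho>" "{xs ! k, xs ! Suc k} \<in> E"
proof -
  have t: "take (Suc (Suc k)) xs = take k xs @ [xs ! k, xs ! Suc k]"
    using k by (simp add: take_Suc_conv_app_nth)
  have "walk E (take (Suc (Suc k)) xs)"
  proof (cases "drop (Suc (Suc k)) xs = []")
    case True
    then show ?thesis using xs(1) by simp
  next
    case False
    have "walk E (take (Suc (Suc k)) xs @ drop (Suc (Suc k)) xs)" using xs(1) by simp
    then show ?thesis using False k by (subst (asm) walk_append_iff) auto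
  qed
  then have w: "walk E (take k xs @ [xs ! k, xs ! Suc k])" by (simp only: t)
  moreover have "distinct (take k xs @ [xs ! k, xs ! Suc k])"
    unfolding t[symmetric] using xs(2) by (rule distinct_take)
  moreover have "hd (take k xs @ [xs ! k, xs ! Suc k]) = \<rho>"
    unfolding t[symmetric] using xs(3) k by (cases xs) auto
  ultimately show "parent E \<rho> (xs ! Suc k) = xs ! k" by (rule parent_eqI)
  have "xs ! Suc k \<noteq> xs ! 0" using xs(2) k by (subst nth_eq_iff_index_eq) auto
  then show "xs ! Suc k \<noteq> \<rho>" using xs(3) k by (cases xs) auto
  have "walk E ([xs ! k] @ [xs ! Suc k])"
    using w by (cases "take k xs = []") (auto simp: walk_append_iff)
  then show "{xs ! k, xs ! Suc k} \<in> E" by (simp add: walk_Cons)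
qed

text \<open>\<open>desc \<rho> c v\<close>: the vertex \<open>v\<close> is \<open>c\<close> or lies below \<open>c\<close> when the tree is rooted at \<open>\<rho>\<close>.\<close>

inductive desc :: "'v \<Rightarrow> 'v \<Rightarrow> 'v \<Rightarrow> bool" for \<rho> c where
  self: "desc \<rho> c c"
| child: "v \<noteq> \<rho> \<Longrightarrow> desc \<rho> c (parent E \<rho> v) \<Longrightarrow> desc \<rho> c v"

text \<open>Sets of eliminated vertices: they contain the root and are closed under parents.\<close>

definition upper :: "'v \<Rightarrow> 'v set \<Rightarrow> bool" where
  "upper \<rho> R \<longleftrightarrow> \<rho> \<in> R \<and> (\<forall>v\<in>R. v \<noteq> \<rho> \<longrightarrow> parent E \<rho> v \<in> R)"

text \<open>The vertices at which the branches hanging below \<open>R\<close> are rooted.\<close>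

definition tops :: "'v \<Rightarrow> 'v set \<Rightarrow> 'v set" where
  "tops \<rho> R = {v\<in>T. v \<notin> R \<and> parent E \<rho> v \<in> R}"

lemma upper_desc: "upper \<rho> R \<Longrightarrow> desc \<rho> c v \<Longrightarrow> v \<in> R \<Longrightarrow> c \<in> R"
  by (rotate_tac 1, induction rule: desc.induct) (auto simp: upper_def)

lemma upper_insert: "upper \<rho> R \<Longrightarrow> j \<in> tops \<rho> R \<Longrightarrow> upper \<rho> (insert j R)"
  by (auto simp: upper_def tops_def)

lemma tops_insert: "j \<in> tops \<rho> R \<Longrightarrow> f \<in> tops \<rho> R \<Longrightarrow> f \<noteq> j \<Longrightarrow> f \<in> tops \<rho> (insert j R)"
  by (auto simp: tops_def)

lemma tops_children:
  assumes \<rho>: "\<rho> \<in> T" and R: "upper \<rho> R" and j: "j \<in> tops \<rho> R" and c: "c \<in> nbrs E j" "c \<noteq> parent E \<rho> j"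
  shows "parent E \<rho> c = j" "c \<noteq> \<rho>" "c \<in> tops \<rho> (insert j R)" "c \<notin> tops \<rho> R" "c \<notin> R"
proof -
  have e: "{j, c} \<in> E" using c by (simp add: nbrs_def)
  show p: "parent E \<rho> c = j" "c \<noteq> \<rho>" using edge_parent[OF \<rho> e] c(2) by auto
  have "j \<notin> R" using j by (simp add: tops_def)
  then show cR: "c \<notin> R" using R p by (auto simp: upper_def)
  show "c \<in> tops \<rho> (insert j R)" using p cR edge_in_T[OF e] by (auto simp: tops_def)
  show "c \<notin> tops \<rho> R" using p \<open>j \<notin> R\<close> by (auto simp: tops_def)
qed

end

section \<open>The branch recursion\<close>

context weighted_graph
begin

text \<open>If no edge joins \<open>A\<close> to the rest of \<open>X\<close>, deleting the mixed entries of the inverse gives an inverse again.\<close>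

lemma green_block:
  assumes X: "finite X" "A \<subseteq> X" and edge: "\<And>a b. a \<in> A \<Longrightarrow> b \<in> X - A \<Longrightarrow> w a b = 0"
    and i: "i \<in> A" and l: "l \<in> X - A"
  shows "green X \<beta> i l = 0"
proof (cases "pos_def_on X (H \<beta>)")
  case True
  let ?G = "green X \<beta>"
  let ?B = "\<lambda>i l. if (i \<in> A) = (l \<in> A) then ?G i l else 0"
  note inv = green_inverse_pair[OF X(1) True]
  have H0: "H \<beta> a b = 0" "H \<beta> b a = 0" if "a \<in> A" "b \<in> X - A" for a b
    using that edge[OF that] cond_sym[of a b] by (auto simp: H_mat_def)
  have HB: "H \<beta> i k * ?B k l = (if (i \<in> A) = (l \<in> A) then H \<beta> i k * ?G k l else 0)"
    and BH: "?B i k * H \<beta> k l = (if (i \<in> A) = (l \<in> A) then ?G i k * H \<beta> k l else 0)"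
    if "i \<in> X" "k \<in> X" "l \<in> X" for i k l
    using that H0[of i k] H0[of k i] H0[of k l] H0[of l k] by auto
  have "inverse_pair X (H \<beta>) ?B"
    unfolding inverse_pair_def
  proof (intro conjI ballI allI impI)
    fix i l assume "i \<notin> X \<or> l \<notin> X"
    then show "?B i l = 0" using inv by (auto simp: inverse_pair_def)
  next
    fix i l assume il: "i \<in> X" "l \<in> X"
    have "(\<Sum>k\<in>X. H \<beta> i k * ?B k l) = (if (i \<in> A) = (l \<in> A) then (\<Sum>k\<in>X. H \<beta> i k * ?G k l) else 0)"
      using HB[OF il(1) _ il(2)] by simp
    then show "(\<Sum>k\<in>X. H \<beta> i k * ?B k l) = (if i = l then 1 else 0)"
      using inv il by (auto simp: inverse_pair_def)
    have "(\<Sum>k\<in>X. ?B i k * H \<beta> k l) = (if (i \<in> A) = (l \<in> A) then (\<Sum>k\<in>X. ?G i k * H \<beta> k l) else 0)"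
      using BH[OF il(1) _ il(2)] by simp
    then show "(\<Sum>k\<in>X. ?B i k * H \<beta> k l) = (if i = l then 1 else 0)"
      using inv il by (auto simp: inverse_pair_def)
  qed
  then have "?G = ?B" by (rule inverse_pair_unique[OF X(1) inv])
  then have "?G i l = ?B i l" by metis
  then show ?thesis using i l by simp
qed (simp add: green_def)

lemma psi_fin_insert_update:
  assumes U: "finite U" "k \<notin> U" and P: "pos_def_on U (H \<beta>)" and y: "0 < y"
  shows "psi_fin (insert k U) \<eta> (\<beta>(k := (y + self_energy U \<beta> k) / 2)) i = psi_fin U \<eta> \<beta> i + harm_ext U \<beta> k i * eff_field U \<beta> \<eta> k / y"
proof -
  have "psi_fin (insert k U) \<eta> (\<beta>(k := (y + self_energy U \<beta> k) / 2)) i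
     = (\<Sum>l\<in>insert k U. green U \<beta> i l * \<eta> l) + harm_ext U \<beta> k i * (\<Sum>l\<in>insert k U. harm_ext U \<beta> k l * \<eta> l) / y"
    unfolding psi_fin_def green_insert_update[OF U P y] sum_distrib_left sum_divide_distrib sum.distrib[symmetric]
    by (intro sum.cong refl) (simp add: algebra_simps)
  also have "(\<Sum>l\<in>insert k U. green U \<beta> i l * \<eta> l) = psi_fin U \<eta> \<beta> i"
    using U by (simp add: psi_fin_def green_outside)
  finally show ?thesis unfolding eff_field_def .
qed

lemma eff_field_eq_psi_fin:
  assumes U: "finite U" "k \<notin> U"
  shows "eff_field U \<beta> \<eta> k = \<eta> k + (\<Sum>l\<in>U. w k l * psi_fin U \<eta> \<beta> l)"
proof -
  have "(\<Sum>i\<in>U. harm_ext U \<beta> k i * \<eta> i) = (\<Sum>i\<in>U. \<Sum>l\<in>U. green U \<beta> i l * w l k * \<eta> i)"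
    using U(2) by (intro sum.cong refl) (auto simp: harm_ext_def sum_distrib_right)
  also have "\<dots> = (\<Sum>l\<in>U. \<Sum>i\<in>U. green U \<beta> i l * w l k * \<eta> i)" by (rule sum.swap)
  also have "\<dots> = (\<Sum>l\<in>U. w k l * psi_fin U \<eta> \<beta> l)"
    unfolding psi_fin_def sum_distrib_left
    by (intro sum.cong refl) (simp add: green_sym[OF U(1), of \<beta>] cond_sym mult.commute mult.left_commute)
  finally show ?thesis using U by (simp add: eff_field_def)
qed

end

text \<open>The constant makes \<open>exp (- W / 6560)\<close> at most \<open>exp (- 40)\<close>, where \<open>1 / 6560\<close> is the exponential rate
  of the upper tail of the reciprocal inverse Gaussian law beyond \<open>1 + 1/40\<close> times its parameter.\<close>

locale tree_env = weighted_graph E W + tree_graph T E for E :: "'v set set" and W T +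
  assumes W_large: "262400 \<le> W" and degree: "i \<in> T \<Longrightarrow> 3 \<le> card (nbrs E i)"
begin

text \<open>The value that the branch rooted at \<open>f\<close> transmits upwards: the field is the boundary weight of the
  whole volume \<open>V\<close>, so that the eliminated vertices \<open>V - U\<close> contribute nothing. Vertices outside \<open>V\<close>
  carry the boundary value 1 of \<open>psi_n\<close>.\<close>

definition branch_psi :: "'v set \<Rightarrow> 'v set \<Rightarrow> 'v \<Rightarrow> ('v \<Rightarrow> real) \<Rightarrow> real" where
  "branch_psi V U f \<beta> = (if f \<in> V then psi_fin U (bw V) \<beta> f else 1)"

text \<open>How far the branch value is from the level 1/40, as a number between 0 and 1. Truncating at a small level
  keeps the recursion close to the linear one.\<close>

definition defect :: "'v set \<Rightarrow> 'v set \<Rightarrow> 'v \<Rightarrow> ('v \<Rightarrow> real) \<Rightarrow> real" where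
  "defect V U f \<beta> = 1 - min 1 (40 * branch_psi V U f \<beta>)"

lemma branch_psi_nonneg: "finite U \<Longrightarrow> 0 \<le> branch_psi V U f \<beta>"
  unfolding branch_psi_def by (auto intro!: psi_fin_nonneg bw_nonneg)

lemma defect_bounds: "finite U \<Longrightarrow> 0 \<le> defect V U f \<beta>" "finite U \<Longrightarrow> defect V U f \<beta> \<le> 1"
  using branch_psi_nonneg[of U V f \<beta>] by (auto simp: defect_def)

lemma defect_outside: "f \<notin> V \<Longrightarrow> defect V U f \<beta> = 0"
  by (simp add: defect_def branch_psi_def)

lemma measurable_defect:
  assumes "finite U" "\<And>i. i \<in> U \<Longrightarrow> (\<lambda>x. b x i) \<in> borel_measurable M"
  shows "(\<lambda>x. defect V U f (b x)) \<in> borel_measurable M"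
proof -
  have [measurable]: "(\<lambda>x. psi_fin U (bw V) (b x) f) \<in> borel_measurable M"
    using measurable_psi_fin[of U b M] assms by auto
  show ?thesis unfolding defect_def branch_psi_def by (cases "f \<in> V") auto
qed

text \<open>The branch below \<open>c\<close> can be left only through the parent of \<open>c\<close>, which is missing from \<open>X\<close>.\<close>

lemma green_branch:
  assumes \<rho>: "\<rho> \<in> T" and X: "finite X" and c: "parent E \<rho> c \<notin> X"
    and i: "i \<in> X" "desc \<rho> c i" and l: "l \<in> X" "\<not> desc \<rho> c l"
  shows "green X \<beta> i l = 0"
proof (rule green_block[of X "{v\<in>X. desc \<rho> c v}"])
  fix a b assume a: "a \<in> {v\<in>X. desc \<rho> c v}" and b: "b \<in> X - {v\<in>X. desc \<rho> c v}"
  show "w a b = 0"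
  proof (rule ccontr)
    assume "w a b \<noteq> 0"
    then have "{a, b} \<in> E" by (auto simp: cond_def split: if_splits)
    then consider "b \<noteq> \<rho>" "parent E \<rho> b = a" | "a \<noteq> \<rho>" "parent E \<rho> a = b" using edge_parent[OF \<rho>] by blast
    then show False
    proof cases
      case 1
      then have "desc \<rho> c b" using a by (auto intro: desc.child)
      then show False using b by auto
    next
      case 2
      have "desc \<rho> c a" using a by auto
      then show False using 2 b c by cases auto
    qed
  qed
qed (use X i l in auto)

context
  fixes \<rho> R V j
  assumes \<rho>: "\<rho> \<in> T" and R: "upper \<rho> R" and V: "finite V" "V \<subseteq> T" "R \<subseteq> V" and j: "j \<in> tops \<rho> R" "j \<in> V"
begin

definition "Urest = V - insert j R"

lemma Urest: "finite Urest" "j \<notin> Urest" "V - R = insert j Urest" "Urest \<inter> R = {}"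
  using V j by (auto simp: Urest_def tops_def)

lemma j_not_R: "j \<notin> R" and parent_j: "parent E \<rho> j \<in> R" and j_T: "j \<in> T" and j_not_root: "j \<noteq> \<rho>"
  using j R by (auto simp: tops_def upper_def)

lemma parent_j_edge: "{parent E \<rho> j, j} \<in> E"
  using parent_edge[OF \<rho> j_T j_not_root] .

text \<open>A top other than \<open>j\<close> lies in a different branch, hence is not connected to the children of \<open>j\<close>.\<close>

lemma harm_ext_other_top:
  assumes f: "f \<in> tops \<rho> R" "f \<in> V" "f \<noteq> j"
  shows "harm_ext Urest \<beta> j f = 0"
proof -
  have "green Urest \<beta> f l * w l j = 0" if l: "l \<in> Urest" for l
  proof (cases "{l, j} \<in> E")
    case True
    then have lj: "l \<in> nbrs E j" by (simp add: nbrs_def insert_commute)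
    have "l \<noteq> parent E \<rho> j" using parent_j l Urest(4) by auto
    note ch = tops_children[OF \<rho> R j(1) lj this]
    have "\<not> desc \<rho> f l"
    proof
      assume "desc \<rho> f l"
      then have "f = l \<or> desc \<rho> f j" using ch(1) by cases auto
      moreover have "f \<noteq> l" using ch(4) f(1) by auto
      ultimately have "desc \<rho> f j" by simp
      then have "desc \<rho> f (parent E \<rho> j)" using f(3) by cases auto
      then have "f \<in> R" using upper_desc[OF R _ parent_j] by blast
      then show False using f(1) by (simp add: tops_def)
    qed
    moreover have "f \<in> Urest" using f by (auto simp: Urest_def tops_def)
    moreover have "parent E \<rho> f \<notin> Urest" using f(1) Urest(4) by (auto simp: tops_def)
    ultimately have "green Urest \<beta> f l = 0"
      using green_branch[OF \<rho> Urest(1), of f f l] l by (auto intro: desc.self)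
    then show ?thesis by simp
  qed (simp add: cond_def)
  then have "(\<Sum>l\<in>Urest. green Urest \<beta> f l * w l j) = 0" by (rule sum.neutral[rule_format])
  then show ?thesis using f(3) by (simp add: harm_ext_def)
qed

text \<open>The parent of such a vertex \<open>i\<close> lies in \<open>R\<close>. If \<open>i\<close> were below a child of \<open>j\<close>, then that child or \<open>j\<close>
  would belong to \<open>R\<close>, since \<open>R\<close> is closed under parents.\<close>

lemma harm_ext_below:
  assumes i: "i \<in> Urest" and r: "r \<in> R" "{i, r} \<in> E"
  shows "harm_ext Urest \<beta> j i = 0"
proof -
  have "green Urest \<beta> i l * w l j = 0" if l: "l \<in> Urest" for l
  proof (cases "{l, j} \<in> E")
    case True
    then have lj: "l \<in> nbrs E j" by (simp add: nbrs_def insert_commute)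
    have "l \<noteq> parent E \<rho> j" using parent_j l Urest(4) by auto
    note ch = tops_children[OF \<rho> R j(1) lj this]
    have "\<not> desc \<rho> l i"
    proof
      assume d: "desc \<rho> l i"
      consider "r \<noteq> \<rho>" "parent E \<rho> r = i" | "i \<noteq> \<rho>" "parent E \<rho> i = r" using edge_parent[OF \<rho> r(2)] by blast
      then show False
      proof cases
        case 1
        then have "i \<in> R" using R r by (auto simp: upper_def)
        then show False using i Urest(4) by auto
      next
        case 2
        from d have "l = i \<or> desc \<rho> l r" using 2 by cases auto
        moreover have "l \<noteq> i" using ch(1) 2 r j_not_R by auto
        ultimately have "l \<in> R" using upper_desc[OF R _ r(1)] by blast
        then show False using ch(5) by simp
      qed
    qed
    moreover have "parent E \<rho> l \<notin> Urest" using ch(1) Urest(2) by simp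
    ultimately have "green Urest \<beta> l i = 0"
      using green_branch[OF \<rho> Urest(1), of l l i] l i by (auto intro: desc.self)
    then show ?thesis using green_sym[OF Urest(1), of \<beta> i l] by simp
  qed (simp add: cond_def)
  then have "(\<Sum>l\<in>Urest. green Urest \<beta> i l * w l j) = 0" by (rule sum.neutral[rule_format])
  then show ?thesis using i Urest(2) by (auto simp: harm_ext_def)
qed

lemma eff_field_source:
  "eff_field Urest \<beta> (bw V) j = W * (\<Sum>c\<in>nbrs E j - {parent E \<rho> j}. branch_psi V Urest c \<beta>)"
proof -
  let ?C = "nbrs E j - {parent E \<rho> j}"
  have fin: "finite ?C" using finite_nbrs by simp
  have wC: "w j c = W" if "c \<in> nbrs E j" for c using that by (simp add: cond_def nbrs_def)
  have "(\<Sum>l\<in>Urest. w j l * psi_fin Urest (bw V) \<beta> l) = (\<Sum>l\<in>?C \<inter> Urest. w j l * psi_fin Urest (bw V) \<beta> l)"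
  proof (rule sum.mono_neutral_right[OF Urest(1)])
    show "\<forall>i\<in>Urest - ?C \<inter> Urest. w j i * psi_fin Urest (bw V) \<beta> i = 0"
      using parent_j Urest(4) by (auto simp: cond_def nbrs_def)
  qed simp
  also have "\<dots> = (\<Sum>c\<in>?C \<inter> Urest. W * branch_psi V Urest c \<beta>)"
    by (intro sum.cong refl) (auto simp: wC branch_psi_def Urest_def)
  finally have 1: "(\<Sum>l\<in>Urest. w j l * psi_fin Urest (bw V) \<beta> l) = (\<Sum>c\<in>?C \<inter> Urest. W * branch_psi V Urest c \<beta>)" .
  have "c \<notin> insert j R" if "c \<in> ?C" for c
    using tops_children[OF \<rho> R j(1), of c] that edge_in_T(3)[of j j] by (auto simp: nbrs_def)
  then have CU: "?C - Urest = nbrs E j - V" using parent_j V(3) by (auto simp: Urest_def)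
  have 2: "bw V j = (\<Sum>c\<in>?C - Urest. W * branch_psi V Urest c \<beta>)"
    unfolding CU boundary_weight_def by (intro sum.cong refl) (auto simp: wC branch_psi_def)
  show ?thesis
    unfolding eff_field_eq_psi_fin[OF Urest(1,2)] 1 2 sum_distrib_left
    using sum.Int_Diff[OF fin, of "\<lambda>c. W * branch_psi V Urest c \<beta>" Urest] by simp
qed

text \<open>The boundary weight of \<open>V - R\<close> exceeds that of \<open>V\<close> by the edges to \<open>R\<close>. Among the vertices seen from \<open>j\<close>
  only \<open>j\<close> itself has such an edge, the one to its parent, of conductance \<open>W\<close>.\<close>

lemma eff_field_boundary:
  "eff_field Urest \<beta> (bw (V - R)) j = eff_field Urest \<beta> (bw V) j + W"
proof -
  have bwR: "bw (V - R) i = bw V i + (\<Sum>r\<in>nbrs E i \<inter> R. w i r)" for i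
  proof -
    have *: "nbrs E i - (V - R) = (nbrs E i - V) \<union> (nbrs E i \<inter> R)" using V(3) by auto
    show ?thesis unfolding boundary_weight_def *
      by (rule sum.union_disjoint) (use V(3) finite_nbrs in auto)
  qed
  have pj: "nbrs E j \<inter> R = {parent E \<rho> j}"
  proof
    show "nbrs E j \<inter> R \<subseteq> {parent E \<rho> j}"
      using tops_children(5)[OF \<rho> R j(1)] by auto
    show "{parent E \<rho> j} \<subseteq> nbrs E j \<inter> R"
      using parent_j parent_j_edge by (auto simp: nbrs_def insert_commute)
  qed
  have "harm_ext Urest \<beta> j i * (\<Sum>r\<in>nbrs E i \<inter> R. w i r) = 0" if i: "i \<in> Urest" for i
  proof (cases "nbrs E i \<inter> R = {}")
    case False
    then show ?thesis using harm_ext_below[OF i] by (auto simp: nbrs_def)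
  qed simp
  then have "(\<Sum>i\<in>Urest. harm_ext Urest \<beta> j i * (\<Sum>r\<in>nbrs E i \<inter> R. w i r)) = 0"
    by (rule sum.neutral[rule_format])
  then have "(\<Sum>i\<in>insert j Urest. harm_ext Urest \<beta> j i * (\<Sum>r\<in>nbrs E i \<inter> R. w i r)) = (\<Sum>r\<in>nbrs E j \<inter> R. w j r)"
    using Urest by simp
  also have "\<dots> = W" unfolding pj using parent_j_edge by (simp add: cond_def insert_commute)
  finally show ?thesis
    unfolding eff_field_def bwR by (simp only: distrib_left sum.distrib)
qed

lemma defect_update_other:
  assumes f: "f \<in> tops \<rho> R" "f \<noteq> j" and P: "pos_def_on Urest (H \<beta>)" and y: "0 < y"
  shows "defect V (V - R) f (\<beta>(j := (y + self_energy Urest \<beta> j) / 2)) = defect V Urest f \<beta>"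
  using psi_fin_insert_update[OF Urest(1,2) P y, of "bw V" f] harm_ext_other_top[OF f(1) _ f(2), of \<beta>]
  by (simp add: defect_def branch_psi_def Urest(3))

lemma defect_update_self:
  assumes P: "pos_def_on Urest (H \<beta>)" and y: "0 < y"
  shows "defect V (V - R) j (\<beta>(j := (y + self_energy Urest \<beta> j) / 2)) = 1 - min 1 (40 * (eff_field Urest \<beta> (bw V) j / y))"
proof -
  have "psi_fin Urest (bw V) \<beta> j = 0" using Urest by (simp add: psi_fin_def green_outside)
  then show ?thesis
    using psi_fin_insert_update[OF Urest(1,2) P y, of "bw V" j] j(2)
    by (simp add: defect_def branch_psi_def Urest(3))
qed

end

lemma exp_bound_40: "40 \<le> m \<Longrightarrow> sqrt 2 * exp (- m) \<le> 1 / 20"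
proof -
  assume m: "40 \<le> m"
  have "sqrt 2 \<le> 3 / 2" by (rule real_le_lsqrt) (auto simp: power2_eq_square)
  moreover have "exp (- m) \<le> 1 / 41"
  proof -
    have "1 + m \<le> exp m" by (rule exp_ge_add_one_self)
    then have "41 \<le> exp m" using m by linarith
    then show ?thesis by (simp add: exp_minus field_simps)
  qed
  ultimately have "sqrt 2 * exp (- m) \<le> 3 / 2 * (1 / 41)" by (intro mult_mono) auto
  then show ?thesis by simp
qed

lemma rig_upper_tail:
  assumes a: "0 \<le> a" and e: "0 < e" and big: "40 \<le> e\<^sup>2 * a / (4 * (1 + e))"
  shows "(\<integral>\<^sup>+y. ennreal (rig_density a y) * indicator {(1 + e) * a<..} y \<partial>lborel) \<le> ennreal (1 / 20)"
proof -
  have "(\<integral>\<^sup>+y. ennreal (rig_density a y) * indicator {(1 + e) * a<..} y \<partial>lborel)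
     \<le> ennreal (sqrt 2 * exp (- (e\<^sup>2 * a / (4 * (1 + e)))))"
  proof (rule nn_integral_rig_density_tail[OF a])
    fix y assume y: "y \<in> {(1 + e) * a<..}" "0 < y"
    have 1: "e * a \<le> y - a" using y by (simp add: algebra_simps)
    have ay: "a \<le> y" using 1 mult_nonneg_nonneg[of e a] a e by linarith
    have 2: "e * y / (1 + e) \<le> y - a"
    proof -
      have "e * y \<le> (1 + e) * (y - a)" using y by (simp add: algebra_simps)
      then show ?thesis using e by (simp add: field_simps)
    qed
    have "(e * a) * (e * y / (1 + e)) \<le> (y - a) * (y - a)"
      using 1 2 e a y ay by (intro mult_mono) auto
    then have "(e * a) * (e * y / (1 + e)) / (4 * y) \<le> (y - a)\<^sup>2 / (4 * y)"
      using y by (intro divide_right_mono) (auto simp: power2_eq_square)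
    also have "(e * a) * (e * y / (1 + e)) / (4 * y) = e\<^sup>2 * a / (4 * (1 + e))"
    proof -
      have "(e * a) * (e * y / s) / (4 * y) = e\<^sup>2 * a / (4 * s)" if "s \<noteq> 0" for s
        using y that by (simp add: power2_eq_square field_simps)
      then show ?thesis using e by simp
    qed
    finally show "e\<^sup>2 * a / (4 * (1 + e)) \<le> (y - a)\<^sup>2 / (4 * y)" .
  qed (use a e in auto)
  also have "\<dots> \<le> ennreal (1 / 20)" by (intro ennreal_leI exp_bound_40 big)
  finally show ?thesis .
qed

text \<open>With \<open>t\<close> the sum of the branch values truncated at 1/40, monotonicity of \<open>s / (1 + s)\<close> and \<open>t \<le> 1/20\<close>
  give \<open>S / y \<ge> t / ((1 + 1/40) (1 + 1/20))\<close>, and this is at least \<open>9/10 * t\<close>. The last step is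
  \<open>1 - min 1 (p + q) \<le> (1 - p) (1 - q)\<close>, which turns the bound into a product over the two children.\<close>

lemma one_step:
  assumes l: "0 \<le> l1" "0 \<le> l2" and S: "W * (l1 + l2) \<le> S"
    and y: "0 < y" "y \<le> (1 + 1/40) * (S + W)"
  shows "1 - min 1 (40 * (S / y)) \<le> (1/10 + 9/10 * (1 - min 1 (40 * l1))) * (1/10 + 9/10 * (1 - min 1 (40 * l2)))"
proof -
  define z1 z2 where "z1 = min 1 (40 * l1)" and "z2 = min 1 (40 * l2)"
  have z: "0 \<le> z1" "z1 \<le> 1" "0 \<le> z2" "z2 \<le> 1" "z1 \<le> 40 * l1" "z2 \<le> 40 * l2" using l by (auto simp: z1_def z2_def)
  define t where "t = (z1 + z2) / 40"
  have t: "0 \<le> t" "t \<le> 1/20" using z by (auto simp: t_def)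
  have W0: "0 < W" by (rule W_pos)
  have "W * t \<le> W * (l1 + l2)" using W0 z by (intro mult_left_mono) (auto simp: t_def)
  then have St: "W * t \<le> S" using S by linarith
  have S0: "0 \<le> S" using St t W0 by (meson mult_nonneg_nonneg less_imp_le order_trans)
  have "9/10 * (z1 + z2) * y \<le> 9/10 * (z1 + z2) * ((1 + 1/40) * (S + W))"
    using y z by (intro mult_left_mono) auto
  also have "\<dots> = 36 * t * (41/40 * (S + W))" by (simp add: t_def)
  also have "\<dots> = 36 * 41/40 * (t * S + W * t)" by (simp add: algebra_simps)
  also have "\<dots> \<le> 36 * 41/40 * (1/20 * S + S)"
    using t St S0 by (intro mult_left_mono add_mono mult_right_mono) auto
  also have "\<dots> \<le> 40 * S" using S0 by simp
  finally have "9/10 * (z1 + z2) \<le> 40 * S / y" using y by (subst pos_le_divide_eq) auto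
  then have "9/10 * (z1 + z2) \<le> 40 * (S / y)" by simp
  from min.mono[OF order_refl this, of 1]
  have "1 - min 1 (40 * (S / y)) \<le> 1 - min 1 (9/10 * (z1 + z2))" by linarith
  also have "\<dots> \<le> (1 - 9/10 * z1) * (1 - 9/10 * z2)"
  proof (cases "9/10 * (z1 + z2) \<le> 1")
    case True
    have "0 \<le> z1 * z2" using z by simp
    moreover have "(1 - 9/10 * z1) * (1 - 9/10 * z2) = 1 - 9/10 * (z1 + z2) + 81/100 * (z1 * z2)"
      by (simp add: field_simps)
    moreover have "min 1 (9/10 * (z1 + z2)) = 9/10 * (z1 + z2)" using True by simp
    ultimately show ?thesis by linarith
  next
    case False
    have "0 \<le> (1 - 9/10 * z1) * (1 - 9/10 * z2)" using z by (intro mult_nonneg_nonneg) auto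
    then show ?thesis using False by simp
  qed
  also have "\<dots> = (1/10 + 9/10 * (1 - z1)) * (1/10 + 9/10 * (1 - z2))" by (simp add: field_simps)
  finally show ?thesis by (simp add: z1_def z2_def)
qed

end

section \<open>A lower bound for the harmonic function\<close>

context tree_env
begin

lemma rig_step_integral:
  assumes l: "0 \<le> l1" "0 \<le> l2" and S: "W * (l1 + l2) \<le> S"
  shows "(\<integral>\<^sup>+y. ennreal (rig_density (S + W) y) * ennreal (1 - min 1 (40 * (S / y))) \<partial>lborel)
    \<le> ennreal (1/20 + (1/10 + 9/10 * (1 - min 1 (40 * l1))) * (1/10 + 9/10 * (1 - min 1 (40 * l2))))"
    (is "_ \<le> ennreal (_ + ?q)")
proof -
  have "0 \<le> W * (l1 + l2)" using l W_pos by simp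
  then have S0: "0 \<le> S" using S by linarith
  have a0: "0 \<le> S + W" using S0 W_pos by simp
  have q0: "0 \<le> ?q" by (intro mult_nonneg_nonneg add_nonneg_nonneg) auto
  have *: "ennreal (rig_density (S + W) y) * ennreal (1 - min 1 (40 * (S / y)))
     \<le> ennreal ?q * ennreal (rig_density (S + W) y) + ennreal (rig_density (S + W) y) * indicator {(1 + 1/40) * (S + W)<..} y" for y
  proof (cases "0 < y")
    case y: True
    show ?thesis
    proof (cases "y \<le> (1 + 1/40) * (S + W)")
      case True
      have "ennreal (rig_density (S + W) y) * ennreal (1 - min 1 (40 * (S / y))) \<le> ennreal (rig_density (S + W) y) * ennreal ?q"
        by (intro mult_left_mono ennreal_leI one_step[OF l S y True]) simp
      then show ?thesis by (simp add: mult.commute add_increasing2)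
    next
      case False
      have "0 \<le> S / y" using S0 y by simp
      then have "ennreal (1 - min 1 (40 * (S / y))) \<le> ennreal 1" by (intro ennreal_leI) simp
      then have "ennreal (rig_density (S + W) y) * ennreal (1 - min 1 (40 * (S / y))) \<le> ennreal (rig_density (S + W) y) * 1"
        by (intro mult_left_mono) simp_all
      then show ?thesis using False by (simp add: add_increasing)
    qed
  qed (simp add: rig_density_def)
  have "(\<integral>\<^sup>+y. ennreal (rig_density (S + W) y) * ennreal (1 - min 1 (40 * (S / y))) \<partial>lborel)
     \<le> (\<integral>\<^sup>+y. ennreal ?q * ennreal (rig_density (S + W) y) + ennreal (rig_density (S + W) y) * indicator {(1 + 1/40) * (S + W)<..} y \<partial>lborel)"
    by (intro nn_integral_mono *)
  also have "\<dots> = ennreal ?q * (\<integral>\<^sup>+y. ennreal (rig_density (S + W) y) \<partial>lborel)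
      + (\<integral>\<^sup>+y. ennreal (rig_density (S + W) y) * indicator {(1 + 1/40) * (S + W)<..} y \<partial>lborel)"
    by (simp add: nn_integral_add nn_integral_cmult)
  also have "\<dots> \<le> ennreal ?q * 1 + ennreal (1/20)"
  proof (intro add_mono mult_left_mono)
    show "(\<integral>\<^sup>+y. ennreal (rig_density (S + W) y) \<partial>lborel) \<le> 1" using nn_integral_rig_density[OF a0] by simp
    show "(\<integral>\<^sup>+y. ennreal (rig_density (S + W) y) * indicator {(1 + 1/40) * (S + W)<..} y \<partial>lborel) \<le> ennreal (1/20)"
      using W_large S0 by (intro rig_upper_tail[OF a0]) (auto simp: power2_eq_square)
  qed simp
  also have "\<dots> = ennreal (1/20 + ?q)" using q0 by (simp add: ennreal_plus[symmetric] add.commute del: ennreal_plus)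
  finally show ?thesis .
qed

lemma ennreal_plus4:
  "0 \<le> a \<Longrightarrow> 0 \<le> b \<Longrightarrow> 0 \<le> c \<Longrightarrow> 0 \<le> d \<Longrightarrow>
    ennreal (a + (b + (c + d))) = ennreal a + (ennreal b + (ennreal c + ennreal d))"
  by simp

text \<open>Eliminating a top \<open>j\<close> replaces its defect, after averaging over the Schur complement at \<open>j\<close>, by at most
  \<open>1/20 + (1/10 + 9/10 u\<^sub>1) (1/10 + 9/10 u\<^sub>2)\<close> with the defects \<open>u\<^sub>1, u\<^sub>2\<close> of two children. Expanding the product
  gives expectations of the same form over a smaller set, and
  \<open>1/20 + (1/10 + 9/10 * 1/10)\<^sup>2 \<le> 1/10\<close>. Treating products over sets of tops takes the place of an
  independence argument for the branches.\<close>

lemma prod_defect_integral: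
  assumes \<rho>: "\<rho> \<in> T" and V: "finite V" "V \<subseteq> T"
  shows "upper \<rho> R \<Longrightarrow> R \<subseteq> V \<Longrightarrow> finite F \<Longrightarrow> F \<subseteq> tops \<rho> R \<Longrightarrow>
    (\<integral>\<^sup>+\<beta>. ennreal (\<Prod>f\<in>F. defect V (V - R) f \<beta>) \<partial>nuF (V - R)) \<le> ennreal ((1/10) ^ card F)"
proof (induction "card (V - R)" arbitrary: R F rule: less_induct)
  case less
  note R = less.prems(1,2) and F = less.prems(3,4)
  have finU: "finite (V - R)" using V by simp
  interpret VR: prob_space "nuF (V - R)" by (rule prob_space_nuF[OF finU])
  consider "F = {}" | f where "f \<in> F" "f \<notin> V" | j where "j \<in> F" "F \<subseteq> V" by blast
  then show ?case
  proof cases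
    case 1
    then show ?thesis using VR.emeasure_space_1 by simp
  next
    case (2 f)
    then have "(\<Prod>f\<in>F. defect V (V - R) f \<beta>) = 0" for \<beta>
      using F(1) defect_outside[of f V "V - R" \<beta>] by (intro prod_zero) auto
    then show ?thesis by simp
  next
    case (3 j)
    define F' where "F' = F - {j}"
    define U where "U = V - insert j R"
    have j: "j \<in> tops \<rho> R" "j \<in> V" using 3 F by auto
    have F': "finite F'" "F = insert j F'" "j \<notin> F'" "F' \<subseteq> tops \<rho> R" using 3 F by (auto simp: F'_def)
    note ctx = \<rho> R(1) V R(2) j
    have U: "finite U" "j \<notin> U" "V - R = insert j U" using j V by (auto simp: U_def tops_def)
    interpret U: prob_space "nuF U" by (rule prob_space_nuF[OF U(1)])
    let ?C = "nbrs E j - {parent E \<rho> j}"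
    have "2 \<le> card ?C"
      using degree[of j] j V card_Diff_subset[of "{parent E \<rho> j}" "nbrs E j"] finite_nbrs
      by (cases "parent E \<rho> j \<in> nbrs E j") auto
    then obtain C' where "C' \<subseteq> ?C" "card C' = 2" using obtain_subset_with_card_n by metis
    then obtain c1 c2 where c: "c1 \<in> ?C" "c2 \<in> ?C" "c1 \<noteq> c2" by (auto simp: card_2_iff)
    have ct: "c1 \<in> tops \<rho> (insert j R)" "c2 \<in> tops \<rho> (insert j R)" "c1 \<notin> F'" "c2 \<notin> F'"
      using tops_children(3,4)[OF \<rho> R(1) j(1)] c F'(4) by auto
    have F'tops: "F' \<subseteq> tops \<rho> (insert j R)"
      using tops_insert[OF j(1)] F'(3,4) by blast
    have IH: "(\<integral>\<^sup>+\<beta>. ennreal (\<Prod>f\<in>X. defect V U f \<beta>) \<partial>nuF U) \<le> ennreal ((1/10) ^ card X)"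
      if X: "finite X" "X \<subseteq> tops \<rho> (insert j R)" for X
    proof -
      have "card (V - insert j R) < card (V - R)"
        using U j by (simp add: U_def[symmetric])
      moreover have "insert j R \<subseteq> V" using R(2) j by simp
      ultimately show ?thesis
        unfolding U_def using less.hyps[OF _ upper_insert[OF R(1) j(1)] _ X] by blast
    qed
    have mu: "(\<lambda>\<beta>. defect V X f \<beta>) \<in> borel_measurable (PiL X)" if "finite X" for X f
      by (rule measurable_defect[OF that]) (rule PiL_component)
    have mP: "(\<lambda>\<beta>. \<Prod>f\<in>Y. defect V X f \<beta>) \<in> borel_measurable (PiL X)" if "finite X" for X Y
      using mu[OF that] by (intro borel_measurable_prod)
    let ?P = "\<lambda>Y \<beta>. \<Prod>f\<in>Y. defect V U f \<beta>"
    have P0: "0 \<le> ?P Y \<beta>" for Y \<beta> using defect_bounds[OF U(1)] by (intro prod_nonneg) auto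
    have "(\<integral>\<^sup>+\<beta>. ennreal (\<Prod>f\<in>F. defect V (V - R) f \<beta>) \<partial>nuF (V - R))
      = (\<integral>\<^sup>+\<beta>. (\<integral>\<^sup>+y. ennreal (rig_density (eff_field U \<beta> (bw (V - R)) j) y) *
           ennreal (\<Prod>f\<in>F. defect V (V - R) f (\<beta>(j := (y + self_energy U \<beta> j) / 2))) \<partial>lborel) \<partial>nuF U)"
      using nn_integral_nu_insert[OF U(1,2), of "\<lambda>\<beta>. ennreal (\<Prod>f\<in>F. defect V (V - R) f \<beta>)" "bw (V - R)"] mP[OF finU, of F]
      unfolding U(3)[symmetric] nuF_insert[OF U(2,1), unfolded U(3)[symmetric]] by simp
    also have "\<dots> \<le> (\<integral>\<^sup>+\<beta>. ennreal (6/100 * ?P F' \<beta>) + (ennreal (9/100 * ?P (insert c1 F') \<beta>)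
         + (ennreal (9/100 * ?P (insert c2 F') \<beta>) + ennreal (81/100 * ?P (insert c1 (insert c2 F')) \<beta>))) \<partial>nuF U)"
    proof (rule nn_integral_mono_AE)
      show "AE \<beta> in nuF U. (\<integral>\<^sup>+y. ennreal (rig_density (eff_field U \<beta> (bw (V - R)) j) y) *
           ennreal (\<Prod>f\<in>F. defect V (V - R) f (\<beta>(j := (y + self_energy U \<beta> j) / 2))) \<partial>lborel)
        \<le> ennreal (6/100 * ?P F' \<beta>) + (ennreal (9/100 * ?P (insert c1 F') \<beta>)
         + (ennreal (9/100 * ?P (insert c2 F') \<beta>) + ennreal (81/100 * ?P (insert c1 (insert c2 F')) \<beta>)))"
        using AE_nu_fin_pos_def[OF U(1)]
      proof eventually_elim
        case (elim \<beta>)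
        define S where "S = eff_field U \<beta> (bw V) j"
        have a: "eff_field U \<beta> (bw (V - R)) j = S + W"
          using eff_field_boundary[OF ctx] unfolding Urest_def[OF ctx] U_def[symmetric] S_def .
        have SC: "S = W * (\<Sum>c\<in>?C. branch_psi V U c \<beta>)"
          using eff_field_source[OF ctx] unfolding Urest_def[OF ctx] U_def[symmetric] S_def .
        have "branch_psi V U c1 \<beta> + branch_psi V U c2 \<beta> \<le> (\<Sum>c\<in>?C. branch_psi V U c \<beta>)"
          using c finite_nbrs branch_psi_nonneg[OF U(1)] sum_mono2[of ?C "{c1, c2}" "\<lambda>c. branch_psi V U c \<beta>"] by auto
        then have SW: "W * (branch_psi V U c1 \<beta> + branch_psi V U c2 \<beta>) \<le> S" unfolding SC using W_pos by simp
        let ?u1 = "defect V U c1 \<beta>" and ?u2 = "defect V U c2 \<beta>"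
        have pt: "ennreal (rig_density (S + W) y) * ennreal (\<Prod>f\<in>F. defect V (V - R) f (\<beta>(j := (y + self_energy U \<beta> j) / 2)))
           = ennreal (?P F' \<beta>) * (ennreal (rig_density (S + W) y) * ennreal (1 - min 1 (40 * (S / y))))" for y
        proof (cases "0 < y")
          case True
          have s: "defect V (V - R) j (\<beta>(j := (y + self_energy U \<beta> j) / 2)) = 1 - min 1 (40 * (S / y))"
            using defect_update_self[OF ctx] elim True unfolding Urest_def[OF ctx] U_def[symmetric] S_def by blast
          have o: "defect V (V - R) f (\<beta>(j := (y + self_energy U \<beta> j) / 2)) = defect V U f \<beta>" if "f \<in> F'" for f
            using defect_update_other[OF ctx, of f] that F'(3,4) elim True unfolding Urest_def[OF ctx] U_def[symmetric] by blast
          have "(\<Prod>f\<in>F. defect V (V - R) f (\<beta>(j := (y + self_energy U \<beta> j) / 2))) = (1 - min 1 (40 * (S / y))) * ?P F' \<beta>"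
          proof -
            have "(\<Prod>f\<in>F'. defect V (V - R) f (\<beta>(j := (y + self_energy U \<beta> j) / 2))) = ?P F' \<beta>"
              by (intro prod.cong refl o)
            then show ?thesis unfolding F'(2) prod.insert[OF F'(1,3)] s by (rule arg_cong)
          qed
          then show ?thesis using P0[of \<beta> F'] by (simp add: ennreal_mult ac_simps)
        qed (simp add: rig_density_def)
        have mm: "(\<lambda>y. ennreal (rig_density (S + W) y) * ennreal (1 - min 1 (40 * (S / y)))) \<in> borel_measurable lborel"
          by measurable
        have "(\<integral>\<^sup>+y. ennreal (rig_density (eff_field U \<beta> (bw (V - R)) j) y) *
           ennreal (\<Prod>f\<in>F. defect V (V - R) f (\<beta>(j := (y + self_energy U \<beta> j) / 2))) \<partial>lborel)
          = ennreal (?P F' \<beta>) * (\<integral>\<^sup>+y. ennreal (rig_density (S + W) y) * ennreal (1 - min 1 (40 * (S / y))) \<partial>lborel)"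
          unfolding a pt by (rule nn_integral_cmult[OF mm])
        also have "\<dots> \<le> ennreal (?P F' \<beta>) * ennreal (1/20 + (1/10 + 9/10 * ?u1) * (1/10 + 9/10 * ?u2))"
          unfolding defect_def[of V U c1] defect_def[of V U c2]
          by (intro mult_left_mono rig_step_integral[OF _ _ SW] branch_psi_nonneg U) simp
        also have "\<dots> = ennreal (?P F' \<beta> * (1/20 + (1/10 + 9/10 * ?u1) * (1/10 + 9/10 * ?u2)))"
          using P0[of \<beta> F'] by (simp add: ennreal_mult')
        also have "?P F' \<beta> * (1/20 + (1/10 + 9/10 * ?u1) * (1/10 + 9/10 * ?u2))
          = 6/100 * ?P F' \<beta> + (9/100 * ?P (insert c1 F') \<beta> + (9/100 * ?P (insert c2 F') \<beta> + 81/100 * ?P (insert c1 (insert c2 F')) \<beta>))"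
          using F'(1) ct(3,4) c(3) by (simp add: field_simps)
        also have "ennreal \<dots> = ennreal (6/100 * ?P F' \<beta>) + (ennreal (9/100 * ?P (insert c1 F') \<beta>)
         + (ennreal (9/100 * ?P (insert c2 F') \<beta>) + ennreal (81/100 * ?P (insert c1 (insert c2 F')) \<beta>)))"
          by (rule ennreal_plus4) (intro mult_nonneg_nonneg P0, simp)+
        finally show ?case .
      qed
    qed
    also have "\<dots> = (\<integral>\<^sup>+\<beta>. ennreal (6/100 * ?P F' \<beta>) \<partial>nuF U) + ((\<integral>\<^sup>+\<beta>. ennreal (9/100 * ?P (insert c1 F') \<beta>) \<partial>nuF U)
         + ((\<integral>\<^sup>+\<beta>. ennreal (9/100 * ?P (insert c2 F') \<beta>) \<partial>nuF U) + (\<integral>\<^sup>+\<beta>. ennreal (81/100 * ?P (insert c1 (insert c2 F')) \<beta>) \<partial>nuF U)))"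
    proof -
      have [measurable]: "?P Y \<in> borel_measurable (nuF U)" for Y using mP[OF U(1), of Y] by simp
      show ?thesis by (subst nn_integral_add; (measurable | subst nn_integral_add | simp))+
    qed
    also have "\<dots> \<le> ennreal (6/100 * (1/10) ^ card F') + (ennreal (9/100 * (1/10) ^ Suc (card F'))
         + (ennreal (9/100 * (1/10) ^ Suc (card F')) + ennreal (81/100 * (1/10) ^ Suc (Suc (card F')))))"
    proof -
      have sc: "(\<integral>\<^sup>+\<beta>. ennreal (k * ?P Y \<beta>) \<partial>nuF U) \<le> ennreal (k * (1/10) ^ n)"
        if "0 \<le> k" "finite Y" "Y \<subseteq> tops \<rho> (insert j R)" "card Y = n" for k Y n
      proof -
        have "(\<integral>\<^sup>+\<beta>. ennreal (k * ?P Y \<beta>) \<partial>nuF U) = ennreal k * (\<integral>\<^sup>+\<beta>. ennreal (?P Y \<beta>) \<partial>nuF U)"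
          using mP[OF U(1), of Y] that(1) by (subst nn_integral_cmult[symmetric]) (auto simp: ennreal_mult')
        also have "\<dots> \<le> ennreal k * ennreal ((1/10) ^ n)"
          using IH[OF that(2,3)] that(4) by (intro mult_left_mono) auto
        finally show ?thesis using that(1) by (simp add: ennreal_mult')
      qed
      show ?thesis
        using F'(1) F'tops ct c(3) by (intro add_mono sc) auto
    qed
    also have "\<dots> = ennreal (6/100 * (1/10) ^ card F' + (9/100 * (1/10) ^ Suc (card F')
         + (9/100 * (1/10) ^ Suc (card F') + 81/100 * (1/10) ^ Suc (Suc (card F')))))"
      by (simp add: ennreal_plus[symmetric] del: ennreal_plus)
    also have "\<dots> \<le> ennreal ((1/10) ^ Suc (card F'))"
    proof (rule ennreal_leI)
      have "0 \<le> (1/10 :: real) ^ card F'" by simp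
      then show "6/100 * (1/10) ^ card F' + (9/100 * (1/10) ^ Suc (card F')
         + (9/100 * (1/10) ^ Suc (card F') + 81/100 * (1/10) ^ Suc (Suc (card F')))) \<le> (1/10 :: real) ^ Suc (card F')"
        unfolding power_Suc by linarith
    qed
    finally show ?thesis using F' by simp
  qed
qed

text \<open>At the root \<open>\<psi> = a / y\<close> where \<open>a\<close> is at least \<open>W\<close> times one branch value. If the defect of that branch
  is at most 1/2, which fails with probability at most \<open>2 * 1/10\<close>, then \<open>a \<ge> W / 80\<close> and \<open>y \<le> 2 a\<close> up to
  probability 1/20.\<close>

lemma psi_small_unlikely:
  assumes \<rho>: "\<rho> \<in> V" and V: "finite V" "V \<subseteq> T"
  shows "emeasure (nuF V) {\<beta>\<in>space (nuF V). psi_fin V (bw V) \<beta> \<rho> < 1/2} \<le> ennreal (1/4)"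
proof -
  have \<rho>T: "\<rho> \<in> T" using \<rho> V by auto
  define U where "U = V - {\<rho>}"
  have U: "finite U" "\<rho> \<notin> U" "V = insert \<rho> U" using \<rho> V by (auto simp: U_def)
  interpret U: prob_space "nuF U" by (rule prob_space_nuF[OF U(1)])
  have "nbrs E \<rho> \<noteq> {}" using degree[OF \<rho>T] by auto
  then obtain c where c: "c \<in> nbrs E \<rho>" by blast
  then have e: "{\<rho>, c} \<in> E" by (simp add: nbrs_def)
  have wc: "w \<rho> c = W" using e by (simp add: cond_def)
  have up: "upper \<rho> {\<rho>}" by (simp add: upper_def)
  have c\<rho>: "c \<noteq> \<rho>" using edge_in_T(3)[OF e] by simp
  have "parent E \<rho> c = \<rho>" using edge_parent[OF \<rho>T e] by auto
  then have ct: "c \<in> tops \<rho> {\<rho>}" using edge_in_T(2)[OF e] c\<rho> by (simp add: tops_def)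
  have core: "(\<integral>\<^sup>+\<beta>. ennreal (defect V U c \<beta>) \<partial>nuF U) \<le> ennreal (1/10)"
    using prod_defect_integral[OF \<rho>T V up, of "{c}"] ct \<rho> by (simp add: U_def)
  let ?A = "{\<beta>\<in>space (PiL V). psi_fin V (bw V) \<beta> \<rho> < 1/2}"
  have "(\<lambda>\<beta>. psi_fin V (bw V) \<beta> \<rho>) \<in> borel_measurable (PiL V)"
    by (rule measurable_psi_fin[OF V(1)]) (rule PiL_component)
  then have A: "?A \<in> sets (PiL V)" by measurable
  have mu [measurable]: "(\<lambda>\<beta>. defect V U c \<beta>) \<in> borel_measurable (PiL U)"
    by (rule measurable_defect[OF U(1)]) (rule PiL_component)
  have "emeasure (nuF V) {\<beta>\<in>space (nuF V). psi_fin V (bw V) \<beta> \<rho> < 1/2} = (\<integral>\<^sup>+\<beta>. indicator ?A \<beta> \<partial>nuF V)"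
    using A by simp
  also have "\<dots> = (\<integral>\<^sup>+\<beta>. (\<integral>\<^sup>+y. ennreal (rig_density (eff_field U \<beta> (bw V) \<rho>) y) * indicator ?A (\<beta>(\<rho> := (y + self_energy U \<beta> \<rho>) / 2)) \<partial>lborel) \<partial>nuF U)"
    using nn_integral_nu_insert[OF U(1,2), of "indicator ?A" "bw V"] A
    unfolding U(3)[symmetric] nuF_insert[OF U(2,1), unfolded U(3)[symmetric]] by simp
  also have "\<dots> \<le> (\<integral>\<^sup>+\<beta>. ennreal (1/20) + 2 * ennreal (defect V U c \<beta>) \<partial>nuF U)"
  proof (rule nn_integral_mono_AE)
    show "AE \<beta> in nuF U. (\<integral>\<^sup>+y. ennreal (rig_density (eff_field U \<beta> (bw V) \<rho>) y) * indicator ?A (\<beta>(\<rho> := (y + self_energy U \<beta> \<rho>) / 2)) \<partial>lborel)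
        \<le> ennreal (1/20) + 2 * ennreal (defect V U c \<beta>)"
      using AE_nu_fin_pos_def[OF U(1)]
    proof eventually_elim
      case (elim \<beta>)
      define a where "a = eff_field U \<beta> (bw V) \<rho>"
      have a0: "0 \<le> a" unfolding a_def by (rule eff_field_nonneg[OF U(1) bw_nonneg])
      have psn: "0 \<le> w \<rho> l * psi_fin U (bw V) \<beta> l" for l
        by (intro mult_nonneg_nonneg cond_nonneg psi_fin_nonneg U bw_nonneg)
      have aW: "W * branch_psi V U c \<beta> \<le> a"
      proof (cases "c \<in> V")
        case True
        then have "c \<in> U" using c\<rho> by (simp add: U_def)
        then have "w \<rho> c * psi_fin U (bw V) \<beta> c \<le> (\<Sum>l\<in>U. w \<rho> l * psi_fin U (bw V) \<beta> l)"
          using psn U(1) by (intro member_le_sum) auto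
        then show ?thesis unfolding a_def eff_field_eq_psi_fin[OF U(1,2)]
          using True wc bw_nonneg[of V \<rho>] by (simp add: branch_psi_def)
      next
        case False
        have "w \<rho> c \<le> bw V \<rho>" unfolding boundary_weight_def
          using False c finite_nbrs cond_nonneg by (intro member_le_sum) auto
        moreover have "0 \<le> (\<Sum>l\<in>U. w \<rho> l * psi_fin U (bw V) \<beta> l)" by (intro sum_nonneg psn)
        ultimately show ?thesis unfolding a_def eff_field_eq_psi_fin[OF U(1,2)]
          using False wc by (simp add: branch_psi_def)
      qed
      have psi0: "psi_fin U (bw V) \<beta> \<rho> = 0" using U by (simp add: psi_fin_def green_outside)
      have pt: "ennreal (rig_density a y) * indicator ?A (\<beta>(\<rho> := (y + self_energy U \<beta> \<rho>) / 2))
          \<le> ennreal (rig_density a y) * indicator {(1 + 1) * a<..} y" for y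
      proof (cases "0 < y")
        case True
        have "psi_fin V (bw V) (\<beta>(\<rho> := (y + self_energy U \<beta> \<rho>) / 2)) \<rho> = a / y"
          using psi_fin_insert_update[OF U(1,2) elim True, of "bw V" \<rho>] psi0
          unfolding U(3)[symmetric] by (simp add: a_def)
        moreover have "(1 + 1) * a < y" if "a / y < 1/2" using that True by (simp add: field_simps)
        ultimately show ?thesis by (auto intro!: mult_left_mono split: split_indicator)
      qed (simp add: rig_density_def)
      have "(\<integral>\<^sup>+y. ennreal (rig_density a y) * indicator ?A (\<beta>(\<rho> := (y + self_energy U \<beta> \<rho>) / 2)) \<partial>lborel)
        \<le> (\<integral>\<^sup>+y. ennreal (rig_density a y) * indicator {(1 + 1) * a<..} y \<partial>lborel)"
        by (intro nn_integral_mono pt)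
      also have "\<dots> \<le> ennreal (1/20) + 2 * ennreal (defect V U c \<beta>)"
      proof (cases "defect V U c \<beta> \<le> 1/2")
        case True
        then have "1/80 \<le> branch_psi V U c \<beta>" by (simp add: defect_def min_def split: if_splits)
        then have "W * (1/80) \<le> W * branch_psi V U c \<beta>" using W_pos by (intro mult_left_mono) auto
        then have "W / 80 \<le> a" using aW by simp
        then have "(\<integral>\<^sup>+y. ennreal (rig_density a y) * indicator {(1 + 1) * a<..} y \<partial>lborel) \<le> ennreal (1/20)"
          using W_large by (intro rig_upper_tail a0) auto
        then show ?thesis by (simp add: add_increasing2)
      next
        case False
        have "(\<integral>\<^sup>+y. ennreal (rig_density a y) * indicator {(1 + 1) * a<..} y \<partial>lborel) \<le> (\<integral>\<^sup>+y. ennreal (rig_density a y) \<partial>lborel)"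
          by (intro nn_integral_mono) (auto split: split_indicator)
        also have "\<dots> = ennreal 1" using nn_integral_rig_density[OF a0] by simp
        also have "\<dots> \<le> ennreal (2 * defect V U c \<beta>)" using False by (intro ennreal_leI) simp
        also have "\<dots> = 2 * ennreal (defect V U c \<beta>)" by (simp add: ennreal_mult')
        finally show ?thesis by (simp add: add_increasing)
      qed
      finally show ?case by (simp only: a_def)
    qed
  qed
  also have "\<dots> = ennreal (1/20) + 2 * (\<integral>\<^sup>+\<beta>. ennreal (defect V U c \<beta>) \<partial>nuF U)"
    using mu U.emeasure_space_1 by (simp add: nn_integral_add nn_integral_cmult)
  also have "\<dots> \<le> ennreal (1/20) + 2 * ennreal (1/10)"
    using core by (intro add_left_mono mult_left_mono) auto
  also have "\<dots> = ennreal (1/20 + 2 * (1/10))"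
  proof -
    have "2 * ennreal (1/10) = ennreal (2 * (1/10))" by (subst ennreal_mult') auto
    then show ?thesis by (simp only:) (subst ennreal_plus, auto)
  qed
  also have "\<dots> = ennreal (1/4)" by simp
  finally show ?thesis .
qed

end

section \<open>Separating the two environments\<close>

text \<open>Environments with a vanishing rate are included because the telescoping of Green function ratios breaks down there; the independent environment has
  none almost surely.\<close>

definition undecayed :: "('v \<times> 'v) set \<Rightarrow> real \<Rightarrow> 'v list \<Rightarrow> nat \<Rightarrow> real \<Rightarrow> ('v \<times> 'v \<Rightarrow> real) set" where
  "undecayed D W xs n e = {r\<in>space (\<Pi>\<^sub>M e\<in>D. borel).
     e \<le> (\<Prod>k<n. 2 / W * r (xs ! k, xs ! Suc k)) \<or> (\<exists>k<n. r (xs ! k, xs ! Suc k) = 0)}"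

lemma undecayed_sets:
  assumes "\<And>k. k < n \<Longrightarrow> (xs ! k, xs ! Suc k) \<in> D"
  shows "undecayed D W xs n e \<in> sets (\<Pi>\<^sub>M e\<in>D. borel)"
proof -
  have m: "(\<lambda>r. r (xs ! k, xs ! Suc k)) \<in> borel_measurable (\<Pi>\<^sub>M e\<in>D. (borel :: real measure))" if "k < n" for k
    using measurable_component_singleton[OF assms[OF that], of "\<lambda>_. borel :: real measure"] .
  have [measurable]: "(\<lambda>r. \<Prod>k<n. 2 / W * r (xs ! k, xs ! Suc k)) \<in> borel_measurable (\<Pi>\<^sub>M e\<in>D. (borel :: real measure))"
    using m by (intro borel_measurable_prod borel_measurable_times) auto
  have [measurable]: "Measurable.pred (\<Pi>\<^sub>M e\<in>D. (borel :: real measure)) (\<lambda>r. \<exists>k\<in>{..<n}. r (xs ! k, xs ! Suc k) = 0)"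
  proof (rule pred_intros_finite(4))
    fix k assume "k \<in> {..<n}"
    then have [measurable]: "(\<lambda>r. r (xs ! k, xs ! Suc k)) \<in> borel_measurable (\<Pi>\<^sub>M e\<in>D. (borel :: real measure))" using m by simp
    show "Measurable.pred (\<Pi>\<^sub>M e\<in>D. (borel :: real measure)) (\<lambda>r. r (xs ! k, xs ! Suc k) = 0)" by measurable
  qed simp
  have "undecayed D W xs n e = {r\<in>space (\<Pi>\<^sub>M e\<in>D. borel).
     e \<le> (\<Prod>k<n. 2 / W * r (xs ! k, xs ! Suc k)) \<or> (\<exists>k\<in>{..<n}. r (xs ! k, xs ! Suc k) = 0)}"
    by (auto simp: undecayed_def)
  also have "\<dots> \<in> sets (\<Pi>\<^sub>M e\<in>D. borel)" by measurable
  finally show ?thesis .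
qed

lemma nn_integral_prod_inv_gauss:
  assumes W: "0 < W" and J: "finite J" "J \<subseteq> I" and f: "f \<in> borel_measurable borel"
  shows "(\<integral>\<^sup>+A. (\<Prod>j\<in>J. f (A j)) \<partial>(\<Pi>\<^sub>M i\<in>I. inv_gauss W)) = (\<integral>\<^sup>+s. f s \<partial>inv_gauss W) ^ card J"
proof -
  have fm: "f \<in> borel_measurable (inv_gauss W)" using f by simp
  interpret product_prob_space "\<lambda>_. inv_gauss W" I
    by (rule product_prob_spaceI) (rule prob_space_inv_gauss[OF W])
  have m: "(\<lambda>A. \<Prod>j\<in>J. f (A j)) \<in> borel_measurable (\<Pi>\<^sub>M i\<in>J. inv_gauss W)"
  proof (rule borel_measurable_prod_ennreal)
    fix j assume "j \<in> J"
    then have "(\<lambda>A. A j) \<in> (\<Pi>\<^sub>M i\<in>J. inv_gauss W) \<rightarrow>\<^sub>M inv_gauss W" by (rule measurable_component_singleton)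
    then show "(\<lambda>A. f (A j)) \<in> borel_measurable (\<Pi>\<^sub>M i\<in>J. inv_gauss W)"
      by (rule measurable_compose) (rule fm)
  qed
  have r: "(\<lambda>A. restrict A J) \<in> (\<Pi>\<^sub>M i\<in>I. inv_gauss W) \<rightarrow>\<^sub>M (\<Pi>\<^sub>M i\<in>J. inv_gauss W)"
    by (rule measurable_restrict_subset[OF J(2)])
  have "(\<integral>\<^sup>+A. (\<Prod>j\<in>J. f (A j)) \<partial>(\<Pi>\<^sub>M i\<in>J. inv_gauss W))
      = (\<integral>\<^sup>+A. (\<Prod>j\<in>J. f (A j)) \<partial>distr (\<Pi>\<^sub>M i\<in>I. inv_gauss W) (\<Pi>\<^sub>M i\<in>J. inv_gauss W) (\<lambda>A. restrict A J))"
    by (simp only: distr_PiM_restrict_finite[OF J])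
  also have "\<dots> = (\<integral>\<^sup>+A. (\<Prod>j\<in>J. f (restrict A J j)) \<partial>(\<Pi>\<^sub>M i\<in>I. inv_gauss W))"
    by (rule nn_integral_distr[OF r]) (simp add: m)
  also have "\<dots> = (\<integral>\<^sup>+A. (\<Prod>j\<in>J. f (A j)) \<partial>(\<Pi>\<^sub>M i\<in>I. inv_gauss W))"
    by (intro nn_integral_cong prod.cong refl) simp
  also have "(\<integral>\<^sup>+A. (\<Prod>j\<in>J. f (A j)) \<partial>(\<Pi>\<^sub>M i\<in>J. inv_gauss W)) = (\<Prod>j\<in>J. (\<integral>\<^sup>+s. f s \<partial>inv_gauss W))"
    using product_nn_integral_prod[OF J(1), of "\<lambda>_. f"] fm by blast
  finally show ?thesis by simp
qed

lemma ind_rates_measurable: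
  "ind_rates E \<phi> W \<in> (\<Pi>\<^sub>M i\<in>I. inv_gauss W) \<rightarrow>\<^sub>M (\<Pi>\<^sub>M e\<in>darts E. borel)"
proof -
  have c: "(\<lambda>A. A i) \<in> borel_measurable (\<Pi>\<^sub>M i\<in>I. inv_gauss W)" for i
  proof (cases "i \<in> I")
    case True
    then show ?thesis using measurable_component_singleton[OF True, of "\<lambda>_. inv_gauss W"] by simp
  next
    case False
    then have "(\<lambda>A. A i) \<in> borel_measurable (\<Pi>\<^sub>M i\<in>I. inv_gauss W)
        \<longleftrightarrow> (\<lambda>A. undefined :: real) \<in> borel_measurable (\<Pi>\<^sub>M i\<in>I. inv_gauss W)"
      by (intro measurable_cong) (auto simp: space_PiM PiE_def extensional_def)
    then show ?thesis by simp
  qed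
  note [measurable] = c
  have "(\<lambda>A. \<lambda>e\<in>darts E. case e of (i, j) \<Rightarrow> if j \<noteq> \<phi> \<and> i = parent E \<phi> j then 1/2 * W * A j else 1/2 * W / A i)
     \<in> (\<Pi>\<^sub>M i\<in>I. inv_gauss W) \<rightarrow>\<^sub>M (\<Pi>\<^sub>M e\<in>darts E. borel)"
  proof (rule measurable_restrict)
    fix e :: "'a \<times> 'a" assume "e \<in> darts E"
    show "(\<lambda>A. case e of (i, j) \<Rightarrow> if j \<noteq> \<phi> \<and> i = parent E \<phi> j then 1/2 * W * A j else 1/2 * W / A i)
      \<in> borel_measurable (\<Pi>\<^sub>M i\<in>I. inv_gauss W)"
      by (cases e) (simp, measurable)
  qed
  then show ?thesis by (simp add: ind_rates_def[abs_def])
qed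

text \<open>Markov's inequality for the square root of the product of independent variables.\<close>

lemma (in tree_graph) R_ind_undecayed:
  assumes W: "0 < W" and \<phi>: "\<phi> \<in> T" and xs: "walk E xs" "distinct xs" "hd xs = \<phi>" "set xs \<subseteq> T" "length xs = Suc n"
    and e: "0 < e"
  shows "emeasure (R_ind T E \<phi> W) (undecayed (darts E) W xs n e)
    \<le> ennreal (1 / sqrt e) * (\<integral>\<^sup>+s. ennreal (sqrt s) \<partial>inv_gauss W) ^ n"
proof -
  let ?P = "\<Pi>\<^sub>M i\<in>T - {\<phi>}. inv_gauss W"
  let ?J = "(\<lambda>k. xs ! Suc k) ` {..<n}"
  interpret product_prob_space "\<lambda>_. inv_gauss W" "T - {\<phi>}"
    by (rule product_prob_spaceI) (rule prob_space_inv_gauss[OF W])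
  have inj: "inj_on (\<lambda>k. xs ! Suc k) {..<n}"
    using xs(2,5) by (auto simp: inj_on_def nth_eq_iff_index_eq)
  have edge: "(xs ! k, xs ! Suc k) \<in> darts E" "parent E \<phi> (xs ! Suc k) = xs ! k" "xs ! Suc k \<noteq> \<phi>" "xs ! Suc k \<in> T" if "k < n" for k
    using parent_nth[OF xs(1-3), of k] that xs(4,5) nth_mem[of "Suc k" xs] by (auto simp: darts_def)
  have J: "finite ?J" "?J \<subseteq> T - {\<phi>}" "card ?J = n"
    using edge inj by (auto simp: card_image)
  have rate: "2 / W * ind_rates E \<phi> W A (xs ! k, xs ! Suc k) = A (xs ! Suc k)"
    "ind_rates E \<phi> W A (xs ! k, xs ! Suc k) = W / 2 * A (xs ! Suc k)" if "k < n" for A k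
    using edge[OF that] W by (auto simp: ind_rates_def)
  have fpos: "AE A in ?P. \<forall>j\<in>?J. 0 < A j"
  proof (rule AE_finite_allI[OF J(1)])
    fix j assume "j \<in> ?J"
    then have "j \<in> T - {\<phi>}" using J(2) by blast
    then show "AE A in ?P. 0 < A j"
      by (intro AE_PiM_component[of _ _ _ "\<lambda>s. 0 < s"] prob_space_inv_gauss[OF W] AE_inv_gauss_pos)
  qed
  let ?D = "undecayed (darts E) W xs n e"
  have D: "?D \<in> sets (\<Pi>\<^sub>M e\<in>darts E. borel)" by (rule undecayed_sets) (rule edge)
  have "emeasure (R_ind T E \<phi> W) ?D = emeasure ?P (ind_rates E \<phi> W -` ?D \<inter> space ?P)"
    unfolding R_ind_def by (rule emeasure_distr[OF ind_rates_measurable D])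
  also have "\<dots> = (\<integral>\<^sup>+A. indicator (ind_rates E \<phi> W -` ?D \<inter> space ?P) A \<partial>?P)"
    using measurable_sets[OF ind_rates_measurable D] by simp
  also have "\<dots> \<le> (\<integral>\<^sup>+A. ennreal (1 / sqrt e) * (\<Prod>j\<in>?J. ennreal (sqrt (A j))) \<partial>?P)"
  proof (rule nn_integral_mono_AE)
    show "AE A in ?P. indicator (ind_rates E \<phi> W -` ?D \<inter> space ?P) A \<le> ennreal (1 / sqrt e) * (\<Prod>j\<in>?J. ennreal (sqrt (A j)))"
      using fpos
    proof eventually_elim
      case (elim A)
      show ?case
      proof (cases "A \<in> ind_rates E \<phi> W -` ?D \<inter> space ?P")
        case True
        have "\<not> (\<exists>k<n. ind_rates E \<phi> W A (xs ! k, xs ! Suc k) = 0)"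
          using elim W by (auto simp: rate(2)) (metis (mono_tags) imageI lessThan_iff less_irrefl)
        then have "e \<le> (\<Prod>k<n. 2 / W * ind_rates E \<phi> W A (xs ! k, xs ! Suc k))"
          using True by (auto simp: undecayed_def)
        also have "\<dots> = (\<Prod>k<n. A (xs ! Suc k))" by (intro prod.cong refl rate(1)) simp
        also have "\<dots> = (\<Prod>j\<in>?J. A j)" using inj by (simp add: prod.reindex)
        finally have "e \<le> (\<Prod>j\<in>?J. A j)" .
        then have "sqrt e \<le> sqrt (\<Prod>j\<in>?J. A j)" by simp
        also have "\<dots> = (\<Prod>j\<in>?J. sqrt (A j))"
        proof -
          have "sqrt (\<Prod>j\<in>X. A j) = (\<Prod>j\<in>X. sqrt (A j))" for X
            by (induction X rule: infinite_finite_induct) (auto simp: real_sqrt_mult)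
          then show ?thesis .
        qed
        finally have "1 \<le> 1 / sqrt e * (\<Prod>j\<in>?J. sqrt (A j))" using e by (simp add: field_simps)
        then have "ennreal 1 \<le> ennreal (1 / sqrt e * (\<Prod>j\<in>?J. sqrt (A j)))" by (rule ennreal_leI)
        also have "\<dots> = ennreal (1 / sqrt e) * (\<Prod>j\<in>?J. ennreal (sqrt (A j)))"
        proof -
          have "(\<Prod>j\<in>?J. ennreal (sqrt (A j))) = ennreal (\<Prod>j\<in>?J. sqrt (A j))"
          proof (rule prod_ennreal)
            fix j assume "j \<in> ?J"
            then have "0 < A j" using elim by blast
            then show "0 \<le> sqrt (A j)" by simp
          qed
          then show ?thesis using e by (simp only:) (subst ennreal_mult', auto)
        qed
        finally show ?thesis using True by simp
      qed simp
    qed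
  qed
  also have "\<dots> = ennreal (1 / sqrt e) * (\<integral>\<^sup>+A. (\<Prod>j\<in>?J. ennreal (sqrt (A j))) \<partial>?P)"
  proof (rule nn_integral_cmult, rule borel_measurable_prod_ennreal)
    fix j assume "j \<in> ?J"
    then have "j \<in> T - {\<phi>}" using J(2) by blast
    then have "(\<lambda>A. A j) \<in> ?P \<rightarrow>\<^sub>M inv_gauss W" by (rule measurable_component_singleton)
    then show "(\<lambda>A. ennreal (sqrt (A j))) \<in> borel_measurable ?P"
      by (rule measurable_compose) simp
  qed
  also have "(\<integral>\<^sup>+A. (\<Prod>j\<in>?J. ennreal (sqrt (A j))) \<partial>?P) = (\<integral>\<^sup>+s. ennreal (sqrt s) \<partial>inv_gauss W) ^ n"
    using nn_integral_prod_inv_gauss[OF W J(1,2), of "\<lambda>s. ennreal (sqrt s)"] J(3) by simp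
  finally show ?thesis .
qed

lemma (in prob_space) prob_large_small:
  fixes X :: "'a \<Rightarrow> real"
  assumes [measurable]: "X \<in> borel_measurable M" and e: "0 < e"
  shows "\<exists>K>0. prob {x\<in>space M. K < X x} < e"
proof -
  have "(\<lambda>n::nat. prob {x\<in>space M. real n < X x}) \<longlonglongrightarrow> prob (\<Inter>n::nat. {x\<in>space M. real n < X x})"
    by (intro finite_Lim_measure_decseq) (auto simp: decseq_def)
  moreover have "(\<Inter>n::nat. {x\<in>space M. real n < X x}) = {}"
  proof -
    have "\<exists>n::nat. \<not> real n < X x" for x using reals_Archimedean2[of "X x"] by (meson less_asym)
    then show ?thesis by blast
  qed
  ultimately have "(\<lambda>n::nat. prob {x\<in>space M. real n < X x}) \<longlonglongrightarrow> 0" by simp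
  then have "eventually (\<lambda>n. prob {x\<in>space M. real n < X x} < e) sequentially"
    using e by (rule order_tendstoD)
  then obtain m where m: "\<And>n. m \<le> n \<Longrightarrow> prob {x\<in>space M. real n < X x} < e"
    by (auto simp: eventually_sequentially)
  show ?thesis using m[of "Suc m"] by (intro exI[of _ "real (Suc m)"]) auto
qed

locale transient_env = tree_env E W T + exhausted_graph E W T V
  for E :: "'v set set" and W and T and V +
  fixes \<phi> assumes \<phi>: "\<phi> \<in> T"
begin

abbreviation "PM \<equiv> N \<Otimes>\<^sub>M gamma_half"

lemma measurable_Green:
  "(\<lambda>z. Green E W V (fst z) (snd z) i j) \<in> borel_measurable PM"
proof -
  have [measurable]: "(\<lambda>z. psi E W V (fst z) x) \<in> borel_measurable PM" for x
    by (rule measurable_compose[OF measurable_fst measurable_limits(1)])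
  have [measurable]: "(\<lambda>z. Ghat E W V (fst z) i j) \<in> borel_measurable PM"
    by (rule measurable_compose[OF measurable_fst measurable_limits(2)])
  have [measurable]: "snd \<in> borel_measurable PM"
    using measurable_snd[of N gamma_half] by simp
  show ?thesis unfolding Green_def by measurable
qed

lemma st_rates_measurable:
  "st_rates E \<phi> W V \<in> PM \<rightarrow>\<^sub>M (\<Pi>\<^sub>M e\<in>darts E. borel)"
proof -
  note [measurable] = measurable_Green
  have "(\<lambda>z. \<lambda>e\<in>darts E. case e of (i, j) \<Rightarrow>
      1/2 * w i j * (Green E W V (fst z) (snd z) \<phi> j / Green E W V (fst z) (snd z) \<phi> i))
    \<in> PM \<rightarrow>\<^sub>M (\<Pi>\<^sub>M e\<in>darts E. borel)"
  proof (rule measurable_restrict)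
    fix e :: "'v \<times> 'v" assume "e \<in> darts E"
    show "(\<lambda>z. case e of (i, j) \<Rightarrow>
      1/2 * w i j * (Green E W V (fst z) (snd z) \<phi> j / Green E W V (fst z) (snd z) \<phi> i)) \<in> borel_measurable PM"
      by (cases e) (simp, measurable)
  qed
  then show ?thesis by (simp add: st_rates_def[abs_def] case_prod_beta')
qed

text \<open>Three bounds that are uniform in the path are combined: \<open>\<gamma> \<le> g0\<close> with probability at least 1/2, \<open>G(\<phi>, \<phi>) \<le> K\<close>
  up to probability 1/8, and \<open>\<psi>\<close> is at least 1/2 at both ends of the path with probability at least 1/2.
  On the intersection \<open>G(\<phi>, x) / G(\<phi>, \<phi>)\<close> is at least \<open>1 / (8 g0 K)\<close>.\<close>

lemma R_st_undecayed:
  "\<exists>e>0. \<forall>n xs. walk E xs \<longrightarrow> distinct xs \<longrightarrow> hd xs = \<phi> \<longrightarrow> set xs \<subseteq> T \<longrightarrow> length xs = Suc n \<longrightarrow>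
     ennreal (1/8) \<le> emeasure (R_st T E \<phi> W V) (undecayed (darts E) W xs n e)"
proof -
  interpret gam: prob_space gamma_half by (rule prob_space_gamma_half)
  interpret pp: pair_prob_space N gamma_half ..
  have [measurable]: "(\<lambda>z. Green E W V (fst z) (snd z) i j) \<in> borel_measurable PM" for i j by (rule measurable_Green)
  have [measurable]: "(\<lambda>\<beta>. psi E W V \<beta> x) \<in> borel_measurable N" for x by (rule measurable_limits)
  obtain K where K: "0 < K" "pp.prob {z\<in>space PM. K < Green E W V (fst z) (snd z) \<phi> \<phi>} < 1/8"
    using pp.prob_large_small[OF measurable_Green, of "1/8" \<phi> \<phi>] by auto
  obtain g0 where g0: "0 < g0" "gam.prob {x\<in>space gamma_half. g0 < x} < 1/2"
    using gam.prob_large_small[of "\<lambda>x. x" "1/2"] by auto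
  let ?e = "1 / (8 * g0 * K)"
  let ?good = "\<lambda>\<beta>. \<forall>x\<in>T. (\<lambda>n. psi_n E W (V n) \<beta> x) \<longlonglongrightarrow> psi E W V \<beta> x \<and> 0 \<le> psi E W V \<beta> x \<and>
     (\<forall>y\<in>T. 0 \<le> Ghat E W V \<beta> x y)"
  obtain N0 where N0: "{\<beta>\<in>space N. \<not> ?good \<beta>} \<subseteq> N0" "emeasure N N0 = 0" "N0 \<in> sets N"
    using AE_limits by (rule AE_E)
  have E2: "1/2 \<le> gam.prob {x. 0 < x \<and> x \<le> g0}"
  proof -
    have "AE x in gamma_half. x \<in> {x. 0 < x \<and> x \<le> g0} \<union> {x\<in>space gamma_half. g0 < x}"
      using AE_gamma_half_pos by eventually_elim auto
    then have "gam.prob ({x. 0 < x \<and> x \<le> g0} \<union> {x\<in>space gamma_half. g0 < x}) = 1"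
      by (subst gam.prob_eq_1) auto
    moreover have "gam.prob ({x. 0 < x \<and> x \<le> g0} \<union> {x\<in>space gamma_half. g0 < x})
        \<le> gam.prob {x. 0 < x \<and> x \<le> g0} + gam.prob {x\<in>space gamma_half. g0 < x}"
      by (rule measure_Un_le) auto
    ultimately show ?thesis using g0 by simp
  qed
  have psi_low: "prob {\<beta>\<in>space N. psi E W V \<beta> x < 1/2} \<le> 1/4" if "x \<in> T" for x
    using psi_small_unlikely[OF _ V_finite V_sub] by (intro prob_psi_less that) auto
  have main: "ennreal (1/8) \<le> emeasure (R_st T E \<phi> W V) (undecayed (darts E) W xs n ?e)"
    if xs: "walk E xs" "distinct xs" "hd xs = \<phi>" "set xs \<subseteq> T" "length xs = Suc n" for n xs
  proof -
    define x where "x = last xs"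
    have ne: "xs \<noteq> []" using xs(5) by auto
    have xT: "x \<in> T" using xs(4) ne by (auto simp: x_def)
    have ends: "xs ! 0 = \<phi>" "xs ! n = x" using xs(3,5) ne by (auto simp: hd_conv_nth last_conv_nth x_def)
    have edge: "(xs ! k, xs ! Suc k) \<in> darts E" "w (xs ! k) (xs ! Suc k) = W" if "k < n" for k
      using parent_nth(3)[OF xs(1-3), of k] that xs(5) by (auto simp: darts_def cond_def)
    let ?E1 = "{\<beta>\<in>space N. 1/2 \<le> psi E W V \<beta> \<phi> \<and> 1/2 \<le> psi E W V \<beta> x} - N0"
    let ?E2 = "{x. 0 < x \<and> x \<le> g0} :: real set"
    let ?B1 = "{\<beta>\<in>space N. psi E W V \<beta> \<phi> < 1/2}" and ?B2 = "{\<beta>\<in>space N. psi E W V \<beta> x < 1/2}"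
    have E1s: "?E1 \<in> sets N" using N0(3) by measurable
    have E1: "1/2 \<le> prob ?E1"
    proof -
      have "space N \<subseteq> ?E1 \<union> (?B1 \<union> ?B2 \<union> N0)" by auto
      then have "prob (space N) \<le> prob (?E1 \<union> (?B1 \<union> ?B2 \<union> N0))"
        using E1s N0(3) by (intro finite_measure_mono) auto
      also have "\<dots> \<le> prob ?E1 + prob (?B1 \<union> ?B2 \<union> N0)"
        using E1s N0(3) by (intro measure_Un_le) auto
      also have "prob (?B1 \<union> ?B2 \<union> N0) \<le> prob (?B1 \<union> ?B2) + prob N0" using N0(3) by (intro measure_Un_le) auto
      also have "prob (?B1 \<union> ?B2) \<le> prob ?B1 + prob ?B2" by (intro measure_Un_le) auto
      finally have "1 \<le> prob ?E1 + (prob ?B1 + prob ?B2 + prob N0)" by (simp only: prob_space)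
      moreover have "prob N0 = 0" using N0(2) by (simp add: measure_def)
      ultimately show ?thesis using psi_low[OF \<phi>] psi_low[OF xT] by linarith
    qed
    let ?E3 = "{z\<in>space PM. K < Green E W V (fst z) (snd z) \<phi> \<phi>}"
    have E12: "1/4 \<le> pp.prob (?E1 \<times> ?E2)"
    proof -
      have "?E2 \<in> sets gamma_half" by simp
      then have "pp.prob (?E1 \<times> ?E2) = prob ?E1 * gam.prob ?E2"
        using E1s by (simp add: measure_def gam.emeasure_pair_measure_Times enn2real_mult)
      moreover have "1/2 * (1/2) \<le> prob ?E1 * gam.prob ?E2" using E1 E2 by (intro mult_mono) auto
      ultimately show ?thesis by simp
    qed
    have E12s: "?E1 \<times> ?E2 \<in> sets PM" using E1s by (intro pair_measureI) auto
    have E3s: "?E3 \<in> sets PM" by measurable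
    have "pp.prob (?E1 \<times> ?E2) \<le> pp.prob ((?E1 \<times> ?E2 - ?E3) \<union> ?E3)"
      by (intro pp.finite_measure_mono sets.Un sets.Diff E12s E3s) blast
    also have "\<dots> \<le> pp.prob (?E1 \<times> ?E2 - ?E3) + pp.prob ?E3"
      by (intro measure_Un_le sets.Diff E12s E3s)
    finally have big: "1/8 \<le> pp.prob (?E1 \<times> ?E2 - ?E3)" using E12 K(2) by simp
    let ?D = "undecayed (darts E) W xs n ?e"
    have D: "?D \<in> sets (\<Pi>\<^sub>M e\<in>darts E. borel)" by (rule undecayed_sets) (rule edge)
    have sub: "?E1 \<times> ?E2 - ?E3 \<subseteq> st_rates E \<phi> W V -` ?D \<inter> space PM"
    proof
      fix z assume z: "z \<in> ?E1 \<times> ?E2 - ?E3"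
      obtain \<beta> \<gamma> where zz: "z = (\<beta>, \<gamma>)" by (cases z)
      have b: "\<beta> \<in> space N" "1/2 \<le> psi E W V \<beta> \<phi>" "1/2 \<le> psi E W V \<beta> x" "0 < \<gamma>" "\<gamma> \<le> g0" and bg: "?good \<beta>"
        using z zz N0(1) by auto
      have zs: "z \<in> space PM" using b zz by (simp add: space_pair_measure)
      let ?G = "Green E W V \<beta> \<gamma> \<phi>"
      have GK: "?G \<phi> \<le> K" using z zz zs by auto
      have Glow: "1 / (8 * g0) \<le> ?G x"
      proof -
        have "1/2 * (1/2) \<le> psi E W V \<beta> \<phi> * psi E W V \<beta> x" using b by (intro mult_mono) auto
        then have "1 / (2 * g0) * (1/4) \<le> 1 / (2 * \<gamma>) * (psi E W V \<beta> \<phi> * psi E W V \<beta> x)"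
          using b g0 by (intro mult_mono) (auto intro!: divide_left_mono)
        moreover have "0 \<le> Ghat E W V \<beta> \<phi> x" using bg \<phi> xT by blast
        ultimately show ?thesis by (simp add: Green_def)
      qed
      have Gpos: "0 < ?G \<phi>"
      proof -
        have "0 < 1 / (2 * \<gamma>) * psi E W V \<beta> \<phi> * psi E W V \<beta> \<phi>" using b by (intro mult_pos_pos) auto
        moreover have "0 \<le> Ghat E W V \<beta> \<phi> \<phi>" using bg \<phi> by blast
        ultimately show ?thesis by (simp add: Green_def)
      qed
      let ?r = "st_rates E \<phi> W V z"
      have rk: "?r (xs ! k, xs ! Suc k) = 1/2 * W * (?G (xs ! Suc k) / ?G (xs ! k))" if "k < n" for k
        using edge[OF that] zz by (simp add: st_rates_def)
      have "?r \<in> ?D"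
      proof (cases "\<exists>k<n. ?r (xs ! k, xs ! Suc k) = 0")
        case True
        then show ?thesis using measurable_space[OF st_rates_measurable zs] by (simp add: undecayed_def)
      next
        case False
        then have nz: "?G (xs ! Suc k) \<noteq> 0" if "k < n" for k using rk[OF that] that by auto
        have nz0: "?G (xs ! k) \<noteq> 0" if "k \<le> n" for k
          using that nz[of "k - 1"] Gpos ends(1) by (cases k) auto
        have tel: "m \<le> n \<Longrightarrow> (\<Prod>k<m. ?G (xs ! Suc k) / ?G (xs ! k)) = ?G (xs ! m) / ?G (xs ! 0)" for m
        proof (induction m)
          case 0
          show ?case using nz0[of 0] by simp
        next
          case (Suc m)
          then show ?case using nz0[of m] by simp
        qed
        have "(\<Prod>k<n. 2 / W * ?r (xs ! k, xs ! Suc k)) = (\<Prod>k<n. ?G (xs ! Suc k) / ?G (xs ! k))"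
          using W_pos by (intro prod.cong refl) (simp add: rk)
        also have "\<dots> = ?G x / ?G \<phi>" using tel[of n] ends by simp
        finally have pr: "(\<Prod>k<n. 2 / W * ?r (xs ! k, xs ! Suc k)) = ?G x / ?G \<phi>" .
        have "?e = 1 / (8 * g0) / K" by simp
        also have "\<dots> \<le> ?G x / ?G \<phi>" using Glow GK Gpos g0 by (intro frac_le) (auto intro: order_trans[OF _ Glow])
        finally show ?thesis using pr measurable_space[OF st_rates_measurable zs] by (simp add: undecayed_def)
      qed
      then show "z \<in> st_rates E \<phi> W V -` ?D \<inter> space PM" using zs by simp
    qed
    have "ennreal (1/8) \<le> ennreal (pp.prob (?E1 \<times> ?E2 - ?E3))" by (rule ennreal_leI[OF big])
    also have "\<dots> = emeasure PM (?E1 \<times> ?E2 - ?E3)" by (simp add: pp.emeasure_eq_measure)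
    also have "\<dots> \<le> emeasure PM (st_rates E \<phi> W V -` ?D \<inter> space PM)"
      by (rule emeasure_mono[OF sub]) (rule measurable_sets[OF st_rates_measurable D])
    also have "\<dots> = emeasure (R_st T E \<phi> W V) ?D"
      unfolding R_st_def by (rule emeasure_distr[OF st_rates_measurable D, symmetric])
    finally show ?thesis .
  qed
  have "0 < ?e" using K g0 by simp
  then show ?thesis using main by (intro exI[of _ ?e]) blast
qed

lemma R_ind_neq_R_st: "R_ind T E \<phi> W \<noteq> R_st T E \<phi> W V"
proof
  assume eq: "R_ind T E \<phi> W = R_st T E \<phi> W V"
  obtain e where e: "0 < e" "\<And>n xs. walk E xs \<Longrightarrow> distinct xs \<Longrightarrow> hd xs = \<phi> \<Longrightarrow> set xs \<subseteq> T \<Longrightarrow> length xs = Suc n \<Longrightarrow>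
     ennreal (1/8) \<le> emeasure (R_st T E \<phi> W V) (undecayed (darts E) W xs n e)"
    using R_st_undecayed by blast
  define c where "c = enn2real (\<integral>\<^sup>+s. ennreal (sqrt s) \<partial>inv_gauss W)"
  have c: "(\<integral>\<^sup>+s. ennreal (sqrt s) \<partial>inv_gauss W) = ennreal c" "0 \<le> c" "c < 1"
  proof -
    show 1: "(\<integral>\<^sup>+s. ennreal (sqrt s) \<partial>inv_gauss W) = ennreal c"
      unfolding c_def using inv_gauss_sqrt_mean_less_1[OF W_pos]
      by (intro ennreal_enn2real[symmetric]) (auto intro: less_trans)
    show c0: "0 \<le> c" by (simp add: c_def)
    show "c < 1" using inv_gauss_sqrt_mean_less_1[OF W_pos] c0 unfolding 1 by (simp add: ennreal_less_one_iff)
  qed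
  have "1/8 \<le> 1 / sqrt e * c ^ n" for n
  proof -
    obtain xs where xs: "walk E xs" "distinct xs" "hd xs = \<phi>" "set xs \<subseteq> T" "length xs = Suc n"
      using long_distinct_walk[OF \<phi>, of n] finite_nbrs degree by blast
    have "ennreal (1/8) \<le> ennreal (1 / sqrt e) * ennreal c ^ n"
      using e(2)[OF xs] R_ind_undecayed[OF W_pos \<phi> xs e(1)] unfolding eq c(1) by (rule order_trans)
    also have "\<dots> = ennreal (1 / sqrt e) * ennreal (c ^ n)" using c(2) by (simp only: ennreal_power)
    also have "\<dots> = ennreal (1 / sqrt e * c ^ n)" using e(1) by (intro ennreal_mult'[symmetric]) simp
    finally show ?thesis using c(2) e(1) by (subst (asm) ennreal_le_iff) auto
  qed
  moreover have "(\<lambda>n. 1 / sqrt e * c ^ n) \<longlonglongrightarrow> 1 / sqrt e * 0"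
    using c by (intro tendsto_intros LIMSEQ_realpow_zero)
  ultimately have "1/8 \<le> 1 / sqrt e * (0 :: real)" by (intro LIMSEQ_le_const) auto
  then show False by simp
qed

end

theorem proposition2p7:
  fixes T :: "'v set" and E :: "'v set set" and \<phi> :: 'v and d :: nat
  assumes "tree T E" and "infinite T" and "d \<ge> 3" and "regular T E d" and "\<phi> \<in> T"
  shows "\<forall>\<^sub>F W :: real in at_top. \<forall>V. exhaustion T E V \<longrightarrow> R_ind T E \<phi> W \<noteq> R_st T E \<phi> W V"
  using eventually_ge_at_top[of "262400 :: real"]
proof eventually_elim
  case (elim W)
  show ?case
  proof (intro allI impI)
    fix V assume V: "exhaustion T E V"
    interpret tg: tree_graph T E by unfold_locales (rule assms)
    interpret transient_env E W T V \<phi>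
    proof unfold_locales
      show "{i} \<notin> E" for i using tg.edge_in_T(3)[of i i] by auto
      show "finite (nbrs E i)" for i
      proof (cases "i \<in> T")
        case True then show ?thesis using assms(4) by (simp add: regular_def)
      next
        case False
        then have "nbrs E i = {}" using tg.edge_in_T(1) by (auto simp: nbrs_def)
        then show ?thesis by simp
      qed
      show "0 < W" "262400 \<le> W" using elim by simp_all
      show "3 \<le> card (nbrs E i)" if "i \<in> T" for i using assms(3,4) that by (simp add: regular_def)
      show "incseq V" "finite (V n)" "(\<Union>n. V n) = T" for n using V by (simp_all add: exhaustion_def)
    qed (rule assms)+
    show "R_ind T E \<phi> W \<noteq> R_st T E \<phi> W V" by (rule R_ind_neq_R_st)
  qed
qed

end
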